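(* Let $M$ be a complete connected Riemannian manifold of dimension $n$. Consider on $M$ the stochastic differential equation $dx_t=X(x_t)\circ dB_t+A(x_t)\,dt$ with $C^2$ coefficients, and suppose it is complete at one point (there is $x_0\in M$ with $\xi(x_0)=\infty$ a.s.). Let $1\le d\le n$. Suppose that for each positive number $t$ and each compact set $K\subset M$ there is a number $\delta>0$ such that $$\sup_{x\in K}E\left(\sup_{s\le t}|T_xF_s|^{d+\delta}\chi_{\{s<\xi(x)\}}\right)<\infty .$$ Then $\xi^K=\infty$ almost surely for each $K\in L_d$. In particular the equation is strongly $d$-complete.
   Context: $\{\Omega,\mathcal F,\mathcal F_t,P\}$ is a filtered probability space satisfying the usual conditions, $B_t$ is an $\mathbb R^m$-valued Brownian motion, $X(x):\mathbb R^m\to T_xM$ is linear for each $x\in M$, $A$ is a vector field, and $\circ$ denotes the Stratonovich integral. $F_t(x)$ is the maximal solution starting from $x$, with explosion time $\xi(x)$; $(F_t(\cdot),\xi(\cdot))$ is the partial flow, i.e. the version for which, almost surely, for each $t$ the set $\{x:t<\xi(x,\omega)\}$ is open, $F_t(\cdot,\omega)$ is a $C^{1}$ diffeomorphism of this set onto an open subset of $M$ depending continuously on $t$ (in the topology of $C^1$ convergence on compacta), and, for $K$ compact and $\xi^K:=\inf_{x\in K}\xi(x)$, $\lim_{t\nearrow \xi^K}\sup_{x\in K}d(x_0,F_t(x))=\infty$ a.s. on $\{\xi^K<\infty\}$. $T_xF_t:T_xM\to T_{F_t(x)}M$ is the derivative of $F_t$ at $x$ (the derivative flow); $v_t=T_xF_t(v)$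 solves $Dv_t=\nabla X(v_t)\circ dB_t+\nabla A(v_t)\,dt$, $v_0=v$. $L_d$ is the set of images of maps $\alpha:[0,1]^d\to M$ which are Lipschitz continuous, i.e. $d(\alpha(\underline s),\alpha(\underline t))\le c|\underline s-\underline t|$ for some constant $c$ (with $d(\cdot,\cdot)$ the Riemannian distance). The equation is strongly $p$-complete if $\xi^K=\infty$ a.s. for every $K$ that is the image of a smooth singular $p$-simplex (smooth meaning that it extends smoothly over an open neighbourhood of the standard simplex). *)

theory Defs
  imports "HOL-Probability.Probability"
begin

section \<open>Smooth manifolds\<close>

text \<open>
  The manifold is (the universe of) a topological type, the dimension is \<open>CARD('n)\<close>.
  A chart is a pair of an open domain and a coordinate map; the values of the coordinate map
  outside its domain are irrelevant.
\<close>

type_synonym ('m, 'n) chart = "'m set \<times> ('m \<Rightarrow> real ^ 'n)"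

abbreviation chart_inv :: "('m, 'n) chart \<Rightarrow> real ^ 'n \<Rightarrow> 'm" where
  "chart_inv c \<equiv> inv_into (fst c) (snd c)"

text \<open>For open \<open>S\<close>, \<open>Ck_on k f S\<close> says that \<open>f\<close> is of class \<open>C\<^sup>k\<close> on \<open>S\<close>: all iterated
  directional derivatives up to order \<open>k\<close> exist as total derivatives and are continuous.\<close>

fun Ck_on :: "nat \<Rightarrow> ('a::euclidean_space \<Rightarrow> 'b::real_normed_vector) \<Rightarrow> 'a set \<Rightarrow> bool" where
  "Ck_on 0 f S \<longleftrightarrow> continuous_on S f"
| "Ck_on (Suc k) f S \<longleftrightarrow>
     (\<forall>x\<in>S. f differentiable (at x)) \<and> (\<forall>e. Ck_on k (\<lambda>x. frechet_derivative f (at x) e) S)"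

definition smooth_on :: "('a::euclidean_space \<Rightarrow> 'b::real_normed_vector) \<Rightarrow> 'a set \<Rightarrow> bool" where
  "smooth_on f S \<longleftrightarrow> (\<forall>k. Ck_on k f S)"

definition smooth_atlas :: "('m::topological_space, 'n::finite) chart set \<Rightarrow> bool" where
  "smooth_atlas atl \<longleftrightarrow>
     (\<Union>c\<in>atl. fst c) = UNIV \<and>
     (\<forall>c\<in>atl. open (fst c) \<and> open (snd c ` fst c) \<and>
        homeomorphism (fst c) (snd c ` fst c) (snd c) (chart_inv c)) \<and>
     (\<forall>c\<in>atl. \<forall>c'\<in>atl. smooth_on (snd c' \<circ> chart_inv c) (snd c ` (fst c \<inter> fst c')))"

definition charts_at :: "('m, 'n) chart set \<Rightarrow> 'm \<Rightarrow> ('m, 'n) chart set" where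
  "charts_at atl x = {c \<in> atl. x \<in> fst c}"

definition some_chart :: "('m, 'n) chart set \<Rightarrow> 'm \<Rightarrow> ('m, 'n) chart" where
  "some_chart atl x = (SOME c. c \<in> charts_at atl x)"

text \<open>
  A tangent vector at \<open>x\<close> is a family of coordinate vectors, one for every chart at \<open>x\<close>, related
  by the derivatives of the transition maps.  At all other indices the family is \<open>0\<close>, so that
  linear structure and equality are those of functions.
\<close>

type_synonym ('m, 'n) tvec = "('m, 'n) chart \<Rightarrow> real ^ 'n"

definition tangent_space ::
  "('m, 'n::finite) chart set \<Rightarrow> 'm \<Rightarrow> ('m, 'n) tvec set" where
  "tangent_space atl x =
     {v. (\<forall>c\<in>charts_at atl x. \<forall>c'\<in>charts_at atl x.
            v c' = frechet_derivative (snd c' \<circ> chart_inv c) (at (snd c x)) (v c)) \<and>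
         (\<forall>c. c \<notin> charts_at atl x \<longrightarrow> v c = 0)}"

text \<open>The tangent vector at \<open>x\<close> with coordinates \<open>u\<close> in the chart \<open>c\<close>.\<close>

definition coord_vec ::
  "('m, 'n::finite) chart set \<Rightarrow> ('m, 'n) chart \<Rightarrow> 'm \<Rightarrow> real ^ 'n \<Rightarrow> ('m, 'n) tvec" where
  "coord_vec atl c x u =
     (\<lambda>c'. if c' \<in> charts_at atl x
           then frechet_derivative (snd c' \<circ> chart_inv c) (at (snd c x)) u else 0)"

text \<open>The derivative \<open>T\<^sub>xf\<close> of a map from (an open part of) the manifold to the manifold.\<close>

definition tangent_map ::
  "('m, 'n::finite) chart set \<Rightarrow> ('m \<Rightarrow> 'm) \<Rightarrow> 'm \<Rightarrow> ('m, 'n) tvec \<Rightarrow> ('m, 'n) tvec" where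
  "tangent_map atl f x v =
     (let c = some_chart atl x in
      (\<lambda>c'. if c' \<in> charts_at atl (f x)
            then frechet_derivative (snd c' \<circ> f \<circ> chart_inv c) (at (snd c x)) (v c) else 0))"

text \<open>The differential \<open>df\<^sub>x(v)\<close> of a real function.\<close>

definition differential ::
  "('m, 'n::finite) chart set \<Rightarrow> ('m \<Rightarrow> real) \<Rightarrow> 'm \<Rightarrow> ('m, 'n) tvec \<Rightarrow> real" where
  "differential atl f x v =
     (let c = some_chart atl x in
      frechet_derivative (f \<circ> chart_inv c) (at (snd c x)) (v c))"

definition smooth_function :: "('m, 'n::finite) chart set \<Rightarrow> ('m \<Rightarrow> real) \<Rightarrow> bool" where
  "smooth_function atl f \<longleftrightarrow> (\<forall>c\<in>atl. smooth_on (f \<circ> chart_inv c) (snd c ` fst c))"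

definition Ck_vector_field ::
  "nat \<Rightarrow> ('m, 'n::finite) chart set \<Rightarrow> ('m \<Rightarrow> ('m, 'n) tvec) \<Rightarrow> bool" where
  "Ck_vector_field k atl A \<longleftrightarrow>
     (\<forall>x. A x \<in> tangent_space atl x) \<and>
     (\<forall>c\<in>atl. Ck_on k (\<lambda>z. A (chart_inv c z) c) (snd c ` fst c))"

text \<open>\<open>C\<^sup>1\<close> maps and diffeomorphisms defined on an open subset \<open>S\<close> of the manifold.\<close>

definition C1_map_on ::
  "('m::topological_space, 'n::finite) chart set \<Rightarrow> 'm set \<Rightarrow> ('m \<Rightarrow> 'm) \<Rightarrow> bool" where
  "C1_map_on atl S f \<longleftrightarrow>
     continuous_on S f \<and>
     (\<forall>c\<in>atl. \<forall>c'\<in>atl.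
        Ck_on 1 (snd c' \<circ> f \<circ> chart_inv c) (snd c ` (S \<inter> fst c \<inter> f -` fst c')))"

definition C1_open_diffeo ::
  "('m::topological_space, 'n::finite) chart set \<Rightarrow> 'm set \<Rightarrow> ('m \<Rightarrow> 'm) \<Rightarrow> bool" where
  "C1_open_diffeo atl S f \<longleftrightarrow>
     inj_on f S \<and> open (f ` S) \<and> C1_map_on atl S f \<and> C1_map_on atl (f ` S) (inv_into S f)"

section \<open>Riemannian metrics\<close>

type_synonym ('m, 'n) metric_tensor = "'m \<Rightarrow> ('m, 'n) tvec \<Rightarrow> ('m, 'n) tvec \<Rightarrow> real"

definition riemannian_metric ::
  "('m, 'n::finite) chart set \<Rightarrow> ('m, 'n) metric_tensor \<Rightarrow> bool" where
  "riemannian_metric atl g \<longleftrightarrow>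
     (\<forall>x. \<forall>u\<in>tangent_space atl x. \<forall>v\<in>tangent_space atl x.
        g x u v = g x v u \<and> (u \<noteq> (\<lambda>_. 0) \<longrightarrow> g x u u > 0) \<and>
        (\<forall>w\<in>tangent_space atl x. \<forall>a. g x (\<lambda>c. a *\<^sub>R u c + v c) w = a * g x u w + g x v w)) \<and>
     (\<forall>c\<in>atl. \<forall>i j.
        smooth_on (\<lambda>z. g (chart_inv c z) (coord_vec atl c (chart_inv c z) (axis i 1))
                                         (coord_vec atl c (chart_inv c z) (axis j 1)))
                  (snd c ` fst c))"

definition tnorm :: "('m, 'n) metric_tensor \<Rightarrow> 'm \<Rightarrow> ('m, 'n) tvec \<Rightarrow> real" where
  "tnorm g x v = sqrt (g x v v)"

text \<open>The operator norm of \<open>T\<^sub>xf\<close> with respect to the Riemannian norms at \<open>x\<close> and \<open>f x\<close>.\<close>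

definition tangent_map_norm ::
  "('m, 'n::finite) chart set \<Rightarrow> ('m, 'n) metric_tensor \<Rightarrow> ('m \<Rightarrow> 'm) \<Rightarrow> 'm \<Rightarrow> real" where
  "tangent_map_norm atl g f x =
     (SUP v \<in> {v \<in> tangent_space atl x. tnorm g x v \<le> 1}. tnorm g (f x) (tangent_map atl f x v))"

definition C1_curve_on ::
  "('m::topological_space, 'n::finite) chart set \<Rightarrow> (real \<Rightarrow> 'm) \<Rightarrow> real \<Rightarrow> real \<Rightarrow> bool" where
  "C1_curve_on atl \<gamma> a b \<longleftrightarrow>
     continuous_on {a..b} \<gamma> \<and>
     (\<forall>c\<in>atl. \<exists>D.
        (\<forall>t\<in>{a..b} \<inter> \<gamma> -` fst c. ((snd c \<circ> \<gamma>) has_vector_derivative D t) (at t within {a..b})) \<and>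
        continuous_on ({a..b} \<inter> \<gamma> -` fst c) D)"

definition piecewise_C1_curve ::
  "('m::topological_space, 'n::finite) chart set \<Rightarrow> (real \<Rightarrow> 'm) \<Rightarrow> bool" where
  "piecewise_C1_curve atl \<gamma> \<longleftrightarrow>
     (\<exists>S. finite S \<and> {0, 1} \<subseteq> S \<and> S \<subseteq> {0..1} \<and>
        (\<forall>a\<in>S. \<forall>b\<in>S. a < b \<and> {a<..<b} \<inter> S = {} \<longrightarrow> C1_curve_on atl \<gamma> a b))"

definition velocity ::
  "('m, 'n::finite) chart set \<Rightarrow> (real \<Rightarrow> 'm) \<Rightarrow> real \<Rightarrow> ('m, 'n) tvec" where
  "velocity atl \<gamma> t =
     (\<lambda>c. if c \<in> charts_at atl (\<gamma> t) then vector_derivative (snd c \<circ> \<gamma>) (at t) else 0)"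

text \<open>The velocity is meaningless only at the finitely many break points.\<close>

definition curve_length ::
  "('m, 'n::finite) chart set \<Rightarrow> ('m, 'n) metric_tensor \<Rightarrow> (real \<Rightarrow> 'm) \<Rightarrow> real" where
  "curve_length atl g \<gamma> = integral {0..1} (\<lambda>t. tnorm g (\<gamma> t) (velocity atl \<gamma> t))"

definition riem_dist ::
  "('m::topological_space, 'n::finite) chart set \<Rightarrow> ('m, 'n) metric_tensor \<Rightarrow> 'm \<Rightarrow> 'm \<Rightarrow> real"
  where
  "riem_dist atl g x y =
     (INF \<gamma> \<in> {\<gamma>. piecewise_C1_curve atl \<gamma> \<and> \<gamma> 0 = x \<and> \<gamma> 1 = y}. curve_length atl g \<gamma>)"

definition complete_connected_riemannian_manifold ::
  "('m::{t2_space, second_countable_topology}, 'n::finite) chart set \<Rightarrow> ('m, 'n) metric_tensor \<Rightarrow> bool"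
  where
  "complete_connected_riemannian_manifold atl g \<longleftrightarrow>
     smooth_atlas atl \<and> riemannian_metric atl g \<and> connected (UNIV :: 'm set) \<and>
     Metric_space.mcomplete UNIV (riem_dist atl g)"

section \<open>Stochastic calculus\<close>

text \<open>Time is \<open>[0,\<infinity>)\<close>, embedded in the reals; nothing is said about negative indices.\<close>

definition usual_filtration :: "'w measure \<Rightarrow> (real \<Rightarrow> 'w measure) \<Rightarrow> bool" where
  "usual_filtration P Fil \<longleftrightarrow>
     prob_space P \<and> complete_measure P \<and>
     (\<forall>t\<ge>0. subalgebra P (Fil t)) \<and>
     (\<forall>s\<ge>0. \<forall>t\<ge>s. sets (Fil s) \<subseteq> sets (Fil t)) \<and>
     (\<forall>t\<ge>0. sets (Fil t) = (\<Inter>s\<in>{t<..}. sets (Fil s))) \<and>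
     null_sets P \<subseteq> sets (Fil 0)"

definition adapted ::
  "(real \<Rightarrow> 'w measure) \<Rightarrow> (real \<Rightarrow> 'w \<Rightarrow> 'b::topological_space) \<Rightarrow> bool" where
  "adapted Fil Y \<longleftrightarrow> (\<forall>t\<ge>0. Y t \<in> borel_measurable (Fil t))"

definition continuous_paths ::
  "'w measure \<Rightarrow> (real \<Rightarrow> 'w \<Rightarrow> 'b::topological_space) \<Rightarrow> bool" where
  "continuous_paths P Y \<longleftrightarrow> (AE \<omega> in P. continuous_on {0..} (\<lambda>t. Y t \<omega>))"

definition brownian_motion ::
  "'w measure \<Rightarrow> (real \<Rightarrow> 'w measure) \<Rightarrow> (real \<Rightarrow> 'w \<Rightarrow> real ^ 'k::finite) \<Rightarrow> bool" where
  "brownian_motion P Fil B \<longleftrightarrow>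
     adapted Fil B \<and> continuous_paths P B \<and> (AE \<omega> in P. B 0 \<omega> = 0) \<and>
     (\<forall>s\<ge>0. \<forall>t>s.
        prob_space.indep_set P (sets (Fil s))
          (sets (vimage_algebra (space P) (\<lambda>\<omega>. B t \<omega> - B s \<omega>) borel)) \<and>
        distributed P lborel (\<lambda>\<omega>. B t \<omega> - B s \<omega>)
          (\<lambda>x. \<Prod>i\<in>UNIV. ennreal (normal_density 0 (sqrt (t - s)) (x $ i))))"

definition is_stopping_time ::
  "'w measure \<Rightarrow> (real \<Rightarrow> 'w measure) \<Rightarrow> ('w \<Rightarrow> ereal) \<Rightarrow> bool" where
  "is_stopping_time P Fil \<tau> \<longleftrightarrow>
     (\<forall>\<omega>\<in>space P. 0 \<le> \<tau> \<omega>) \<and> (\<forall>t\<ge>0. {\<omega> \<in> space P. \<tau> \<omega> \<le> ereal t} \<in> sets (Fil t))"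

definition stopped :: "('w \<Rightarrow> real) \<Rightarrow> (real \<Rightarrow> 'w \<Rightarrow> 'b) \<Rightarrow> real \<Rightarrow> 'w \<Rightarrow> 'b" where
  "stopped \<tau> Y t \<omega> = Y (min t (\<tau> \<omega>)) \<omega>"

definition is_martingale ::
  "'w measure \<Rightarrow> (real \<Rightarrow> 'w measure) \<Rightarrow> (real \<Rightarrow> 'w \<Rightarrow> real) \<Rightarrow> bool" where
  "is_martingale P Fil Y \<longleftrightarrow>
     adapted Fil Y \<and> (\<forall>t\<ge>0. integrable P (Y t)) \<and>
     (\<forall>s\<ge>0. \<forall>t\<ge>s. AE \<omega> in P. real_cond_exp P (Fil s) (Y t) \<omega> = Y s \<omega>)"

definition continuous_local_martingale ::
  "'w measure \<Rightarrow> (real \<Rightarrow> 'w measure) \<Rightarrow> (real \<Rightarrow> 'w \<Rightarrow> real) \<Rightarrow> bool" where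
  "continuous_local_martingale P Fil Y \<longleftrightarrow>
     adapted Fil Y \<and> continuous_paths P Y \<and>
     (\<exists>\<sigma> :: nat \<Rightarrow> 'w \<Rightarrow> real.
        (\<forall>n. is_stopping_time P Fil (\<lambda>\<omega>. ereal (\<sigma> n \<omega>))) \<and>
        (AE \<omega> in P. incseq (\<lambda>n. \<sigma> n \<omega>) \<and> filterlim (\<lambda>n. \<sigma> n \<omega>) at_top sequentially) \<and>
        (\<forall>n. is_martingale P Fil (\<lambda>t \<omega>. stopped (\<sigma> n) Y t \<omega> - Y 0 \<omega>)))"

text \<open>A partition of \<open>[0,t]\<close> into \<open>N\<close> (possibly degenerate) intervals of length less than \<open>\<delta>\<close>.\<close>

definition partition_upto :: "real \<Rightarrow> real \<Rightarrow> nat \<Rightarrow> (nat \<Rightarrow> real) \<Rightarrow> bool" where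
  "partition_upto t \<delta> N p \<longleftrightarrow>
     p 0 = 0 \<and> p N = t \<and> (\<forall>i<N. 0 \<le> p (Suc i) - p i \<and> p (Suc i) - p i < \<delta>)"

definition finite_variation_upto :: "real \<Rightarrow> (real \<Rightarrow> real) \<Rightarrow> bool" where
  "finite_variation_upto t v \<longleftrightarrow>
     (\<exists>C. \<forall>\<delta> N p. partition_upto t \<delta> N p \<longrightarrow> (\<Sum>i<N. \<bar>v (p (Suc i)) - v (p i)\<bar>) \<le> C)"

definition continuous_semimartingale ::
  "'w measure \<Rightarrow> (real \<Rightarrow> 'w measure) \<Rightarrow> (real \<Rightarrow> 'w \<Rightarrow> real) \<Rightarrow> bool" where
  "continuous_semimartingale P Fil Y \<longleftrightarrow>
     (\<exists>M V. continuous_local_martingale P Fil M \<and> adapted Fil V \<and> continuous_paths P V \<and>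
        (AE \<omega> in P. \<forall>t\<ge>0. finite_variation_upto t (\<lambda>s. V s \<omega>)) \<and>
        (AE \<omega> in P. \<forall>t\<ge>0. Y t \<omega> = M t \<omega> + V t \<omega>))"

text \<open>
  \<open>I\<close> is the Stratonovich integral of \<open>Y\<close> against \<open>B\<close>, that is, the limit in probability of the
  sums with the integrand averaged over the end points, as the mesh of the partition tends
  to \<open>0\<close>.  It is used below only for continuous semimartingales, for which the limit exists and is
  the Ito integral plus one half of the bracket.
\<close>

definition has_stratonovich_integral ::
  "'w measure \<Rightarrow> (real \<Rightarrow> 'w measure) \<Rightarrow> (real \<Rightarrow> 'w \<Rightarrow> real ^ 'k::finite) \<Rightarrow>
   (real \<Rightarrow> 'w \<Rightarrow> real ^ 'k) \<Rightarrow> (real \<Rightarrow> 'w \<Rightarrow> real) \<Rightarrow> bool" where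
  "has_stratonovich_integral P Fil Y B I \<longleftrightarrow>
     adapted Fil Y \<and> adapted Fil B \<and> adapted Fil I \<and> continuous_paths P I \<and>
     (\<forall>t\<ge>0. \<forall>\<epsilon>>0. \<exists>\<delta>>0. \<forall>N p. partition_upto t \<delta> N p \<longrightarrow>
        measure P {\<omega> \<in> space P.
          \<bar>(\<Sum>i<N. ((1/2) *\<^sub>R (Y (p i) \<omega> + Y (p (Suc i)) \<omega>)) \<bullet> (B (p (Suc i)) \<omega> - B (p i) \<omega>)) - I t \<omega>\<bar> > \<epsilon>}
        < \<epsilon>)"

section \<open>The stochastic differential equation and its partial flow\<close>

text \<open>
  The coefficient \<open>X x :: real ^ 'k \<Rightarrow> tvec\<close> is linear into the tangent space at \<open>x\<close>; linearity is
  expressed componentwise because the type of tangent vectors carries no vector space class.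
\<close>

definition C2_coefficients ::
  "('m, 'n::finite) chart set \<Rightarrow> ('m \<Rightarrow> real ^ 'k::finite \<Rightarrow> ('m, 'n) tvec) \<Rightarrow>
   ('m \<Rightarrow> ('m, 'n) tvec) \<Rightarrow> bool" where
  "C2_coefficients atl X A \<longleftrightarrow>
     (\<forall>x c. linear (\<lambda>e. X x e c)) \<and> (\<forall>e. Ck_vector_field 2 atl (\<lambda>x. X x e)) \<and>
     Ck_vector_field 2 atl A"

text \<open>
  \<open>y\<close> is a solution on \<open>[0,\<zeta>)\<close> of \<open>dy = X(y) \<circ> dB + A(y) dt\<close> started at \<open>x\<close>; the values of \<open>y\<close>
  from \<open>\<zeta>\<close> on are irrelevant.  The equation is tested on smooth functions,
  \<open>f (y t) = f x + \<integral>\<^sub>0\<^sup>t df (X (y s) \<cdot>) \<circ> dB s + \<integral>\<^sub>0\<^sup>t df (A (y s)) ds\<close>,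
  up to stopping times announcing \<open>\<zeta>\<close>.
\<close>

definition sde_solution ::
  "'w measure \<Rightarrow> (real \<Rightarrow> 'w measure) \<Rightarrow> (real \<Rightarrow> 'w \<Rightarrow> real ^ 'k::finite) \<Rightarrow>
   ('m::topological_space, 'n::finite) chart set \<Rightarrow> ('m \<Rightarrow> real ^ 'k \<Rightarrow> ('m, 'n) tvec) \<Rightarrow>
   ('m \<Rightarrow> ('m, 'n) tvec) \<Rightarrow> 'm \<Rightarrow> (real \<Rightarrow> 'w \<Rightarrow> 'm) \<Rightarrow> ('w \<Rightarrow> ereal) \<Rightarrow> bool" where
  "sde_solution P Fil B atl X A x y \<zeta> \<longleftrightarrow>
     is_stopping_time P Fil \<zeta> \<and>
     (AE \<omega> in P. 0 < \<zeta> \<omega> \<and> y 0 \<omega> = x \<and> continuous_on {t. 0 \<le> t \<and> ereal t < \<zeta> \<omega>} (\<lambda>t. y t \<omega>)) \<and>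
     (\<forall>t\<ge>0. \<forall>U\<in>sets borel. {\<omega> \<in> space P. ereal t < \<zeta> \<omega> \<and> y t \<omega> \<in> U} \<in> sets (Fil t)) \<and>
     (\<exists>\<tau> :: nat \<Rightarrow> 'w \<Rightarrow> real.
        (\<forall>n. is_stopping_time P Fil (\<lambda>\<omega>. ereal (\<tau> n \<omega>))) \<and>
        (AE \<omega> in P. incseq (\<lambda>n. \<tau> n \<omega>) \<and> (\<forall>n. ereal (\<tau> n \<omega>) < \<zeta> \<omega>) \<and>
           (\<lambda>n. ereal (\<tau> n \<omega>)) \<longlonglongrightarrow> \<zeta> \<omega>) \<and>
        (\<forall>n f. smooth_function atl f \<longrightarrow>
           continuous_semimartingale P Fil (stopped (\<tau> n) (\<lambda>t \<omega>. f (y t \<omega>))) \<and>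
           has_stratonovich_integral P Fil
             (stopped (\<tau> n) (\<lambda>t \<omega>. \<chi> i. differential atl f (y t \<omega>) (X (y t \<omega>) (axis i 1))))
             (stopped (\<tau> n) B)
             (stopped (\<tau> n) (\<lambda>t \<omega>. f (y t \<omega>) - f x -
                integral {0..t} (\<lambda>s. differential atl f (y s \<omega>) (A (y s \<omega>)))))))"

definition maximal_solution ::
  "'w measure \<Rightarrow> (real \<Rightarrow> 'w measure) \<Rightarrow> (real \<Rightarrow> 'w \<Rightarrow> real ^ 'k::finite) \<Rightarrow>
   ('m::topological_space, 'n::finite) chart set \<Rightarrow> ('m \<Rightarrow> real ^ 'k \<Rightarrow> ('m, 'n) tvec) \<Rightarrow>
   ('m \<Rightarrow> ('m, 'n) tvec) \<Rightarrow> 'm \<Rightarrow> (real \<Rightarrow> 'w \<Rightarrow> 'm) \<Rightarrow> ('w \<Rightarrow> ereal) \<Rightarrow> bool" where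
  "maximal_solution P Fil B atl X A x y \<zeta> \<longleftrightarrow>
     sde_solution P Fil B atl X A x y \<zeta> \<and>
     (\<forall>y' \<zeta>'. sde_solution P Fil B atl X A x y' \<zeta>' \<longrightarrow> (AE \<omega> in P. \<zeta>' \<omega> \<le> \<zeta> \<omega>))"

text \<open>
  Continuity of \<open>t \<mapsto> F\<^sub>t\<close> for \<open>C\<^sup>1\<close> convergence on compacta, in the form of the weak \<open>C\<^sup>1\<close> topology:
  uniform convergence of the chart expressions and of their derivatives on compact sets contained
  in one chart domain and mapped into one chart domain.  \<open>F\<^sub>t\<close> is defined on \<open>{x. t < \<xi> x}\<close>.
\<close>

definition C1_compacta_continuous ::
  "('m::topological_space, 'n::finite) chart set \<Rightarrow> (real \<Rightarrow> 'm \<Rightarrow> 'm) \<Rightarrow> ('m \<Rightarrow> ereal) \<Rightarrow> bool" where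
  "C1_compacta_continuous atl F \<xi> \<longleftrightarrow>
     (\<forall>t\<ge>0. \<forall>c\<in>atl. \<forall>c'\<in>atl. \<forall>K.
        compact K \<and> K \<subseteq> fst c \<and> (\<forall>x\<in>K. ereal t < \<xi> x) \<and> F t ` K \<subseteq> fst c' \<longrightarrow>
        (\<forall>\<^sub>F s in at t within {0..}. (\<forall>x\<in>K. ereal s < \<xi> x) \<and> F s ` K \<subseteq> fst c') \<and>
        uniform_limit (snd c ` K) (\<lambda>s. snd c' \<circ> F s \<circ> chart_inv c)
          (snd c' \<circ> F t \<circ> chart_inv c) (at t within {0..}) \<and>
        (\<forall>e. uniform_limit (snd c ` K)
          (\<lambda>s z. frechet_derivative (snd c' \<circ> F s \<circ> chart_inv c) (at z) e)
          (\<lambda>z. frechet_derivative (snd c' \<circ> F t \<circ> chart_inv c) (at z) e) (at t within {0..})))"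

definition explosion_time_on :: "('m \<Rightarrow> 'w \<Rightarrow> ereal) \<Rightarrow> 'm set \<Rightarrow> 'w \<Rightarrow> ereal" where
  "explosion_time_on \<xi> K \<omega> = (INF x\<in>K. \<xi> x \<omega>)"

definition partial_flow ::
  "'w measure \<Rightarrow> (real \<Rightarrow> 'w measure) \<Rightarrow> (real \<Rightarrow> 'w \<Rightarrow> real ^ 'k::finite) \<Rightarrow>
   ('m::topological_space, 'n::finite) chart set \<Rightarrow> ('m, 'n) metric_tensor \<Rightarrow>
   ('m \<Rightarrow> real ^ 'k \<Rightarrow> ('m, 'n) tvec) \<Rightarrow> ('m \<Rightarrow> ('m, 'n) tvec) \<Rightarrow>
   (real \<Rightarrow> 'm \<Rightarrow> 'w \<Rightarrow> 'm) \<Rightarrow> ('m \<Rightarrow> 'w \<Rightarrow> ereal) \<Rightarrow> bool" where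
  "partial_flow P Fil B atl g X A F \<xi> \<longleftrightarrow>
     (\<forall>x. maximal_solution P Fil B atl X A x (\<lambda>t. F t x) (\<xi> x)) \<and>
     (AE \<omega> in P.
        (\<forall>x. 0 < \<xi> x \<omega>) \<and>
        (\<forall>t\<ge>0. open {x. ereal t < \<xi> x \<omega>} \<and>
           C1_open_diffeo atl {x. ereal t < \<xi> x \<omega>} (\<lambda>x. F t x \<omega>)) \<and>
        C1_compacta_continuous atl (\<lambda>t x. F t x \<omega>) (\<lambda>x. \<xi> x \<omega>)) \<and>
     (\<forall>b. \<forall>K. compact K \<longrightarrow>
        (AE \<omega> in P. explosion_time_on \<xi> K \<omega> < \<infinity> \<longrightarrow>
           filterlim (\<lambda>t. SUP x\<in>K. riem_dist atl g b (F t x \<omega>)) at_top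
             (at_left (real_of_ereal (explosion_time_on \<xi> K \<omega>)))))"

section \<open>Lipschitz cubes and strong completeness\<close>

text \<open>\<open>L\<^sub>d\<close>, where \<open>d = CARD('d)\<close>.\<close>

definition lipschitz_cubes ::
  "'d::finite itself \<Rightarrow> ('m::topological_space, 'n::finite) chart set \<Rightarrow>
   ('m, 'n) metric_tensor \<Rightarrow> 'm set set" where
  "lipschitz_cubes _ atl g =
     {\<alpha> ` cbox 0 1 | \<alpha> :: real ^ 'd \<Rightarrow> 'm.
        \<exists>C. \<forall>s\<in>cbox 0 1. \<forall>t\<in>cbox 0 1. riem_dist atl g (\<alpha> s) (\<alpha> t) \<le> C * norm (s - t)}"

definition smooth_map_into ::
  "('m::topological_space, 'n::finite) chart set \<Rightarrow> 'a::euclidean_space set \<Rightarrow> ('a \<Rightarrow> 'm) \<Rightarrow> bool" where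
  "smooth_map_into atl U \<sigma> \<longleftrightarrow>
     continuous_on U \<sigma> \<and> (\<forall>c\<in>atl. smooth_on (snd c \<circ> \<sigma>) (U \<inter> \<sigma> -` fst c))"

text \<open>The standard \<open>d\<close>-simplex is taken in \<open>d\<close>-dimensional space, spanned by \<open>0\<close> and the unit vectors.\<close>

definition smooth_simplices ::
  "'d::finite itself \<Rightarrow> ('m::topological_space, 'n::finite) chart set \<Rightarrow> 'm set set" where
  "smooth_simplices _ atl =
     {\<sigma> ` (convex hull (insert 0 Basis)) | \<sigma> :: real ^ 'd \<Rightarrow> 'm.
        \<exists>U. open U \<and> convex hull (insert 0 Basis) \<subseteq> U \<and> smooth_map_into atl U \<sigma>}"

definition strongly_complete ::
  "'d::finite itself \<Rightarrow> ('m::topological_space, 'n::finite) chart set \<Rightarrow> 'w measure \<Rightarrow>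
   ('m \<Rightarrow> 'w \<Rightarrow> ereal) \<Rightarrow> bool" where
  "strongly_complete d atl P \<xi> \<longleftrightarrow>
     (\<forall>K\<in>smooth_simplices d atl. AE \<omega> in P. explosion_time_on \<xi> K \<omega> = \<infinity>)"

end

theory Submission
  imports Defs
begin

text \<open>
  The proof is pathwise.  If \<open>\<gamma>\<close> is a piecewise \<open>C\<^sup>1\<close> curve along which \<open>F\<^sub>t\<close> is defined, then
  \<open>d(F\<^sub>t \<gamma>(0), F\<^sub>t \<gamma>(1))\<close> is at most the length of \<open>F\<^sub>t \<circ> \<gamma>\<close>, that is, at most the integral of
  \<open>|T\<^bsub>\<gamma>(r)\<^esub>F\<^sub>t| |\<gamma>'(r)|\<close>.  The \<open>p\<close>-th moment of the supremum over \<open>t\<close> of this length, where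
  \<open>p = d + \<delta>\<close>, is therefore at most a constant times the \<open>p\<close>-th power of the length of \<open>\<gamma>\<close>.
  Since explosion on a compact set forces distances to become infinite, the whole curve does not
  explode as soon as its starting point does not, and hence no point explodes.  For a Lipschitz
  cube the moment bound is applied to curves joining neighbouring dyadic points; because \<open>p > d\<close>, a
  Kolmogorov chaining argument bounds \<open>F\<^sub>t\<close> on all dyadic points by a random constant, and by
  continuity on the whole cube, which excludes explosion.

  Explosion is contradicted along rational times only.  This leaves countable suprema, so that the
  measurability of \<open>T\<^sub>xF\<^sub>t\<close> for fixed \<open>t\<close> and \<open>x\<close> suffices; and the integrals over the curve are
  replaced by Riemann sums together with Fatou's lemma, so that no joint measurability in the
  curve parameter and \<open>\<omega>\<close> is needed.
\<close>

section \<open>Charts and tangent vectors\<close>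

text \<open>The exponent \<delta> and the moment bound depend on the time horizon and on the compact
  set, so they can be applied only to curves inside one compact set fixed beforehand. Curves that
  nearly realise the distance between two points of a cube may leave the cube and are confined only
  by being short; chaining therefore starts at a level where all links are short enough, and the
  finitely many points of that level are controlled by their own nonexplosion. Since the links may
  leave the cube, survival of the cube up to time t does not imply survival of the links. This is
  why completeness along single curves comes first; it is then used for the countably many links at
  once. The supremum over all times inside the moment is not known to be measurable. It serves only
  as an upper bound: below it stand measurable functions, built from rational times and from the
  stretching of one tangent vector in place of the operator norm.\<close>

lemma Ck_on_1_iff:
  "Ck_on 1 f S \<longleftrightarrow> (\<forall>x\<in>S. f differentiable (at x)) \<and>
     (\<forall>e. continuous_on S (\<lambda>x. frechet_derivative f (at x) e))"
  by (simp add: One_nat_def)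

lemma Ck_on_1_has_derivative:
  assumes "Ck_on 1 f S" "x \<in> S"
  shows "(f has_derivative frechet_derivative f (at x)) (at x)"
  using assms by (simp add: Ck_on_1_iff frechet_derivative_works[symmetric])

text \<open>\<open>Ck_on\<close> controls the derivative only in fixed directions; expanding the
  moving direction in the standard basis reduces joint continuity to these.\<close>

lemma Ck_on_1_continuous_on_derivative:
  fixes f :: "'a::euclidean_space \<Rightarrow> 'b::real_normed_vector"
  assumes f: "Ck_on 1 f S" and z: "continuous_on I z" and u: "continuous_on I u" and S: "z ` I \<subseteq> S"
  shows "continuous_on I (\<lambda>t. frechet_derivative f (at (z t)) (u t))"
proof -
  have "continuous_on I (\<lambda>t. \<Sum>b\<in>Basis. (u t \<bullet> b) *\<^sub>R frechet_derivative f (at (z t)) b)"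
  proof (intro continuous_intros u)
    fix b :: 'a
    have "continuous_on S (\<lambda>x. frechet_derivative f (at x) b)"
      using f by (simp add: Ck_on_1_iff)
    then show "continuous_on I (\<lambda>t. frechet_derivative f (at (z t)) b)"
      using z S by (rule continuous_on_compose2)
  qed
  moreover have "(\<Sum>b\<in>Basis. (u t \<bullet> b) *\<^sub>R frechet_derivative f (at (z t)) b)
      = frechet_derivative f (at (z t)) (u t)" if "t \<in> I" for t
  proof -
    have lin: "linear (frechet_derivative f (at (z t)))"
      using f S that by (meson Ck_on_1_has_derivative has_derivative_linear image_subset_iff)
    have "(\<Sum>b\<in>Basis. (u t \<bullet> b) *\<^sub>R frechet_derivative f (at (z t)) b)
        = frechet_derivative f (at (z t)) (\<Sum>b\<in>Basis. (u t \<bullet> b) *\<^sub>R b)"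
      by (simp add: linear_sum[OF lin] linear_scale[OF lin])
    then show ?thesis by (simp add: euclidean_representation)
  qed
  ultimately show ?thesis
    by (simp cong: continuous_on_cong)
qed

lemma smooth_on_imp_Ck_on: "smooth_on f S \<Longrightarrow> Ck_on k f S"
  by (simp add: smooth_on_def)

section \<open>Charts and changes of coordinates\<close>

locale riem_manifold =
  fixes atl :: "('m::{t2_space, second_countable_topology}, 'n::finite) chart set"
    and g :: "('m, 'n) metric_tensor"
  assumes atlas: "smooth_atlas atl" and metric: "riemannian_metric atl g"
    and connected_UNIV: "connected (UNIV :: 'm set)"
begin

abbreviation rdist :: "'m \<Rightarrow> 'm \<Rightarrow> real" where
  "rdist \<equiv> riem_dist atl g"

lemma chart_exists: "\<exists>c\<in>atl. x \<in> fst c"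
proof -
  have "x \<in> (\<Union>c\<in>atl. fst c)" using atlas by (simp add: smooth_atlas_def)
  then show ?thesis by blast
qed

lemma some_chart: "some_chart atl x \<in> atl" "x \<in> fst (some_chart atl x)"
proof -
  have "\<exists>c. c \<in> charts_at atl x" using chart_exists[of x] by (auto simp: charts_at_def)
  then have "some_chart atl x \<in> charts_at atl x" unfolding some_chart_def by (rule someI_ex)
  then show "some_chart atl x \<in> atl" "x \<in> fst (some_chart atl x)" by (auto simp: charts_at_def)
qed

lemma chart_homeomorphism:
  "c \<in> atl \<Longrightarrow> homeomorphism (fst c) (snd c ` fst c) (snd c) (chart_inv c)"
  using atlas by (auto simp: smooth_atlas_def)

lemma open_chart: "c \<in> atl \<Longrightarrow> open (fst c)"
  using atlas by (auto simp: smooth_atlas_def)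

lemma open_chart_image: "c \<in> atl \<Longrightarrow> open (snd c ` fst c)"
  using atlas by (auto simp: smooth_atlas_def)

lemma chart_inv_chart [simp]: "c \<in> atl \<Longrightarrow> x \<in> fst c \<Longrightarrow> chart_inv c (snd c x) = x"
  using chart_homeomorphism by (simp add: homeomorphism_def)

lemma chart_inv_mem: "z \<in> snd c ` fst c \<Longrightarrow> chart_inv c z \<in> fst c"
  by (rule inv_into_into)

lemma chart_chart_inv [simp]: "z \<in> snd c ` fst c \<Longrightarrow> snd c (chart_inv c z) = z"
  by (rule f_inv_into_f)

lemma continuous_on_chart: "c \<in> atl \<Longrightarrow> continuous_on (fst c) (snd c)"
  using chart_homeomorphism by (simp add: homeomorphism_def)

lemma continuous_on_chart_inv: "c \<in> atl \<Longrightarrow> continuous_on (snd c ` fst c) (chart_inv c)"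
  using chart_homeomorphism by (simp add: homeomorphism_def)

lemma chart_image_eq:
  "c \<in> atl \<Longrightarrow> snd c ` (fst c \<inter> U) = (snd c ` fst c) \<inter> chart_inv c -` U"
  by (auto simp: inv_into_into)

lemma open_chart_image_Int: "c \<in> atl \<Longrightarrow> open U \<Longrightarrow> open (snd c ` (fst c \<inter> U))"
  using chart_image_eq[of c U] continuous_on_chart_inv[of c] open_chart_image[of c]
    continuous_on_open_vimage[of "snd c ` fst c" "chart_inv c"] by (simp add: inf_commute)

lemma open_chart_inv_image:
  assumes "c \<in> atl" "open V" "V \<subseteq> snd c ` fst c"
  shows "open (chart_inv c ` V)"
proof -
  have "chart_inv c ` V = fst c \<inter> snd c -` V"
  proof (intro set_eqI iffI)
    fix x assume "x \<in> chart_inv c ` V"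
    then obtain z where z: "x = chart_inv c z" "z \<in> V" by blast
    then have "z \<in> snd c ` fst c" using assms(3) by blast
    then show "x \<in> fst c \<inter> snd c -` V"
      unfolding z(1) using z(2) chart_inv_mem[of z c] chart_chart_inv[of z c] by simp
  next
    fix x assume "x \<in> fst c \<inter> snd c -` V"
    then show "x \<in> chart_inv c ` V"
      using assms(1) by (intro image_eqI[of _ _ "snd c x"]) auto
  qed
  then show ?thesis
    using continuous_on_open_vimage[OF open_chart[OF assms(1)], of "snd c"]
      continuous_on_chart[OF assms(1)] assms(2) by (simp add: inf_commute)
qed

lemma transition_Ck_1:
  "c \<in> atl \<Longrightarrow> c' \<in> atl \<Longrightarrow> Ck_on 1 (snd c' \<circ> chart_inv c) (snd c ` (fst c \<inter> fst c'))"
  using atlas by (intro smooth_on_imp_Ck_on) (auto simp: smooth_atlas_def)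

lemma transition_has_derivative:
  assumes "c \<in> atl" "c' \<in> atl" "x \<in> fst c" "x \<in> fst c'"
  shows "((snd c' \<circ> chart_inv c) has_derivative
      frechet_derivative (snd c' \<circ> chart_inv c) (at (snd c x))) (at (snd c x))"
  using assms by (intro Ck_on_1_has_derivative[OF transition_Ck_1[OF assms(1,2)]]) simp

text \<open>Close to the point the coordinate expression factors through the transition map, and a
  derivative depends only on values close to the point. Arbitrary \<phi> covers coordinate maps as
  well as maps followed by a chart.\<close>

lemma chart_change_has_derivative:
  assumes c: "c \<in> atl" "c' \<in> atl" "x \<in> fst c" "x \<in> fst c'"
    and d: "((\<phi> \<circ> chart_inv c') has_derivative D) (at (snd c' x))"
  shows "((\<phi> \<circ> chart_inv c) has_derivative
      (\<lambda>u. D (frechet_derivative (snd c' \<circ> chart_inv c) (at (snd c x)) u))) (at (snd c x))"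
proof -
  have "((\<phi> \<circ> chart_inv c') \<circ> (snd c' \<circ> chart_inv c) has_derivative
      D \<circ> frechet_derivative (snd c' \<circ> chart_inv c) (at (snd c x))) (at (snd c x))"
    using c d by (intro diff_chain_at transition_has_derivative) auto
  then have "(\<phi> \<circ> chart_inv c has_derivative
      D \<circ> frechet_derivative (snd c' \<circ> chart_inv c) (at (snd c x))) (at (snd c x))"
  proof (rule has_derivative_transform_within_open)
    show "open (snd c ` (fst c \<inter> fst c'))" by (intro open_chart_image_Int open_chart c)
  qed (use c in auto)
  then show ?thesis by (simp add: comp_def)
qed

lemma transition_chain:
  assumes c: "c \<in> atl" "c' \<in> atl" "x \<in> fst c" "x \<in> fst c'" and c'': "c'' \<in> atl" "x \<in> fst c''"
  shows "frechet_derivative (snd c'' \<circ> chart_inv c') (at (snd c' x))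
      (frechet_derivative (snd c' \<circ> chart_inv c) (at (snd c x)) u)
    = frechet_derivative (snd c'' \<circ> chart_inv c) (at (snd c x)) u"
  using frechet_derivative_at[OF chart_change_has_derivative[OF c transition_has_derivative[OF c(2) c''(1) c(4) c''(2)]]]
  by (rule fun_cong)

lemma transition_self:
  assumes "c \<in> atl" "x \<in> fst c"
  shows "frechet_derivative (snd c \<circ> chart_inv c) (at (snd c x)) u = u"
proof -
  have "((\<lambda>z. z) has_derivative (\<lambda>z. z)) (at (snd c x))" by (rule has_derivative_ident)
  then have "(snd c \<circ> chart_inv c has_derivative (\<lambda>z. z)) (at (snd c x))"
    by (rule has_derivative_transform_within_open[OF _ open_chart_image[OF assms(1)]])
      (use assms in auto)
  then show ?thesis by (metis frechet_derivative_at)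
qed

section \<open>Tangent vectors in coordinates\<close>

lemma coord_vec_apply_self [simp]: "c \<in> atl \<Longrightarrow> x \<in> fst c \<Longrightarrow> coord_vec atl c x u c = u"
  by (simp add: coord_vec_def charts_at_def transition_self)

lemma coord_vec_in_tangent_space:
  "c \<in> atl \<Longrightarrow> x \<in> fst c \<Longrightarrow> coord_vec atl c x u \<in> tangent_space atl x"
  by (simp add: tangent_space_def coord_vec_def charts_at_def transition_chain del: split_paired_All)

text \<open>One coordinate vector determines the whole family, so every computation with tangent
  vectors can be done in a single chart.\<close>

lemma tangent_vector_eq_coord_vec:
  assumes "c \<in> atl" "x \<in> fst c" "v \<in> tangent_space atl x"
  shows "v = coord_vec atl c x (v c)"
proof
  fix c'
  have "c \<in> charts_at atl x" using assms by (simp add: charts_at_def)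
  then show "v c' = coord_vec atl c x (v c) c'"
    using assms(3) unfolding tangent_space_def coord_vec_def mem_Collect_eq by metis
qed

lemma linear_transition:
  assumes "c \<in> atl" "c' \<in> atl" "x \<in> fst c" "x \<in> fst c'"
  shows "linear (frechet_derivative (snd c' \<circ> chart_inv c) (at (snd c x)))"
  using transition_has_derivative[OF assms] has_derivative_linear by blast

lemma coord_vec_linear:
  assumes "c \<in> atl" "x \<in> fst c"
  shows "coord_vec atl c x (a *\<^sub>R u + w) = (\<lambda>c'. a *\<^sub>R coord_vec atl c x u c' + coord_vec atl c x w c')"
proof
  fix c'
  show "coord_vec atl c x (a *\<^sub>R u + w) c' = a *\<^sub>R coord_vec atl c x u c' + coord_vec atl c x w c'"
  proof (cases "c' \<in> charts_at atl x")
    case True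
    then have "linear (frechet_derivative (snd c' \<circ> chart_inv c) (at (snd c x)))"
      using assms by (intro linear_transition) (auto simp: charts_at_def)
    then show ?thesis using True by (simp add: coord_vec_def linear_add linear_scale)
  qed (simp add: coord_vec_def)
qed

section \<open>The metric in coordinates\<close>

lemma riemannian_metricD:
  assumes "u \<in> tangent_space atl x" "v \<in> tangent_space atl x"
  shows "g x u v = g x v u" "u \<noteq> (\<lambda>_. 0) \<Longrightarrow> g x u u > 0"
    "w \<in> tangent_space atl x \<Longrightarrow> g x (\<lambda>c. a *\<^sub>R u c + v c) w = a * g x u w + g x v w"
  using metric assms unfolding riemannian_metric_def by blast+

definition chart_inner :: "('m, 'n) chart \<Rightarrow> 'm \<Rightarrow> real ^ 'n \<Rightarrow> real ^ 'n \<Rightarrow> real" where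
  "chart_inner c x u w = g x (coord_vec atl c x u) (coord_vec atl c x w)"

lemma chart_inner_add_scale_left:
  "c \<in> atl \<Longrightarrow> x \<in> fst c \<Longrightarrow> chart_inner c x (a *\<^sub>R u + v) w = a * chart_inner c x u w + chart_inner c x v w"
  by (simp add: chart_inner_def coord_vec_linear riemannian_metricD(3) coord_vec_in_tangent_space)

lemma chart_inner_commute: "c \<in> atl \<Longrightarrow> x \<in> fst c \<Longrightarrow> chart_inner c x u w = chart_inner c x w u"
  unfolding chart_inner_def by (rule riemannian_metricD(1)) (auto intro: coord_vec_in_tangent_space)

lemma linear_chart_inner_left: 
  assumes "c \<in> atl" "x \<in> fst c"
  shows "linear (\<lambda>u. chart_inner c x u w)"
proof -
  note * = chart_inner_add_scale_left[OF assms]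
  \<comment> \<open>With scalar 1 and both vectors zero the law reads z = z + z.\<close>
  have 0: "chart_inner c x 0 w = 0" using *[of 1 0 0 w] by simp
  show ?thesis
  proof (rule linearI)
    show "chart_inner c x (u + v) w = chart_inner c x u w + chart_inner c x v w" for u v using *[of 1 u v w] by simp
    show "chart_inner c x (r *\<^sub>R u) w = r *\<^sub>R chart_inner c x u w" for r u using *[of r u 0 w] 0 by simp
  qed
qed

text \<open>Separates the vectors from the base point: smoothness of the metric is given for its
  coefficient functions, and continuity of norms is deduced from it through this formula.\<close>

lemma chart_inner_expand:
  assumes "c \<in> atl" "x \<in> fst c"
  shows "chart_inner c x u w = (\<Sum>i\<in>UNIV. \<Sum>j\<in>UNIV. u $ i * w $ j * chart_inner c x (axis i 1) (axis j 1))"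
proof -
  have *: "chart_inner c x u w = (\<Sum>i\<in>UNIV. u $ i * chart_inner c x (axis i 1) w)" for u w
  proof -
    have "chart_inner c x (\<Sum>i\<in>UNIV. u $ i *\<^sub>R axis i 1) w = (\<Sum>i\<in>UNIV. u $ i * chart_inner c x (axis i 1) w)"
      by (simp add: linear_sum[OF linear_chart_inner_left[OF assms]] linear_scale[OF linear_chart_inner_left[OF assms]])
    moreover have "(\<Sum>i\<in>UNIV. u $ i *\<^sub>R axis i 1) = u"
      using basis_expansion[of u] by (simp add: scalar_mult_eq_scaleR)
    ultimately show ?thesis by simp
  qed
  have "chart_inner c x u w = (\<Sum>i\<in>UNIV. u $ i * (\<Sum>j\<in>UNIV. w $ j * chart_inner c x (axis j 1) (axis i 1)))"
    unfolding *[of u w] chart_inner_commute[OF assms, of "axis _ 1" w] *[of w "axis _ 1"] ..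
  also have "\<dots> = (\<Sum>i\<in>UNIV. \<Sum>j\<in>UNIV. u $ i * w $ j * chart_inner c x (axis i 1) (axis j 1))"
    unfolding sum_distrib_left
    by (intro sum.cong refl) (simp add: chart_inner_commute[OF assms, of "axis _ 1" "axis i 1" for i])
  finally show ?thesis .
qed

lemma continuous_on_chart_inner_coeff:
  assumes "c \<in> atl"
  shows "continuous_on (snd c ` fst c) (\<lambda>z. chart_inner c (chart_inv c z) (axis i 1) (axis j 1))"
proof -
  have "smooth_on (\<lambda>z. chart_inner c (chart_inv c z) (axis i 1) (axis j 1)) (snd c ` fst c)"
    using metric assms unfolding riemannian_metric_def chart_inner_def by blast
  then have "Ck_on 0 (\<lambda>z. chart_inner c (chart_inv c z) (axis i 1) (axis j 1)) (snd c ` fst c)"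
    by (rule smooth_on_imp_Ck_on)
  then show ?thesis by simp
qed

definition chart_norm :: "('m, 'n) chart \<Rightarrow> 'm \<Rightarrow> real ^ 'n \<Rightarrow> real" where
  "chart_norm c x u = tnorm g x (coord_vec atl c x u)"

lemma chart_norm_eq: "chart_norm c x u = sqrt (chart_inner c x u u)"
  by (simp add: chart_norm_def tnorm_def chart_inner_def)

lemma continuous_on_chart_norm:
  assumes c: "c \<in> atl" and I: "continuous_on I y" "y ` I \<subseteq> fst c" and u: "continuous_on I u"
  shows "continuous_on I (\<lambda>t. chart_norm c (y t) (u t))"
proof -
  have cy: "continuous_on I (\<lambda>t. snd c (y t))"
    using continuous_on_compose2[OF continuous_on_chart[OF c] I] .
  have "continuous_on I (\<lambda>t. chart_inner c (chart_inv c (snd c (y t))) (axis i 1) (axis j 1))" for i j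
    by (rule continuous_on_compose2[OF continuous_on_chart_inner_coeff[OF c] cy]) (use I in auto)
  then have *: "continuous_on I (\<lambda>t. chart_inner c (y t) (axis i 1) (axis j 1))" for i j
    by (rule continuous_on_eq) (use I c in \<open>auto simp: image_subset_iff\<close>)
  have "continuous_on I (\<lambda>t. sqrt (\<Sum>i\<in>UNIV. \<Sum>j\<in>UNIV. u t $ i * u t $ j * chart_inner c (y t) (axis i 1) (axis j 1)))"
    by (intro continuous_intros * u)
  then show ?thesis
  proof (rule continuous_on_eq)
    fix t assume "t \<in> I"
    then have "y t \<in> fst c" using I by auto
    from chart_inner_expand[OF c this, of "u t" "u t"]
    show "sqrt (\<Sum>i\<in>UNIV. \<Sum>j\<in>UNIV. u t $ i * u t $ j * chart_inner c (y t) (axis i 1) (axis j 1)) = chart_norm c (y t) (u t)"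
      by (simp add: chart_norm_eq)
  qed
qed

lemma chart_norm_scaleR: 
  assumes "c \<in> atl" "x \<in> fst c"
  shows "chart_norm c x (a *\<^sub>R u) = \<bar>a\<bar> * chart_norm c x u"
proof -
  have *: "chart_inner c x (a *\<^sub>R u) w = a * chart_inner c x u w" for u w
    using linear_scale[OF linear_chart_inner_left[OF assms]] by simp
  have "chart_inner c x (a *\<^sub>R u) (a *\<^sub>R u) = a\<^sup>2 * chart_inner c x u u"
    using *[of u "a *\<^sub>R u"] *[of u u] chart_inner_commute[OF assms, of u "a *\<^sub>R u"] by (simp add: power2_eq_square)
  then show ?thesis by (simp add: chart_norm_eq real_sqrt_mult)
qed

lemma chart_norm_pos:
  assumes "c \<in> atl" "x \<in> fst c" "u \<noteq> 0"
  shows "0 < chart_norm c x u"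
proof -
  have "coord_vec atl c x u \<noteq> (\<lambda>_. 0)"
    using coord_vec_apply_self[OF assms(1,2), of u] assms(3) by auto
  then show ?thesis
    using riemannian_metricD(2)[OF coord_vec_in_tangent_space[OF assms(1,2)] coord_vec_in_tangent_space[OF assms(1,2)]]
    by (simp add: chart_norm_eq chart_inner_def)
qed

lemma chart_norm_0: "c \<in> atl \<Longrightarrow> x \<in> fst c \<Longrightarrow> chart_norm c x 0 = 0"
  using chart_norm_scaleR[of c x 0 0] by simp

lemma chart_norm_nonneg: "c \<in> atl \<Longrightarrow> x \<in> fst c \<Longrightarrow> 0 \<le> chart_norm c x u"
  by (cases "u = 0") (auto simp: chart_norm_0 chart_norm_pos less_imp_le)

lemma tnorm_eq_chart_norm:
  "c \<in> atl \<Longrightarrow> x \<in> fst c \<Longrightarrow> v \<in> tangent_space atl x \<Longrightarrow> tnorm g x v = chart_norm c x (v c)"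
  unfolding chart_norm_def by (rule arg_cong[of _ _ "tnorm g x", OF tangent_vector_eq_coord_vec])

lemma tnorm_nonneg: "v \<in> tangent_space atl x \<Longrightarrow> 0 \<le> tnorm g x v"
  by (simp add: tnorm_eq_chart_norm[OF some_chart] chart_norm_nonneg[OF some_chart])

text \<open>By homogeneity it suffices to look at unit vectors, and on the compact product of
  \<open>K\<close> with the unit sphere the continuous, positive norm has a positive minimum and a
  maximum.\<close>

lemma chart_norm_bounds_compact:
  assumes c: "c \<in> atl" and K: "compact K" "K \<subseteq> fst c"
  shows "\<exists>m M. 0 < m \<and> 0 < M \<and> (\<forall>x\<in>K. \<forall>u. m * norm u \<le> chart_norm c x u \<and> chart_norm c x u \<le> M * norm u)"
proof (cases "K = {}")
  case True
  have "0 < (1::real)" by simp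
  then show ?thesis using True by blast
next
  case False
  let ?S = "K \<times> sphere (0::real^'n) 1"
  have S: "compact ?S" "?S \<noteq> {}"
    using K False by (auto simp: compact_Times)
  have cont: "continuous_on ?S (\<lambda>p. chart_norm c (fst p) (snd p))"
    using K by (intro continuous_on_chart_norm[OF c] continuous_intros) auto
  obtain p where p: "p \<in> ?S" "\<And>q. q \<in> ?S \<Longrightarrow> chart_norm c (fst p) (snd p) \<le> chart_norm c (fst q) (snd q)"
    using continuous_attains_inf[OF S cont] by blast
  obtain P where P: "P \<in> ?S" "\<And>q. q \<in> ?S \<Longrightarrow> chart_norm c (fst q) (snd q) \<le> chart_norm c (fst P) (snd P)"
    using continuous_attains_sup[OF S cont] by blast
  let ?m = "chart_norm c (fst p) (snd p)" and ?M = "chart_norm c (fst P) (snd P)"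
  have m: "0 < ?m" using p(1) K by (intro chart_norm_pos c) auto
  have M: "0 < ?M" using m P(2)[OF p(1)] by simp
  have "?m * norm u \<le> chart_norm c x u \<and> chart_norm c x u \<le> ?M * norm u" if x: "x \<in> K" for x u
  proof (cases "u = 0")
    case True
    then show ?thesis using x K by (simp add: chart_norm_0 c subset_iff)
  next
    case False
    have q: "(x, (1 / norm u) *\<^sub>R u) \<in> ?S" using x False by simp
    have "chart_norm c x ((1 / norm u) *\<^sub>R u) = chart_norm c x u / norm u"
      using x K by (subst chart_norm_scaleR[OF c]) auto
    with p(2)[OF q] P(2)[OF q] have "?m \<le> chart_norm c x u / norm u" "chart_norm c x u / norm u \<le> ?M"
      by simp_all
    then show ?thesis using False by (simp add: field_simps)
  qed
  then show ?thesis using m M by blast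
qed

end

section \<open>Riemann sums\<close>

text \<open>Setting the function to 0 at the exceptional points and off the open interval leaves
  only finitely many discontinuities on the whole line. The extension connects the gauge integral,
  which defines length, with the Lebesgue integral, for which dominated convergence is
  available.\<close>

lemma piecewise_continuous_extension_measurable:
  fixes f :: "real \<Rightarrow> real"
  assumes S: "finite S" and f: "continuous_on ({a..b} - S) f"
  shows "(\<lambda>x. if x \<in> {a<..<b} - S then f x else 0) \<in> borel_measurable borel"
proof (rule borel_measurable_continuous_countable_exceptions)
  let ?f = "\<lambda>x. if x \<in> {a<..<b} - S then f x else 0"
  have 1: "continuous_on ({a<..<b} - S) ?f"
    by (rule continuous_on_eq[OF continuous_on_subset[OF f]]) auto
  have 2: "continuous_on ({..<a} \<union> {b<..}) ?f"
    by (rule continuous_on_eq[OF continuous_on_const[of _ 0]]) auto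
  have "continuous_on (({a<..<b} - S) \<union> ({..<a} \<union> {b<..})) ?f"
    using S by (intro continuous_on_open_Un 1 2 open_Diff finite_imp_closed open_Un) auto
  then show "continuous_on (- (S \<union> {a, b})) ?f"
    by (rule continuous_on_subset) auto
qed (use S in \<open>simp add: countable_finite\<close>)

lemma piecewise_continuous_integrable:
  fixes f :: "real \<Rightarrow> real"
  assumes S: "finite S" and f: "continuous_on ({a..b} - S) f"
    and B: "\<And>x. x \<in> {a..b} - S \<Longrightarrow> \<bar>f x\<bar> \<le> B"
  shows "f integrable_on {a..b}"
    and "integral {a..b} f = (LINT x:{a..b}|lborel. if x \<in> {a<..<b} - S then f x else 0)"
proof -
  let ?f = "\<lambda>x. if x \<in> {a<..<b} - S then f x else 0"
  have meas: "?f \<in> borel_measurable borel"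
    by (rule piecewise_continuous_extension_measurable[OF S f])
  have int: "set_integrable lborel {a..b} ?f"
    unfolding set_integrable_def
  proof (rule integrableI_bounded_set_indicator[where B = "\<bar>B\<bar>"])
    show "AE x in lborel. x \<in> {a..b} \<longrightarrow> norm (?f x) \<le> \<bar>B\<bar>"
      using B by (intro AE_I2) (force simp: less_imp_le)
    show "emeasure lborel {a..b} < \<infinity>" by (simp add: emeasure_lborel_Icc_eq)
  qed (use meas in auto)
  have *: "finite (S \<union> {a, b})" using S by simp
  show "f integrable_on {a..b}"
    by (rule integrable_spike_finite[OF * _ set_borel_integral_eq_integral(1)[OF int]]) auto
  have "integral {a..b} f = integral {a..b} ?f"
    by (rule integral_spike[OF negligible_finite[OF *]]) auto
  then show "integral {a..b} f = (LINT x:{a..b}|lborel. ?f x)"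
    using set_borel_integral_eq_integral(2)[OF int] by simp
qed

text \<open>The sums are integrals of step functions that take the value at floor(N x) / N; these
  converge at every point of continuity, and dominated convergence applies. Nodes in the exceptional
  set count 0 because a speed carries no information at a break point.\<close>

lemma Riemann_sums_tendsto_integral:
  fixes f :: "real \<Rightarrow> real"
  assumes S: "finite S" "{0, 1} \<subseteq> S" and f: "continuous_on ({0..1} - S) f"
    and B: "\<And>x. x \<in> {0..1} - S \<Longrightarrow> \<bar>f x\<bar> \<le> B"
  shows "(\<lambda>N. (\<Sum>i<N. if real i / real N \<in> S then 0 else f (real i / real N)) / real N)
    \<longlonglongrightarrow> integral {0..1} f"
proof -
  define h where "h = (\<lambda>x. if x \<in> {0<..<1} - S then f x else 0)"
  have h_meas [measurable]: "h \<in> borel_measurable borel"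
    unfolding h_def by (rule piecewise_continuous_extension_measurable[OF S(1) f])
  have h_bound: "\<bar>h x\<bar> \<le> \<bar>B\<bar>" for x
    using B[of x] by (auto simp: h_def)
  \<comment> \<open>The step function equal to \<open>h\<close> at the left end point of each
    interval of length 1 / N. As \<open>h\<close> is bounded on the whole line, all
    \<open>G N\<close> share one dominating function.\<close>
  define G where "G N x = (\<Sum>i<N. h (real i / real N) * indicator {real i / real N..<(real i + 1) / real N} x)"
    for N :: nat and x :: real
  have G_floor: "G N x = h (of_int \<lfloor>real N * x\<rfloor> / real N)" if x: "0 \<le> x" "x < 1" and N: "0 < N" for N x
  proof -
    define k where "k = nat \<lfloor>real N * x\<rfloor>"
    have k: "real k = of_int \<lfloor>real N * x\<rfloor>" using x by (simp add: k_def)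
    have "real N * x < real N" using x N by simp
    then have kN: "k < N" using k floor_correct[of "real N * x"] by linarith
    have ind: "indicator {real i / real N..<(real i + 1) / real N} x = (if i = k then 1 else (0::real))" for i
    proof -
      have "x \<in> {real i / real N..<(real i + 1) / real N} \<longleftrightarrow> real i \<le> real N * x \<and> real N * x < real i + 1"
        using N by (simp add: field_simps)
      also have "\<dots> \<longleftrightarrow> \<lfloor>real N * x\<rfloor> = int i" by (simp add: floor_eq_iff)
      also have "\<dots> \<longleftrightarrow> i = k" using x by (auto simp: k_def)
      finally show ?thesis by (simp add: indicator_def)
    qed
    have "G N x = (\<Sum>i<N. if i = k then h (real i / real N) else 0)"
      unfolding G_def ind by (intro sum.cong) auto
    then show ?thesis using kN by (simp add: k)
  qed
  have G_out: "G N x = 0" if "\<not> (0 \<le> x \<and> x < 1)" for N x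
  proof -
    have "indicator {real i / real N..<(real i + 1) / real N} x = (0::real)" if "i < N" for i
    proof -
      have "(real i + 1) / real N \<le> 1" using that by simp
      then have "x \<notin> {real i / real N..<(real i + 1) / real N}"
        using \<open>\<not> (0 \<le> x \<and> x < 1)\<close> by (smt (verit) atLeastLessThan_iff divide_nonneg_nonneg of_nat_0_le_iff)
      then show ?thesis by simp
    qed
    then show ?thesis by (simp add: G_def)
  qed
  have G_bound: "\<bar>G N x\<bar> \<le> \<bar>B\<bar> * indicator {0..1} x" for N x
  proof (cases "0 \<le> x \<and> x < 1 \<and> 0 < N")
    case True
    then show ?thesis using G_floor[of x N] h_bound by simp
  next
    case False
    then have "G N x = 0" using G_out[of x N] by (auto simp: G_def)
    then show ?thesis by simp
  qed
  have lim: "(\<lambda>N. G N x) \<longlonglongrightarrow> indicator {0..1} x * h x" if "x \<notin> S" for x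
  proof (cases "0 < x \<and> x < 1")
    case True
    have op: "open ({0<..<1} - S)" using S by (intro open_Diff finite_imp_closed) auto
    have "continuous_on ({0<..<1} - S) h"
      by (rule continuous_on_eq[OF continuous_on_subset[OF f]]) (auto simp: h_def)
    then have "isCont h x" using op True that by (simp add: continuous_on_eq_continuous_at)
    moreover have "(\<lambda>N. of_int \<lfloor>real N * x\<rfloor> / real N) \<longlonglongrightarrow> x"
    proof (rule tendsto_sandwich)
      show "\<forall>\<^sub>F N in sequentially. x - 1 / real N \<le> of_int \<lfloor>real N * x\<rfloor> / real N"
        using eventually_gt_at_top[of 0]
      proof eventually_elim
        case (elim N)
        have "real N * x - 1 \<le> of_int \<lfloor>real N * x\<rfloor>" by linarith
        then have "(real N * x - 1) / real N \<le> of_int \<lfloor>real N * x\<rfloor> / real N"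
          by (rule divide_right_mono) simp
        then show ?case using elim by (simp add: diff_divide_distrib)
      qed
      show "\<forall>\<^sub>F N in sequentially. of_int \<lfloor>real N * x\<rfloor> / real N \<le> x"
        using eventually_gt_at_top[of 0]
        by eventually_elim (simp add: field_simps)
      show "(\<lambda>N. x - 1 / real N) \<longlonglongrightarrow> x"
        using tendsto_diff[OF tendsto_const lim_1_over_n] by simp
    qed simp
    ultimately have "(\<lambda>N. h (of_int \<lfloor>real N * x\<rfloor> / real N)) \<longlonglongrightarrow> h x"
      by (rule isCont_tendsto_compose)
    moreover have "\<forall>\<^sub>F N in sequentially. h (of_int \<lfloor>real N * x\<rfloor> / real N) = G N x"
      using eventually_gt_at_top[of 0] by eventually_elim (use True G_floor in simp)
    ultimately show ?thesis
      using True by (simp add: tendsto_cong)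
  next
    case False
    moreover have "x \<noteq> 0" "x \<noteq> 1" using that S by auto
    ultimately have "G N x = 0" for N using G_out[of x N] by auto
    moreover have "indicator {0..1} x = (0::real)" using False \<open>x \<noteq> 0\<close> \<open>x \<noteq> 1\<close> by (auto simp: indicator_def)
    ultimately show ?thesis by simp
  qed
  have AE_S: "AE x in lborel. x \<notin> S"
    using S(1) by (intro AE_not_in finite_imp_null_set_lborel)
  have "(\<lambda>N. integral\<^sup>L lborel (G N)) \<longlonglongrightarrow> (LINT x|lborel. indicator {0..1} x * h x)"
  proof (rule integral_dominated_convergence)
    show "integrable lborel (\<lambda>x::real. \<bar>B\<bar> * indicator {0..1} x)"
      by (intro integrable_mult_right integrable_real_indicator) (auto simp: emeasure_lborel_Icc_eq)
    show "AE x in lborel. (\<lambda>N. G N x) \<longlonglongrightarrow> indicator {0..1} x * h x"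
      using AE_S by eventually_elim (rule lim)
    show "AE x in lborel. norm (G N x) \<le> \<bar>B\<bar> * indicator {0..1} x" for N
      using G_bound by simp
    show "G N \<in> borel_measurable lborel" for N unfolding G_def[abs_def] by measurable
  qed simp
  moreover have "integral\<^sup>L lborel (G N) = (\<Sum>i<N. h (real i / real N)) / real N" for N
  proof -
    have "integral\<^sup>L lborel (G N) = (\<Sum>i<N. h (real i / real N) * (1 / real N))"
      unfolding G_def by (subst Bochner_Integration.integral_sum)
        (auto simp: divide_right_mono diff_divide_distrib[symmetric])
    then show ?thesis by (simp add: sum_divide_distrib)
  qed
  \<comment> \<open>0 belongs to \<open>S\<close> and all nodes are less than 1, so \<open>h\<close>
    and the truncated \<open>f\<close> agree at every node.\<close>
  moreover have "(\<Sum>i<N. h (real i / real N)) = (\<Sum>i<N. if real i / real N \<in> S then 0 else f (real i / real N))"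
    for N
  proof (rule sum.cong)
    fix i assume "i \<in> {..<N}"
    then have "real i / real N < 1" "i = 0 \<or> 0 < real i / real N"
      by (auto simp: zero_less_divide_iff)
    then show "h (real i / real N) = (if real i / real N \<in> S then 0 else f (real i / real N))"
      using S(2) unfolding h_def by (cases "i = 0") auto
  qed simp
  moreover have "(LINT x|lborel. indicator {0..1} x * h x) = integral {0..1} f"
    using piecewise_continuous_integrable(2)[OF S(1) f B] by (simp add: h_def set_lebesgue_integral_def)
  ultimately show ?thesis by simp
qed

lemma affine_has_vector_derivative:
  fixes f :: "real \<Rightarrow> 'b::real_normed_vector"
  assumes "(f has_vector_derivative f') (at (p * t + q) within (\<lambda>t. p * t + q) ` I)"
  shows "((\<lambda>t. f (p * t + q)) has_vector_derivative p *\<^sub>R f') (at t within I)"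
proof -
  have "((\<lambda>t. p * t + q) has_vector_derivative p) (at t within I)"
    by (auto intro!: derivative_eq_intros simp: has_real_derivative_iff_has_vector_derivative[symmetric])
  from vector_diff_chain_within[OF this assms] show ?thesis by (simp add: comp_def)
qed

section \<open>Piecewise differentiable curves\<close>

context riem_manifold begin

text \<open>The witness required by \<open>C1_curve_on\<close>; the derivative is taken within
  \<open>I\<close>, hence one-sided at the ends of an interval.\<close>

definition chart_velocity :: "('m, 'n) chart \<Rightarrow> (real \<Rightarrow> 'm) \<Rightarrow> real set \<Rightarrow> (real \<Rightarrow> real ^ 'n) \<Rightarrow> bool" where
  "chart_velocity c \<gamma> I D \<longleftrightarrow>
     (\<forall>t\<in>I \<inter> \<gamma> -` fst c. ((snd c \<circ> \<gamma>) has_vector_derivative D t) (at t within I)) \<and>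
     continuous_on (I \<inter> \<gamma> -` fst c) D"

lemma chart_velocityD:
  assumes "chart_velocity c \<gamma> I D"
  shows "t \<in> I \<Longrightarrow> \<gamma> t \<in> fst c \<Longrightarrow> ((snd c \<circ> \<gamma>) has_vector_derivative D t) (at t within I)"
    and "continuous_on (I \<inter> \<gamma> -` fst c) D"
  using assms by (auto simp: chart_velocity_def)

lemma C1_curve_on_iff:
  "C1_curve_on atl \<gamma> a b \<longleftrightarrow> continuous_on {a..b} \<gamma> \<and> (\<forall>c\<in>atl. \<exists>D. chart_velocity c \<gamma> {a..b} D)"
  by (simp add: C1_curve_on_def chart_velocity_def)

text \<open>Admits a second curve that agrees with the reparametrised one on [u, v] only, so
  restriction to a subinterval and change of the curve off the interval are the special case p = 1,
  q = 0.\<close>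

lemma C1_curve_on_reparam:
  assumes C: "C1_curve_on atl \<gamma> a b" and p: "0 < p" and ab: "a \<le> p * u + q" "p * v + q \<le> b"
    and eq: "\<And>t. t \<in> {u..v} \<Longrightarrow> \<gamma>' t = \<gamma> (p * t + q)"
  shows "C1_curve_on atl \<gamma>' u v"
  unfolding C1_curve_on_iff
proof (intro conjI ballI)
  have mem: "p * t + q \<in> {a..b}" if "t \<in> {u..v}" for t
  proof -
    have "p * u \<le> p * t" "p * t \<le> p * v" using that p by auto
    then show ?thesis using ab by auto
  qed
  then have sub: "(\<lambda>t. p * t + q) ` {u..v} \<subseteq> {a..b}" by blast
  have "continuous_on {u..v} (\<lambda>t. \<gamma> (p * t + q))"
    by (rule continuous_on_compose2[of "{a..b}" \<gamma>])
      (use C sub in \<open>auto simp: C1_curve_on_def intro!: continuous_intros\<close>)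
  then show "continuous_on {u..v} \<gamma>'" by (rule continuous_on_eq) (simp add: eq)
  fix c assume "c \<in> atl"
  then obtain D where "chart_velocity c \<gamma> {a..b} D" using C unfolding C1_curve_on_iff by blast
  note D = chart_velocityD[OF this]
  have "((snd c \<circ> \<gamma>') has_vector_derivative p *\<^sub>R D (p * t + q)) (at t within {u..v})"
    if t: "t \<in> {u..v}" "\<gamma>' t \<in> fst c" for t
  proof -
    have "((\<lambda>t. (snd c \<circ> \<gamma>) (p * t + q)) has_vector_derivative p *\<^sub>R D (p * t + q)) (at t within {u..v})"
      by (rule affine_has_vector_derivative[OF has_vector_derivative_within_subset[OF D(1) sub]])
        (use t mem[OF t(1)] eq[OF t(1)] in auto)
    then show ?thesis
      by (rule has_vector_derivative_transform[rotated 2]) (use t eq in auto)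
  qed
  moreover have "continuous_on ({u..v} \<inter> \<gamma>' -` fst c) (\<lambda>t. p *\<^sub>R D (p * t + q))"
    by (intro continuous_intros continuous_on_compose2[OF D(2)]) (use mem eq in \<open>auto simp: image_subset_iff\<close>)
  ultimately have "chart_velocity c \<gamma>' {u..v} (\<lambda>t. p *\<^sub>R D (p * t + q))"
    by (simp add: chart_velocity_def)
  then show "\<exists>D. chart_velocity c \<gamma>' {u..v} D" by blast
qed

lemma C1_curve_on_subset: "C1_curve_on atl \<gamma> a b \<Longrightarrow> a \<le> u \<Longrightarrow> v \<le> b \<Longrightarrow> C1_curve_on atl \<gamma> u v"
  using C1_curve_on_reparam[of \<gamma> a b 1 u 0 v \<gamma>] by simp

lemma C1_curve_on_cong: "C1_curve_on atl \<gamma> u v \<Longrightarrow> (\<And>t. t \<in> {u..v} \<Longrightarrow> \<gamma> t = \<gamma>' t) \<Longrightarrow> C1_curve_on atl \<gamma>' u v"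
  using C1_curve_on_reparam[of \<gamma> u v 1 u 0 v \<gamma>'] by simp

text \<open>Different neighbourhoods may supply different formulas for the derivative. On a
  nondegenerate interval vector derivatives are unique, so all formulas agree with
  \<open>vector_derivative\<close>, which is then a single witness for the chart.\<close>

lemma C1_curve_on_localI:
  assumes uv: "u < v" and cont: "continuous_on {u..v} \<gamma>"
    and loc: "\<And>c t\<^sub>0. c \<in> atl \<Longrightarrow> t\<^sub>0 \<in> {u..v} \<Longrightarrow> \<gamma> t\<^sub>0 \<in> fst c \<Longrightarrow>
      \<exists>U D. open U \<and> t\<^sub>0 \<in> U \<and>
        (\<forall>t\<in>{u..v} \<inter> U. ((snd c \<circ> \<gamma>) has_vector_derivative D t) (at t within {u..v})) \<and>
        continuous_on ({u..v} \<inter> U) D"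
  shows "C1_curve_on atl \<gamma> u v"
  unfolding C1_curve_on_iff
proof (intro conjI ballI cont)
  fix c assume c: "c \<in> atl"
  define D where "D t = vector_derivative (snd c \<circ> \<gamma>) (at t within {u..v})" for t
  have *: "((snd c \<circ> \<gamma>) has_vector_derivative D t) (at t within {u..v}) \<and>
      continuous (at t within {u..v} \<inter> \<gamma> -` fst c) D" if t: "t \<in> {u..v} \<inter> \<gamma> -` fst c" for t
  proof -
    obtain U D' where U: "open U" "t \<in> U"
      "\<And>t. t \<in> {u..v} \<inter> U \<Longrightarrow> ((snd c \<circ> \<gamma>) has_vector_derivative D' t) (at t within {u..v})"
      "continuous_on ({u..v} \<inter> U) D'"
      using loc[OF c, of t] t by (metis IntD1 IntD2 vimageE)
    have eq: "D' s = D s" if "s \<in> {u..v} \<inter> U" for s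
      using vector_derivative_within_closed_interval[OF uv _ U(3)[OF that]] that by (simp add: D_def)
    have "continuous_on ({u..v} \<inter> U) D"
      by (rule continuous_on_eq[OF U(4) eq])
    then have "continuous (at t within {u..v} \<inter> U) D"
      using t U(2) by (simp add: continuous_on_eq_continuous_within)
    then have "continuous (at t within {u..v} \<inter> U \<inter> \<gamma> -` fst c) D"
      by (rule continuous_within_subset) auto
    also have "at t within {u..v} \<inter> U \<inter> \<gamma> -` fst c = at t within {u..v} \<inter> \<gamma> -` fst c"
      using U(1,2) by (intro at_within_nhd[of t U]) auto
    finally show ?thesis using U(2) U(3)[of t] eq[of t] t by auto
  qed
  show "\<exists>D. chart_velocity c \<gamma> {u..v} D"
    unfolding chart_velocity_def
    by (intro exI[of _ D]) (use * in \<open>auto simp: continuous_on_eq_continuous_within\<close>)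
qed

text \<open>Continuity of the curve keeps it in the chart domain near t, where \<phi> along the
  curve factors through the chart.\<close>

lemma curve_chain:
  assumes c: "c \<in> atl" "\<gamma> t \<in> fst c" "t \<in> I" and cont: "continuous (at t within I) \<gamma>"
    and w: "((snd c \<circ> \<gamma>) has_vector_derivative w) (at t within I)"
    and D: "((\<phi> \<circ> chart_inv c) has_derivative D) (at (snd c (\<gamma> t)))"
  shows "((\<phi> \<circ> \<gamma>) has_vector_derivative D w) (at t within I)"
proof -
  have "((\<phi> \<circ> chart_inv c) \<circ> (snd c \<circ> \<gamma>) has_derivative D \<circ> (\<lambda>x. x *\<^sub>R w)) (at t within I)"
    using w D by (intro diff_chain_within) (auto simp: has_vector_derivative_def intro: has_derivative_at_withinI)
  moreover have "\<forall>\<^sub>F s in at t within I. ((\<phi> \<circ> chart_inv c) \<circ> (snd c \<circ> \<gamma>)) s = (\<phi> \<circ> \<gamma>) s"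
  proof -
    have "\<forall>\<^sub>F s in at t within I. \<gamma> s \<in> fst c"
      using cont open_chart[OF c(1)] c(2) unfolding continuous_within by (rule topological_tendstoD)
    then show ?thesis by eventually_elim (use c in auto)
  qed
  ultimately have "(\<phi> \<circ> \<gamma> has_derivative D \<circ> (\<lambda>x. x *\<^sub>R w)) (at t within I)"
    by (rule has_derivative_transform_eventually) (use c in auto)
  moreover have "D (x *\<^sub>R w) = x *\<^sub>R D w" for x
    by (rule linear_scale[OF has_derivative_linear[OF D]])
  ultimately show ?thesis by (simp add: has_vector_derivative_def comp_def)
qed

section \<open>Velocity and speed of a curve\<close>

definition speed :: "(real \<Rightarrow> 'm) \<Rightarrow> real \<Rightarrow> real" where
  "speed \<gamma> t = tnorm g (\<gamma> t) (velocity atl \<gamma> t)"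

text \<open>\<open>velocity\<close> uses the two-sided derivative, so it is tied to the derivatives
  of \<open>C1_curve_on\<close> only at interior points; there the chain rule for transition maps
  makes it a tangent vector.\<close>

lemma C1_curve_interior:
  assumes C: "C1_curve_on atl \<gamma> u v" and t: "t \<in> {u<..<v}"
  shows "isCont \<gamma> t"
    and "c \<in> atl \<Longrightarrow> \<gamma> t \<in> fst c \<Longrightarrow> ((snd c \<circ> \<gamma>) has_vector_derivative velocity atl \<gamma> t c) (at t)"
    and "velocity atl \<gamma> t \<in> tangent_space atl (\<gamma> t)"
proof -
  have at: "at t within {u..v} = at t"
    using t by (intro at_within_interior) simp
  have "continuous_on {u..v} \<gamma>" using C by (simp add: C1_curve_on_def)
  then show cont: "isCont \<gamma> t"
    using t at by (metis continuous_on_eq_continuous_within greaterThanLessThan_subseteq_atLeastAtMost_iff order_refl subsetD)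
  have der: "((snd c \<circ> \<gamma>) has_vector_derivative velocity atl \<gamma> t c) (at t)"
    if "c \<in> atl" "\<gamma> t \<in> fst c" for c
  proof -
    obtain D where "chart_velocity c \<gamma> {u..v} D"
      using C \<open>c \<in> atl\<close> unfolding C1_curve_on_iff by blast
    from chart_velocityD(1)[OF this, of t] have D: "((snd c \<circ> \<gamma>) has_vector_derivative D t) (at t)"
      using t at that by auto
    then show ?thesis
      using that by (simp add: velocity_def charts_at_def vector_derivative_at)
  qed
  show "c \<in> atl \<Longrightarrow> \<gamma> t \<in> fst c \<Longrightarrow> ((snd c \<circ> \<gamma>) has_vector_derivative velocity atl \<gamma> t c) (at t)"
    by (rule der)
  have "velocity atl \<gamma> t c' = frechet_derivative (snd c' \<circ> chart_inv c) (at (snd c (\<gamma> t))) (velocity atl \<gamma> t c)"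
    if "c \<in> charts_at atl (\<gamma> t)" "c' \<in> charts_at atl (\<gamma> t)" for c c'
  proof -
    have c: "c \<in> atl" "\<gamma> t \<in> fst c" "c' \<in> atl" "\<gamma> t \<in> fst c'" using that by (auto simp: charts_at_def)
    from curve_chain[OF c(1,2) UNIV_I cont der[OF c(1,2)] transition_has_derivative[OF c(1,3,2,4)]]
    have "((snd c' \<circ> \<gamma>) has_vector_derivative
      frechet_derivative (snd c' \<circ> chart_inv c) (at (snd c (\<gamma> t))) (velocity atl \<gamma> t c)) (at t)" .
    with der[OF c(3,4)] show ?thesis by (rule vector_derivative_unique_at)
  qed
  moreover have "velocity atl \<gamma> t c = 0" if "c \<notin> charts_at atl (\<gamma> t)" for c
    using that by (simp add: velocity_def)
  ultimately show "velocity atl \<gamma> t \<in> tangent_space atl (\<gamma> t)"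
    unfolding tangent_space_def by blast
qed

lemma speed_nonneg: "C1_curve_on atl \<gamma> u v \<Longrightarrow> t \<in> {u<..<v} \<Longrightarrow> 0 \<le> speed \<gamma> t"
  unfolding speed_def by (intro tnorm_nonneg C1_curve_interior(3))

text \<open>The one-sided derivative continues the speed to the end points, where
  \<open>velocity\<close> itself may be meaningless; this continuation serves to bound the speed up
  to the ends.\<close>

lemma C1_curve_speed_chart:
  assumes C: "C1_curve_on atl \<gamma> u v" and c: "c \<in> atl"
  obtains h where "continuous_on ({u..v} \<inter> \<gamma> -` fst c) h"
    and "\<And>t. t \<in> {u<..<v} \<Longrightarrow> \<gamma> t \<in> fst c \<Longrightarrow> speed \<gamma> t = h t"
proof -
  obtain D where "chart_velocity c \<gamma> {u..v} D" using C c unfolding C1_curve_on_iff by blast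
  note D = chart_velocityD[OF this]
  show ?thesis
  proof (rule that[of "\<lambda>t. chart_norm c (\<gamma> t) (D t)"])
    have "continuous_on ({u..v} \<inter> \<gamma> -` fst c) \<gamma>"
      using C continuous_on_subset unfolding C1_curve_on_def by blast
    then show "continuous_on ({u..v} \<inter> \<gamma> -` fst c) (\<lambda>t. chart_norm c (\<gamma> t) (D t))"
      by (rule continuous_on_chart_norm[OF c _ _ D(2)]) auto
    fix t assume t: "t \<in> {u<..<v}" "\<gamma> t \<in> fst c"
    have at: "at t within {u..v} = at t"
      using t by (intro at_within_interior) simp
    have "((snd c \<circ> \<gamma>) has_vector_derivative D t) (at t)"
      using D(1)[of t] t at by auto
    then have "velocity atl \<gamma> t c = D t"
      using C1_curve_interior(2)[OF C t(1) c t(2)] vector_derivative_unique_at by blast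
    then show "speed \<gamma> t = chart_norm c (\<gamma> t) (D t)"
      unfolding speed_def using tnorm_eq_chart_norm[OF c t(2) C1_curve_interior(3)[OF C t(1)]] by simp
  qed
qed

lemma isCont_speed:
  assumes C: "C1_curve_on atl \<gamma> u v" and t: "t \<in> {u<..<v}"
  shows "isCont (speed \<gamma>) t"
proof -
  obtain c where c: "c \<in> atl" "\<gamma> t \<in> fst c" using chart_exists by blast
  obtain h where h: "continuous_on ({u..v} \<inter> \<gamma> -` fst c) h"
    and eq: "\<And>t. t \<in> {u<..<v} \<Longrightarrow> \<gamma> t \<in> fst c \<Longrightarrow> speed \<gamma> t = h t"
    using C1_curve_speed_chart[OF C c(1)] by blast
  let ?U = "{u<..<v} \<inter> \<gamma> -` fst c"
  have "continuous_on {u<..<v} \<gamma>"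
    using C1_curve_interior(1)[OF C] by (auto intro: continuous_at_imp_continuous_on)
  then have op: "open ?U"
    using open_chart[OF c(1)] continuous_on_open_vimage[of "{u<..<v}" \<gamma>] by (metis inf_commute open_greaterThanLessThan)
  have "continuous_on ?U (speed \<gamma>)"
    by (rule continuous_on_eq[OF continuous_on_subset[OF h]]) (use eq in auto)
  then show ?thesis using op t c by (simp add: continuous_on_eq_continuous_at)
qed

text \<open>Near each point of the closed interval, ends included, the continuous extension gives a
  local bound, and by compactness finitely many of these suffice.\<close>

lemma speed_bounded:
  assumes C: "C1_curve_on atl \<gamma> u v"
  shows "\<exists>B. \<forall>t\<in>{u<..<v}. speed \<gamma> t \<le> B"
proof -
  have "\<exists>U B. open U \<and> t \<in> U \<and> (\<forall>s\<in>U \<inter> {u<..<v}. speed \<gamma> s \<le> B)" if t: "t \<in> {u..v}" for t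
  proof -
    obtain c where c: "c \<in> atl" "\<gamma> t \<in> fst c" using chart_exists by blast
    obtain h where h: "continuous_on ({u..v} \<inter> \<gamma> -` fst c) h"
      and eq: "\<And>t. t \<in> {u<..<v} \<Longrightarrow> \<gamma> t \<in> fst c \<Longrightarrow> speed \<gamma> t = h t"
      using C1_curve_speed_chart[OF C c(1)] by blast
    have "continuous_on {u..v} \<gamma>" using C by (simp add: C1_curve_on_def)
    then have "\<exists>V. open V \<and> V \<inter> {u..v} = \<gamma> -` fst c \<inter> {u..v}"
      using open_chart[OF c(1)] by (simp add: continuous_on_open_invariant)
    then obtain V where V: "open V" "{u..v} \<inter> \<gamma> -` fst c = V \<inter> {u..v}"
      by blast
    have "(h \<longlongrightarrow> h t) (at t within {u..v} \<inter> \<gamma> -` fst c)"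
      using h t c by (simp add: continuous_on_def)
    then have "\<forall>\<^sub>F s in at t within {u..v} \<inter> \<gamma> -` fst c. h s < h t + 1"
      by (rule order_tendstoD) simp
    then obtain W where W: "open W" "t \<in> W"
      "\<And>s. s \<in> W \<Longrightarrow> s \<noteq> t \<Longrightarrow> s \<in> {u..v} \<inter> \<gamma> -` fst c \<Longrightarrow> h s < h t + 1"
      unfolding eventually_at_topological by blast
    have "speed \<gamma> s \<le> h t + 1" if s: "s \<in> (V \<inter> W) \<inter> {u<..<v}" for s
    proof -
      have "s \<in> {u..v} \<inter> \<gamma> -` fst c" using s V(2) by auto
      then have "h s \<le> h t + 1" using W(3)[of s] s by (cases "s = t") auto
      then show ?thesis using eq[of s] s \<open>s \<in> {u..v} \<inter> \<gamma> -` fst c\<close> by auto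
    qed
    moreover have "t \<in> V \<inter> W" using V(2) t c W by auto
    moreover have "open (V \<inter> W)" using V W by auto
    ultimately show ?thesis by blast
  qed
  then obtain U B where UB: "\<And>t. t \<in> {u..v} \<Longrightarrow> open (U t) \<and> t \<in> U t \<and> (\<forall>s\<in>U t \<inter> {u<..<v}. speed \<gamma> s \<le> B t)"
    by metis
  obtain T where T: "T \<subseteq> {u..v}" "finite T" "{u..v} \<subseteq> (\<Union>t\<in>T. U t)"
    by (rule compactE_image[of "{u..v}" "{u..v}" U]) (use UB in auto)
  have "speed \<gamma> s \<le> (\<Sum>t\<in>T. \<bar>B t\<bar>)" if s: "s \<in> {u<..<v}" for s
  proof -
    have "s \<in> {u..v}" using s by auto
    then obtain t where t: "t \<in> T" "s \<in> U t" using T(3) by blast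
    then have "speed \<gamma> s \<le> B t" using UB[of t] T(1) s by blast
    then have "speed \<gamma> s \<le> \<bar>B t\<bar>" by simp
    also have "\<dots> \<le> (\<Sum>t\<in>T. \<bar>B t\<bar>)" using T t by (intro member_le_sum) auto
    finally show ?thesis .
  qed
  then show ?thesis by blast
qed

text \<open>All subintervals that avoid the break points are required to be \<open>C\<^sup>1\<close>, not only the
  gaps of the partition: the condition then passes to subintervals with the same \<open>S\<close>.\<close>

definition pwC1 :: "(real \<Rightarrow> 'm) \<Rightarrow> real \<Rightarrow> real \<Rightarrow> bool" where
  "pwC1 \<gamma> a b \<longleftrightarrow> (\<exists>S. finite S \<and>
     (\<forall>u v. a \<le> u \<and> u < v \<and> v \<le> b \<and> {u<..<v} \<inter> S = {} \<longrightarrow> C1_curve_on atl \<gamma> u v))"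

lemma pwC1_subset:
  assumes "pwC1 \<gamma> a b" "a \<le> a'" "b' \<le> b"
  shows "pwC1 \<gamma> a' b'"
proof -
  obtain S where S: "finite S"
    "\<And>u v. a \<le> u \<Longrightarrow> u < v \<Longrightarrow> v \<le> b \<Longrightarrow> {u<..<v} \<inter> S = {} \<Longrightarrow> C1_curve_on atl \<gamma> u v"
    using assms unfolding pwC1_def by blast
  show ?thesis
    unfolding pwC1_def by (rule exI[of _ S]) (use S assms in auto)
qed

lemma C1_imp_pwC1: "C1_curve_on atl \<gamma> a b \<Longrightarrow> pwC1 \<gamma> a b"
  unfolding pwC1_def by (rule exI[of _ "{}"]) (simp add: C1_curve_on_subset)

lemma finite_gap:
  fixes t :: real
  assumes "finite S" "a \<in> S" "b \<in> S" "a \<le> t" "t \<le> b" "t \<notin> S"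
  obtains u v where "u \<in> S" "v \<in> S" "u < t" "t < v" "{u<..<v} \<inter> S = {}"
proof -
  have A: "finite {s\<in>S. s < t}" "{s\<in>S. s < t} \<noteq> {}" "finite {s\<in>S. t < s}" "{s\<in>S. t < s} \<noteq> {}"
    using assms by (auto simp: less_le)
  let ?u = "Max {s\<in>S. s < t}" and ?v = "Min {s\<in>S. t < s}"
  have u: "?u \<in> {s\<in>S. s < t}" using Max_in[OF A(1,2)] .
  have v: "?v \<in> {s\<in>S. t < s}" using Min_in[OF A(3,4)] .
  have "s \<notin> {?u<..<?v}" if "s \<in> S" for s
  proof (cases "s < t")
    case True
    then have "s \<le> ?u" using A that by (intro Max_ge) auto
    then show ?thesis by simp
  next
    case False
    then have "s > t" using that assms by (metis not_less_iff_gr_or_eq)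
    then have "?v \<le> s" using A that by (intro Min_le) auto
    then show ?thesis by simp
  qed
  then show ?thesis using that[of ?u ?v] u v by blast
qed

text \<open>Adding the end points to the exceptional set places every other point strictly inside a
  gap, where the speed is continuous; as there are finitely many gaps, the speed has one bound for
  all of them.\<close>

lemma pwC1_partition:
  assumes "pwC1 \<gamma> a b" "a < b"
  obtains S B where "finite S" "{a, b} \<subseteq> S" "S \<subseteq> {a..b}"
    and "\<And>u v. a \<le> u \<Longrightarrow> u < v \<Longrightarrow> v \<le> b \<Longrightarrow> {u<..<v} \<inter> S = {} \<Longrightarrow> C1_curve_on atl \<gamma> u v"
    and "\<And>t. t \<in> {a..b} - S \<Longrightarrow> \<exists>u v. a \<le> u \<and> v \<le> b \<and> t \<in> {u<..<v} \<and> C1_curve_on atl \<gamma> u v"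
    and "\<And>t. t \<in> {a..b} - S \<Longrightarrow> 0 \<le> speed \<gamma> t \<and> speed \<gamma> t \<le> B"
proof -
  obtain S\<^sub>0 where S\<^sub>0: "finite S\<^sub>0"
    "\<And>u v. a \<le> u \<Longrightarrow> u < v \<Longrightarrow> v \<le> b \<Longrightarrow> {u<..<v} \<inter> S\<^sub>0 = {} \<Longrightarrow> C1_curve_on atl \<gamma> u v"
    using assms unfolding pwC1_def by blast
  define S where "S = insert a (insert b (S\<^sub>0 \<inter> {a..b}))"
  have S: "finite S" "{a, b} \<subseteq> S" "S \<subseteq> {a..b}" using S\<^sub>0 assms(2) by (auto simp: S_def)
  have C: "C1_curve_on atl \<gamma> u v" if "a \<le> u" "u < v" "v \<le> b" "{u<..<v} \<inter> S = {}" for u v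
  proof -
    have "{u<..<v} \<inter> S\<^sub>0 \<subseteq> {u<..<v} \<inter> S" using that by (auto simp: S_def)
    then show ?thesis using S\<^sub>0(2)[of u v] that by auto
  qed
  have gap: "\<exists>u v. u \<in> S \<and> v \<in> S \<and> t \<in> {u<..<v} \<and> a \<le> u \<and> v \<le> b \<and> C1_curve_on atl \<gamma> u v"
    if t: "t \<in> {a..b} - S" for t
  proof -
    obtain u v where uv: "u \<in> S" "v \<in> S" "u < t" "t < v" "{u<..<v} \<inter> S = {}"
      using finite_gap[of S a b t] S t by auto
    then have "a \<le> u" "v \<le> b" using S by auto
    then show ?thesis using uv C[of u v] by auto
  qed
  have "\<exists>B. \<forall>t\<in>{u<..<v}. speed \<gamma> t \<le> B" if "C1_curve_on atl \<gamma> u v" for u v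
    using speed_bounded[OF that] .
  then obtain B where B: "\<And>u v t. C1_curve_on atl \<gamma> u v \<Longrightarrow> t \<in> {u<..<v} \<Longrightarrow> speed \<gamma> t \<le> B u v"
    by metis
  \<comment> \<open>Summing over all pairs of points of \<open>S\<close> includes every gap without
    listing the gaps in order.\<close>
  let ?B = "\<Sum>p\<in>S\<times>S. \<bar>B (fst p) (snd p)\<bar>"
  have bound: "0 \<le> speed \<gamma> t \<and> speed \<gamma> t \<le> ?B" if t: "t \<in> {a..b} - S" for t
  proof -
    obtain u v where uv: "u \<in> S" "v \<in> S" "t \<in> {u<..<v}" "C1_curve_on atl \<gamma> u v"
      using gap[OF t] by blast
    have "speed \<gamma> t \<le> \<bar>B (fst (u, v)) (snd (u, v))\<bar>" using B[OF uv(4,3)] by simp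
    also have "\<dots> \<le> ?B" using uv S by (intro member_le_sum) auto
    finally show ?thesis using speed_nonneg[OF uv(4,3)] by simp
  qed
  show ?thesis
  proof (rule that[OF S C _ bound])
    show "\<exists>u v. a \<le> u \<and> v \<le> b \<and> t \<in> {u<..<v} \<and> C1_curve_on atl \<gamma> u v" if t: "t \<in> {a..b} - S" for t
      using gap[OF t] by blast
  qed
qed

text \<open>This holds also at a break point: within distance \<open>d\<close> there is no other
  one, so the curve is continuous on the closed piece to either side, and the two pieces are
  glued.\<close>

lemma pwC1_continuous:
  assumes "pwC1 \<gamma> a b"
  shows "continuous_on {a..b} \<gamma>"
  unfolding continuous_on_eq_continuous_within
proof
  fix t assume t: "t \<in> {a..b}"
  obtain S where S: "finite S"
    "\<And>u v. a \<le> u \<Longrightarrow> u < v \<Longrightarrow> v \<le> b \<Longrightarrow> {u<..<v} \<inter> S = {} \<Longrightarrow> C1_curve_on atl \<gamma> u v"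
    using assms unfolding pwC1_def by blast
  obtain d where d: "0 < d" "\<And>s. s \<in> S \<Longrightarrow> s \<noteq> t \<Longrightarrow> d \<le> dist t s"
    using finite_set_avoid[OF S(1), of t] by blast
  have piece: "continuous_on {u..v} \<gamma>" if "a \<le> u" "v \<le> b" "t - d \<le> u" "v \<le> t + d" "u = t \<or> v = t" for u v
  proof (cases "u < v")
    case True
    have "{u<..<v} \<inter> S = {}" using d(2) that by (force simp: dist_real_def)
    then show ?thesis using S(2)[of u v] True that by (simp add: C1_curve_on_def)
  next
    case False
    then show ?thesis by (cases "u = v") auto
  qed
  let ?u = "max a (t - d)" and ?v = "min b (t + d)"
  have "continuous_on ({?u..t} \<union> {t..?v}) \<gamma>"
    using t d(1) by (intro continuous_on_closed_Un piece) auto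
  also have "{?u..t} \<union> {t..?v} = {?u..?v}" using t d(1) by auto
  finally have "continuous (at t within {?u..?v}) \<gamma>"
    using t d(1) by (simp add: continuous_on_eq_continuous_within)
  also have "at t within {?u..?v} = at t within {a..b}"
    using d(1) by (intro at_within_nhd[of t "{t - d<..<t + d}"]) auto
  finally show "continuous (at t within {a..b}) \<gamma>" .
qed

section \<open>Length of a curve\<close>

definition len :: "(real \<Rightarrow> 'm) \<Rightarrow> real \<Rightarrow> real \<Rightarrow> real" where
  "len \<gamma> a b = integral {a..b} (speed \<gamma>)"

lemma speed_integrable:
  assumes "pwC1 \<gamma> a b"
  shows "speed \<gamma> integrable_on {a..b}"
proof (cases "a < b")
  case True
  obtain S B where S: "finite S"
    and reg: "\<And>t. t \<in> {a..b} - S \<Longrightarrow> \<exists>u v. a \<le> u \<and> v \<le> b \<and> t \<in> {u<..<v} \<and> C1_curve_on atl \<gamma> u v"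
    and B: "\<And>t. t \<in> {a..b} - S \<Longrightarrow> 0 \<le> speed \<gamma> t \<and> speed \<gamma> t \<le> B"
    by (rule pwC1_partition[OF assms True]) (rule that)
  have "continuous_on ({a..b} - S) (speed \<gamma>)"
    using reg isCont_speed by (intro continuous_at_imp_continuous_on) blast
  then show ?thesis
    using B by (intro piecewise_continuous_integrable(1)[OF S, where B = B]) auto
next
  case False
  then consider "a = b" | "b < a" by linarith
  then show ?thesis
  proof cases
    case 1 then show ?thesis using integrable_on_refl[of "speed \<gamma>" b] by simp
  next
    case 2 then show ?thesis by (simp add: integrable_on_empty)
  qed
qed

lemma len_nonneg:
  assumes "pwC1 \<gamma> a b"
  shows "0 \<le> len \<gamma> a b"
proof (cases "a < b")
  case True
  obtain S B where S: "finite S" and B: "\<And>t. t \<in> {a..b} - S \<Longrightarrow> 0 \<le> speed \<gamma> t \<and> speed \<gamma> t \<le> B"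
    by (rule pwC1_partition[OF assms True]) (rule that)
  \<comment> \<open>At the exceptional points the sign of \<open>speed\<close> is unknown; passing
    to the absolute value alters the integrand on a finite set only.\<close>
  have "integral {a..b} (speed \<gamma>) = integral {a..b} (\<lambda>t. \<bar>speed \<gamma> t\<bar>)"
    using B by (intro integral_spike[OF negligible_finite[OF S]]) auto
  also have "\<dots> \<ge> 0"
    by (cases "(\<lambda>t. \<bar>speed \<gamma> t\<bar>) integrable_on {a..b}")
      (auto intro: integral_nonneg simp: not_integrable_integral)
  finally show ?thesis by (simp add: len_def)
next
  case False
  then have "a = b \<or> b < a" by linarith
  then show ?thesis by (auto simp: len_def)
qed

lemma len_combine:
  "pwC1 \<gamma> a c \<Longrightarrow> a \<le> b \<Longrightarrow> b \<le> c \<Longrightarrow> len \<gamma> a b + len \<gamma> b c = len \<gamma> a c"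
  unfolding len_def by (intro Henstock_Kurzweil_Integration.integral_combine speed_integrable)

lemma len_mono:
  assumes "pwC1 \<gamma> a b" "a \<le> u" "u \<le> v" "v \<le> b"
  shows "len \<gamma> u v \<le> len \<gamma> a b"
proof -
  have "len \<gamma> a u + len \<gamma> u b = len \<gamma> a b" using assms by (intro len_combine) auto
  moreover have "len \<gamma> u v + len \<gamma> v b = len \<gamma> u b"
    using assms pwC1_subset[OF assms(1), of u b] by (intro len_combine) auto
  moreover have "0 \<le> len \<gamma> a u" "0 \<le> len \<gamma> v b"
    using assms by (auto intro!: len_nonneg pwC1_subset[OF assms(1)])
  ultimately show ?thesis by simp
qed

lemma len_le:
  assumes "pwC1 \<gamma> a b" "a \<le> b" "finite T" "\<And>t. t \<in> {a<..<b} - T \<Longrightarrow> speed \<gamma> t \<le> M"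
  shows "len \<gamma> a b \<le> M * (b - a)"
proof -
  let ?T = "insert a (insert b T)"
  have fin: "finite ?T" using assms by simp
  let ?g = "\<lambda>t. if t \<in> ?T then M else speed \<gamma> t"
  have "?g integrable_on {a..b}"
    by (rule integrable_spike_finite[OF fin _ speed_integrable[OF assms(1)]]) auto
  then have "integral {a..b} ?g \<le> integral {a..b} (\<lambda>_. M)"
    using assms(4) by (intro integral_le) auto
  moreover have "integral {a..b} ?g = len \<gamma> a b"
    unfolding len_def by (rule integral_spike[OF negligible_finite[OF fin]]) auto
  ultimately show ?thesis using assms(2) by (simp add: mult.commute)
qed

section \<open>Reparametrisation and concatenation\<close>

lemma velocity_cong:
  assumes "\<And>s. s \<in> {a<..<b} \<Longrightarrow> \<gamma> s = \<gamma>' s" "t \<in> {a<..<b}"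
  shows "velocity atl \<gamma> t = velocity atl \<gamma>' t"
proof
  fix c :: "('m, 'n) chart"
  have "\<forall>\<^sub>F s in nhds t. s \<in> {a<..<b}"
    using assms(2) by (intro eventually_nhds_in_open) auto
  then have "\<forall>\<^sub>F s in nhds t. s \<in> UNIV \<longrightarrow> (snd c \<circ> \<gamma>) s = (snd c \<circ> \<gamma>') s"
    by eventually_elim (use assms(1) in simp)
  then have "vector_derivative (snd c \<circ> \<gamma>) (at t) = vector_derivative (snd c \<circ> \<gamma>') (at t)"
    by (intro vector_derivative_cong_eq) auto
  then show "velocity atl \<gamma> t c = velocity atl \<gamma>' t c"
    using assms by (simp add: velocity_def)
qed

lemma pwC1_cong:
  assumes "pwC1 \<gamma> a b" "\<And>t. t \<in> {a..b} \<Longrightarrow> \<gamma> t = \<gamma>' t"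
  shows "pwC1 \<gamma>' a b" "len \<gamma>' a b = len \<gamma> a b"
proof -
  obtain S where S: "finite S"
    "\<And>u v. a \<le> u \<Longrightarrow> u < v \<Longrightarrow> v \<le> b \<Longrightarrow> {u<..<v} \<inter> S = {} \<Longrightarrow> C1_curve_on atl \<gamma> u v"
    using assms(1) unfolding pwC1_def by blast
  show "pwC1 \<gamma>' a b"
    unfolding pwC1_def
    by (rule exI[of _ S]) (use S(1) in \<open>auto intro!: C1_curve_on_cong[OF S(2)] assms(2)\<close>)
  have "speed \<gamma> t = speed \<gamma>' t" if "t \<in> {a..b} - {a, b}" for t
    unfolding speed_def using velocity_cong[of a b \<gamma> \<gamma>' t] assms(2)[of t] assms(2) that by simp
  then show "len \<gamma>' a b = len \<gamma> a b"
    unfolding len_def by (intro integral_spike[of "{a, b}"]) auto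
qed

lemma pwC1_join:
  assumes "pwC1 \<gamma> a b" "pwC1 \<gamma> b c"
  shows "pwC1 \<gamma> a c"
proof -
  obtain S\<^sub>1 where 1: "finite S\<^sub>1"
    "\<And>u v. a \<le> u \<Longrightarrow> u < v \<Longrightarrow> v \<le> b \<Longrightarrow> {u<..<v} \<inter> S\<^sub>1 = {} \<Longrightarrow> C1_curve_on atl \<gamma> u v"
    using assms(1) unfolding pwC1_def by blast
  obtain S\<^sub>2 where 2: "finite S\<^sub>2"
    "\<And>u v. b \<le> u \<Longrightarrow> u < v \<Longrightarrow> v \<le> c \<Longrightarrow> {u<..<v} \<inter> S\<^sub>2 = {} \<Longrightarrow> C1_curve_on atl \<gamma> u v"
    using assms(2) unfolding pwC1_def by blast
  have "C1_curve_on atl \<gamma> u v"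
    if "a \<le> u" "u < v" "v \<le> c" "{u<..<v} \<inter> (insert b (S\<^sub>1 \<union> S\<^sub>2)) = {}" for u v
  proof -
    have "v \<le> b \<or> b \<le> u" using that by (meson disjoint_iff greaterThanLessThan_iff insertI1 not_le)
    then show ?thesis using 1(2)[of u v] 2(2)[of u v] that by blast
  qed
  then show ?thesis
    unfolding pwC1_def using 1(1) 2(1) by (intro exI[of _ "insert b (S\<^sub>1 \<union> S\<^sub>2)"]) simp
qed

lemma speed_affine:
  assumes p: "0 < p" and C: "C1_curve_on atl \<gamma> (p * u + q) (p * v + q)" and t: "t \<in> {u<..<v}"
  shows "speed (\<lambda>t. \<gamma> (p * t + q)) t = p * speed \<gamma> (p * t + q)"
proof -
  let ?\<gamma> = "\<lambda>t. \<gamma> (p * t + q)"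
  obtain c where c: "c \<in> atl" "\<gamma> (p * t + q) \<in> fst c" using chart_exists by blast
  have pt: "p * t + q \<in> {p * u + q<..<p * v + q}" using t p by simp
  note C' = C1_curve_on_reparam[OF C p order_refl order_refl refl]
  have "((snd c \<circ> \<gamma>) has_vector_derivative velocity atl \<gamma> (p * t + q) c) (at (p * t + q))"
    using C1_curve_interior(2)[OF C pt c] .
  from affine_has_vector_derivative[OF has_vector_derivative_at_within[OF this], of UNIV]
  have "((snd c \<circ> ?\<gamma>) has_vector_derivative p *\<^sub>R velocity atl \<gamma> (p * t + q) c) (at t)"
    by (simp add: comp_def)
  moreover have "((snd c \<circ> ?\<gamma>) has_vector_derivative velocity atl ?\<gamma> t c) (at t)"
    using C1_curve_interior(2)[OF C' t c] .
  ultimately have "velocity atl ?\<gamma> t c = p *\<^sub>R velocity atl \<gamma> (p * t + q) c"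
    using vector_derivative_unique_at by blast
  then show ?thesis
    unfolding speed_def
    by (simp add: tnorm_eq_chart_norm[OF c C1_curve_interior(3)[OF C' t]]
        tnorm_eq_chart_norm[OF c C1_curve_interior(3)[OF C pt]] chart_norm_scaleR[OF c] p less_imp_le)
qed

lemma pwC1_affine:
  assumes p: "0 < p" and \<gamma>: "pwC1 \<gamma> (p * a + q) (p * b + q)" and ab: "a < b"
  shows "pwC1 (\<lambda>t. \<gamma> (p * t + q)) a b"
    and "len (\<lambda>t. \<gamma> (p * t + q)) a b = len \<gamma> (p * a + q) (p * b + q)"
proof -
  let ?\<gamma> = "\<lambda>t. \<gamma> (p * t + q)"
  have "p * a + q < p * b + q" using p ab by simp
  then obtain S B where S: "finite S"
    and gap: "\<And>u v. p * a + q \<le> u \<Longrightarrow> u < v \<Longrightarrow> v \<le> p * b + q \<Longrightarrow> {u<..<v} \<inter> S = {} \<Longrightarrow> C1_curve_on atl \<gamma> u v"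
    and reg: "\<And>t. t \<in> {p * a + q..p * b + q} - S \<Longrightarrow>
      \<exists>u v. p * a + q \<le> u \<and> v \<le> p * b + q \<and> t \<in> {u<..<v} \<and> C1_curve_on atl \<gamma> u v"
    by (rule pwC1_partition[OF \<gamma>]) (rule that)
  define S' where "S' = (\<lambda>s. (s - q) / p) ` S"
  have S': "finite S'" using S by (simp add: S'_def)
  have mem: "p * t + q \<in> S \<Longrightarrow> t \<in> S'" for t
    using p unfolding S'_def by (intro image_eqI[of _ _ "p * t + q"]) auto
  have "C1_curve_on atl ?\<gamma> u v" if uv: "a \<le> u" "u < v" "v \<le> b" "{u<..<v} \<inter> S' = {}" for u v
  proof (rule C1_curve_on_reparam[OF _ p order_refl order_refl refl], rule gap)
    have "s \<notin> S" if "p * u + q < s" "s < p * v + q" for s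
    proof
      assume "s \<in> S"
      then have "(s - q) / p \<in> S'" using mem[of "(s - q) / p"] p by simp
      then show False using uv(4) that p by (auto simp: field_simps disjoint_iff)
    qed
    then show "{p * u + q<..<p * v + q} \<inter> S = {}" by auto
  qed (use uv p in auto)
  then show "pwC1 ?\<gamma> a b" unfolding pwC1_def using S' by blast
  have sp: "speed ?\<gamma> t = p * speed \<gamma> (p * t + q)" if t: "t \<in> {a..b} - S'" for t
  proof -
    have "p * t + q \<in> {p * a + q..p * b + q} - S" using t mem p by auto
    then obtain u v where uv: "p * t + q \<in> {u<..<v}" "C1_curve_on atl \<gamma> u v" using reg by blast
    have eq: "u = p * ((u - q) / p) + q" "v = p * ((v - q) / p) + q" using p by simp_all
    show ?thesis
      by (rule speed_affine[OF p, of \<gamma> "(u - q) / p" q "(v - q) / p"])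
        (use uv eq p in \<open>auto simp: pos_divide_less_eq pos_less_divide_eq mult.commute\<close>)
  qed
  have "(speed \<gamma> has_integral len \<gamma> (p * a + q) (p * b + q)) (cbox (p * a + q) (p * b + q))"
    unfolding len_def using integrable_integral[OF speed_integrable[OF \<gamma>]] by simp
  \<comment> \<open>The substitution divides the integral by \<open>p\<close>, which is compensated
    by the factor \<open>p\<close> in the speed of the reparametrised curve.\<close>
  from has_integral_affinity'[OF this p, of q]
  have "((\<lambda>t. speed \<gamma> (p * t + q)) has_integral len \<gamma> (p * a + q) (p * b + q) / p) {a..b}"
    using p by (simp add: field_simps)
  from has_integral_mult_right[OF this, of p]
  have "((\<lambda>t. p * speed \<gamma> (p * t + q)) has_integral len \<gamma> (p * a + q) (p * b + q)) {a..b}"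
    using p by simp
  then have "(speed ?\<gamma> has_integral len \<gamma> (p * a + q) (p * b + q)) {a..b}"
    by (rule has_integral_spike_finite[OF S', rotated]) (rule sp)
  then show "len ?\<gamma> a b = len \<gamma> (p * a + q) (p * b + q)" unfolding len_def by (simp add: integral_unique)
qed

text \<open>The inclusion of images is there for \<open>compact_neighbourhood\<close>, where a curve
  is confined by prefixing another one to it.\<close>

lemma curve_concat:
  assumes "pwC1 \<gamma>\<^sub>1 0 1" "pwC1 \<gamma>\<^sub>2 0 1" "\<gamma>\<^sub>1 1 = \<gamma>\<^sub>2 0"
  obtains \<gamma> where "pwC1 \<gamma> 0 1" "\<gamma> 0 = \<gamma>\<^sub>1 0" "\<gamma> 1 = \<gamma>\<^sub>2 1"
    "len \<gamma> 0 1 = len \<gamma>\<^sub>1 0 1 + len \<gamma>\<^sub>2 0 1" "\<gamma>\<^sub>2 ` {0..1} \<subseteq> \<gamma> ` {0..1}"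
proof -
  \<comment> \<open>The shift is written as p * t + q to fit \<open>pwC1_affine\<close>; the joined
    curve lives on [0, 2] and is rescaled to [0, 1] at the end.\<close>
  define \<gamma> where "\<gamma> t = (if t \<le> 1 then \<gamma>\<^sub>1 t else \<gamma>\<^sub>2 (1 * t + (-1)))" for t
  have 1: "pwC1 \<gamma> 0 1" "len \<gamma> 0 1 = len \<gamma>\<^sub>1 0 1"
    using pwC1_cong[OF assms(1), of \<gamma>] by (simp_all add: \<gamma>_def)
  have 2: "pwC1 (\<lambda>t. \<gamma>\<^sub>2 (1 * t + (-1))) 1 2" "len (\<lambda>t. \<gamma>\<^sub>2 (1 * t + (-1))) 1 2 = len \<gamma>\<^sub>2 0 1"
    using pwC1_affine[of 1 \<gamma>\<^sub>2 1 "-1" 2] assms(2) by simp_all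
  have eq: "\<gamma>\<^sub>2 (1 * t + (-1)) = \<gamma> t" if "t \<in> {1..2}" for t
    using that assms(3) by (cases "t = 1") (auto simp: \<gamma>_def)
  have 3: "pwC1 \<gamma> 1 2" "len \<gamma> 1 2 = len \<gamma>\<^sub>2 0 1"
    using pwC1_cong[OF 2(1) eq] 2(2) by simp_all
  have 4: "pwC1 \<gamma> 0 2" by (rule pwC1_join[OF 1(1) 3(1)])
  have 5: "len \<gamma> 0 2 = len \<gamma>\<^sub>1 0 1 + len \<gamma>\<^sub>2 0 1"
    using len_combine[OF 4, of 1] 1 3 by simp
  show ?thesis
  proof (rule that[of "\<lambda>t. \<gamma> (2 * t + 0)"])
    show "pwC1 (\<lambda>t. \<gamma> (2 * t + 0)) 0 1" using pwC1_affine(1)[of 2 \<gamma> 0 0 1] 4 by simp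
    show "len (\<lambda>t. \<gamma> (2 * t + 0)) 0 1 = len \<gamma>\<^sub>1 0 1 + len \<gamma>\<^sub>2 0 1"
      using pwC1_affine(2)[of 2 \<gamma> 0 0 1] 4 5 by simp
    show "\<gamma>\<^sub>2 ` {0..1} \<subseteq> (\<lambda>t. \<gamma> (2 * t + 0)) ` {0..1}"
    proof (intro image_subsetI)
      fix s :: real assume s: "s \<in> {0..1}"
      then show "\<gamma>\<^sub>2 s \<in> (\<lambda>t. \<gamma> (2 * t + 0)) ` {0..1}"
        by (intro image_eqI[of _ _ "(s + 1) / 2"]) (auto simp: \<gamma>_def assms(3) add_divide_distrib)
    qed
  qed (simp_all add: \<gamma>_def)
qed

text \<open>The direction to \<open>pwC1\<close> must treat subintervals whose ends are not break
  points: such an interval lies between two neighbouring break points and inherits its regularity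
  from that gap.\<close>

lemma piecewise_C1_curve_iff: "piecewise_C1_curve atl \<gamma> \<longleftrightarrow> pwC1 \<gamma> 0 1"
proof
  assume "pwC1 \<gamma> 0 1"
  then obtain S where S: "finite S" "{0, 1} \<subseteq> S" "S \<subseteq> {0..1}"
    "\<And>u v. 0 \<le> u \<Longrightarrow> u < v \<Longrightarrow> v \<le> 1 \<Longrightarrow> {u<..<v} \<inter> S = {} \<Longrightarrow> C1_curve_on atl \<gamma> u v"
    by (rule pwC1_partition[OF _ zero_less_one]) (rule that)
  then show "piecewise_C1_curve atl \<gamma>"
    unfolding piecewise_C1_curve_def
  proof (intro exI[of _ S] conjI ballI impI)
    fix a b assume "a \<in> S" "b \<in> S" and ab: "a < b \<and> {a<..<b} \<inter> S = {}"
    then have "0 \<le> a" "b \<le> 1" using S(3) by auto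
    then show "C1_curve_on atl \<gamma> a b" using ab by (intro S(4)) auto
  qed (use S in auto)
next
  assume "piecewise_C1_curve atl \<gamma>"
  then obtain S where S: "finite S" "{0, 1} \<subseteq> S" "S \<subseteq> {0..1}"
    "\<And>a b. a \<in> S \<Longrightarrow> b \<in> S \<Longrightarrow> a < b \<Longrightarrow> {a<..<b} \<inter> S = {} \<Longrightarrow> C1_curve_on atl \<gamma> a b"
    unfolding piecewise_C1_curve_def by metis
  have "C1_curve_on atl \<gamma> u v" if uv: "0 \<le> u" "u < v" "v \<le> 1" "{u<..<v} \<inter> S = {}" for u v
  proof -
    have fin: "finite {s\<in>S. s \<le> u}" "{s\<in>S. s \<le> u} \<noteq> {}" "finite {s\<in>S. v \<le> s}" "{s\<in>S. v \<le> s} \<noteq> {}"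
      using S uv by auto
    let ?a = "Max {s\<in>S. s \<le> u}" and ?b = "Min {s\<in>S. v \<le> s}"
    have a: "?a \<in> {s\<in>S. s \<le> u}" using Max_in[OF fin(1,2)] .
    have b: "?b \<in> {s\<in>S. v \<le> s}" using Min_in[OF fin(3,4)] .
    have "s \<notin> {?a<..<?b}" if "s \<in> S" for s
    proof -
      have "s \<le> u \<or> v \<le> s" using that uv(4) by (metis disjoint_iff greaterThanLessThan_iff not_le)
      then show ?thesis
        using Max_ge[OF fin(1), of s] Min_le[OF fin(3), of s] that by auto
    qed
    then have "C1_curve_on atl \<gamma> ?a ?b" using a b uv by (intro S(4)) auto
    then show ?thesis by (rule C1_curve_on_subset) (use a b in auto)
  qed
  then show "pwC1 \<gamma> 0 1" unfolding pwC1_def using S(1) by blast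
qed

section \<open>Distance as an infimum of lengths\<close>

lemma riem_dist_eq:
  "rdist x y = (INF \<gamma> \<in> {\<gamma>. pwC1 \<gamma> 0 1 \<and> \<gamma> 0 = x \<and> \<gamma> 1 = y}. len \<gamma> 0 1)"
  unfolding riem_dist_def piecewise_C1_curve_iff curve_length_def len_def
  by (simp add: speed_def[abs_def])

lemma len_bdd_below: "bdd_below ((\<lambda>\<gamma>. len \<gamma> 0 1) ` {\<gamma>. pwC1 \<gamma> 0 1 \<and> \<gamma> 0 = x \<and> \<gamma> 1 = y})"
  by (rule bdd_belowI[of _ 0]) (use len_nonneg in auto)

lemma riem_dist_le_len:
  assumes "pwC1 \<gamma> a b" "a < b"
  shows "rdist (\<gamma> a) (\<gamma> b) \<le> len \<gamma> a b"
proof -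
  let ?\<gamma> = "\<lambda>t. \<gamma> ((b - a) * t + a)"
  have \<gamma>: "pwC1 ?\<gamma> 0 1" "len ?\<gamma> 0 1 = len \<gamma> a b"
    using pwC1_affine[of "b - a" \<gamma> 0 a 1] assms by simp_all
  have "rdist (?\<gamma> 0) (?\<gamma> 1) \<le> len ?\<gamma> 0 1"
    unfolding riem_dist_eq by (rule cINF_lower[OF len_bdd_below]) (simp add: \<gamma>(1))
  then show ?thesis using \<gamma>(2) by simp
qed

section \<open>Riemannian distance and topology\<close>

text \<open>Covers inverse charts, which supply short curves near a point, and smooth simplices,
  which have to be shown Lipschitz. In both cases curves arise as images of straight
  segments.\<close>

definition Ck1_param :: "'a::euclidean_space set \<Rightarrow> ('a \<Rightarrow> 'm) \<Rightarrow> bool" where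
  "Ck1_param U \<sigma> \<longleftrightarrow> open U \<and> continuous_on U \<sigma> \<and>
     (\<forall>c\<in>atl. Ck_on 1 (snd c \<circ> \<sigma>) (U \<inter> \<sigma> -` fst c))"

lemma Ck1_param_open: "Ck1_param U \<sigma> \<Longrightarrow> c \<in> atl \<Longrightarrow> open (U \<inter> \<sigma> -` fst c)"
  using open_chart[of c] continuous_on_open_vimage[of U \<sigma>] by (simp add: Ck1_param_def inf_commute)

lemma Ck1_param_chart_inv:
  assumes c: "c \<in> atl"
  shows "Ck1_param (snd c ` fst c) (chart_inv c)"
  unfolding Ck1_param_def
proof (intro conjI ballI open_chart_image continuous_on_chart_inv c)
  fix c' assume "c' \<in> atl"
  then show "Ck_on 1 (snd c' \<circ> chart_inv c) (snd c ` fst c \<inter> chart_inv c -` fst c')"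
    using transition_Ck_1[OF c, of c'] chart_image_eq[OF c, of "fst c'"] by simp
qed

lemma Ck1_param_segment:
  fixes x y :: "'a::euclidean_space"
  assumes \<sigma>: "Ck1_param U \<sigma>" and U: "\<And>t. t \<in> {0..1} \<Longrightarrow> x + t *\<^sub>R (y - x) \<in> U"
  shows "C1_curve_on atl (\<lambda>t. \<sigma> (x + t *\<^sub>R (y - x))) 0 1"
    and "t \<in> {0<..<1} \<Longrightarrow> c \<in> atl \<Longrightarrow> \<sigma> (x + t *\<^sub>R (y - x)) \<in> fst c \<Longrightarrow>
      speed (\<lambda>t. \<sigma> (x + t *\<^sub>R (y - x))) t = chart_norm c (\<sigma> (x + t *\<^sub>R (y - x)))
        (frechet_derivative (snd c \<circ> \<sigma>) (at (x + t *\<^sub>R (y - x))) (y - x))"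
proof -
  let ?z = "\<lambda>t. x + t *\<^sub>R (y - x)"
  let ?\<gamma> = "\<lambda>t. \<sigma> (?z t)"
  have z: "continuous_on I ?z" for I by (intro continuous_intros)
  have der: "((snd c \<circ> ?\<gamma>) has_vector_derivative
      frechet_derivative (snd c \<circ> \<sigma>) (at (?z t)) (y - x)) (at t within I)"
    if t: "t \<in> {0..1}" "?\<gamma> t \<in> fst c" and c: "c \<in> atl" for t c I
  proof -
    have D: "((snd c \<circ> \<sigma>) has_derivative frechet_derivative (snd c \<circ> \<sigma>) (at (?z t))) (at (?z t))"
      using \<sigma> c t U[OF t(1)] by (intro Ck_on_1_has_derivative[of _ "U \<inter> \<sigma> -` fst c"]) (auto simp: Ck1_param_def)
    have "(?z has_derivative (\<lambda>s. s *\<^sub>R (y - x))) (at t within I)"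
      by (auto intro!: derivative_eq_intros)
    from diff_chain_within[OF this has_derivative_at_withinI[OF D]]
    show ?thesis
      using linear_scale[OF has_derivative_linear[OF D]] by (simp add: has_vector_derivative_def o_def)
  qed
  show C: "C1_curve_on atl ?\<gamma> 0 1"
    unfolding C1_curve_on_def
  proof (intro conjI ballI)
    show "continuous_on {0..1} ?\<gamma>"
      by (rule continuous_on_compose2[OF _ z, of U]) (use \<sigma> U in \<open>auto simp: Ck1_param_def\<close>)
    fix c assume c: "c \<in> atl"
    show "\<exists>D. (\<forall>t\<in>{0..1} \<inter> ?\<gamma> -` fst c. ((snd c \<circ> ?\<gamma>) has_vector_derivative D t) (at t within {0..1})) \<and>
        continuous_on ({0..1} \<inter> ?\<gamma> -` fst c) D"
    proof (intro exI[of _ "\<lambda>t. frechet_derivative (snd c \<circ> \<sigma>) (at (?z t)) (y - x)"] conjI ballI)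
      show "continuous_on ({0..1} \<inter> ?\<gamma> -` fst c) (\<lambda>t. frechet_derivative (snd c \<circ> \<sigma>) (at (?z t)) (y - x))"
        by (rule Ck_on_1_continuous_on_derivative[of _ "U \<inter> \<sigma> -` fst c", OF _ z])
          (use \<sigma> c U in \<open>auto simp: Ck1_param_def\<close>)
    qed (use der c in auto)
  qed
  show "speed ?\<gamma> t = chart_norm c (?\<gamma> t) (frechet_derivative (snd c \<circ> \<sigma>) (at (?z t)) (y - x))"
    if t: "t \<in> {0<..<1}" and c: "c \<in> atl" "?\<gamma> t \<in> fst c"
  proof -
    have "velocity atl ?\<gamma> t c = frechet_derivative (snd c \<circ> \<sigma>) (at (?z t)) (y - x)"
      using C1_curve_interior(2)[OF C t c] der[of t c UNIV] t c vector_derivative_unique_at by force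
    then show ?thesis
      unfolding speed_def using tnorm_eq_chart_norm[OF c C1_curve_interior(3)[OF C t]] by simp
  qed
qed

text \<open>A bound \<open>M\<close> for the operator norm of the derivative of \<sigma> at
  \<open>z\<close>. One chart is enough, as the Riemannian norm of the image vector is the same in
  all charts.\<close>

definition param_bound :: "('a::euclidean_space \<Rightarrow> 'm) \<Rightarrow> real \<Rightarrow> 'a \<Rightarrow> bool" where
  "param_bound \<sigma> M z \<longleftrightarrow> (\<exists>c\<in>atl. \<sigma> z \<in> fst c \<and>
     (\<forall>e. chart_norm c (\<sigma> z) (frechet_derivative (snd c \<circ> \<sigma>) (at z) e) \<le> M * norm e))"

lemma param_bound_mono: "param_bound \<sigma> M z \<Longrightarrow> M \<le> M' \<Longrightarrow> param_bound \<sigma> M' z"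
  unfolding param_bound_def by (meson mult_right_mono norm_ge_zero order_trans)

text \<open>Homogeneity again reduces the claim to unit vectors, now over a closed ball around
  \<open>x\<close>, and a continuous function on a compact product is bounded.\<close>

lemma param_bound_local:
  assumes \<sigma>: "Ck1_param U \<sigma>" and x: "x \<in> U"
  shows "\<exists>r>0. \<exists>M. cball x r \<subseteq> U \<and> (\<forall>z\<in>cball x r. param_bound \<sigma> M z)"
proof -
  obtain c where c: "c \<in> atl" "\<sigma> x \<in> fst c" using chart_exists by blast
  let ?W = "U \<inter> \<sigma> -` fst c"
  have "open ?W" using Ck1_param_open[OF \<sigma> c(1)] .
  then obtain r where r: "r > 0" "cball x r \<subseteq> ?W" using open_contains_cball c x by blast
  let ?S = "cball x r \<times> sphere (0::'a) 1"
  let ?f = "\<lambda>p. chart_norm c (\<sigma> (fst p)) (frechet_derivative (snd c \<circ> \<sigma>) (at (fst p)) (snd p))"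
  have "continuous_on ?S ?f"
  proof (rule continuous_on_chart_norm[OF c(1)])
    show "continuous_on ?S (\<lambda>p. \<sigma> (fst p))"
      by (rule continuous_on_compose2[of U \<sigma>])
        (use \<sigma> r in \<open>auto simp: Ck1_param_def intro!: continuous_intros\<close>)
    show "(\<lambda>p. \<sigma> (fst p)) ` ?S \<subseteq> fst c" using r by auto
    show "continuous_on ?S (\<lambda>p. frechet_derivative (snd c \<circ> \<sigma>) (at (fst p)) (snd p))"
      by (rule Ck_on_1_continuous_on_derivative[of _ ?W])
        (use \<sigma> c r in \<open>auto simp: Ck1_param_def intro!: continuous_intros\<close>)
  qed
  moreover have "compact ?S" by (intro compact_Times) auto
  ultimately have "bounded (?f ` ?S)" using compact_continuous_image compact_imp_bounded by blast
  then obtain M where M: "\<And>p. p \<in> ?S \<Longrightarrow> \<bar>?f p\<bar> \<le> M" by (force simp: bounded_iff)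
  have "param_bound \<sigma> M z" if z: "z \<in> cball x r" for z
    unfolding param_bound_def
  proof (intro bexI[of _ c] conjI allI c)
    show zc: "\<sigma> z \<in> fst c" using r z by auto
    fix e
    have "(snd c \<circ> \<sigma> has_derivative frechet_derivative (snd c \<circ> \<sigma>) (at z)) (at z)"
      using \<sigma> c r z by (intro Ck_on_1_has_derivative[of _ ?W]) (auto simp: Ck1_param_def)
    from has_derivative_linear[OF this]
    have lin: "linear (frechet_derivative (snd c \<circ> \<sigma>) (at z))" .
    show "chart_norm c (\<sigma> z) (frechet_derivative (snd c \<circ> \<sigma>) (at z) e) \<le> M * norm e"
    proof (cases "e = 0")
      case True
      then show ?thesis by (simp add: linear_0[OF lin] chart_norm_0[OF c(1) zc])
    next
      case False
      then have p: "(z, (1 / norm e) *\<^sub>R e) \<in> ?S" using z by simp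
      have "chart_norm c (\<sigma> z) (frechet_derivative (snd c \<circ> \<sigma>) (at z) e) / norm e = ?f (z, (1 / norm e) *\<^sub>R e)"
        using False by (simp add: linear_scale[OF lin] chart_norm_scaleR[OF c(1) zc])
      also have "\<dots> \<le> M" using M[OF p] by linarith
      finally show ?thesis using False by (simp add: field_simps)
    qed
  qed
  then show ?thesis using r by blast
qed

lemma param_segment:
  fixes x y :: "'a::euclidean_space"
  assumes \<sigma>: "Ck1_param U \<sigma>" and U: "closed_segment x y \<subseteq> U"
    and M: "\<And>z. z \<in> closed_segment x y \<Longrightarrow> param_bound \<sigma> M z"
  obtains \<gamma> where "pwC1 \<gamma> 0 1" "\<gamma> 0 = \<sigma> x" "\<gamma> 1 = \<sigma> y" "len \<gamma> 0 1 \<le> M * norm (y - x)"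
proof -
  let ?\<gamma> = "\<lambda>t. \<sigma> (x + t *\<^sub>R (y - x))"
  have seg: "x + t *\<^sub>R (y - x) \<in> closed_segment x y" if "t \<in> {0..1}" for t
    using that unfolding closed_segment_def by (auto intro!: exI[of _ t] simp: algebra_simps)
  note * = Ck1_param_segment[OF \<sigma> subsetD[OF U seg]]
  have pw: "pwC1 ?\<gamma> 0 1" by (rule C1_imp_pwC1[OF *(1)])
  have "len ?\<gamma> 0 1 \<le> (M * norm (y - x)) * (1 - 0)"
  proof (rule len_le[OF pw, of "{}"])
    fix t :: real assume "t \<in> {0<..<1} - {}"
    then have t: "t \<in> {0<..<1}" "t \<in> {0..1}" by auto
    obtain c where "c \<in> atl" "?\<gamma> t \<in> fst c"
      "\<And>e. chart_norm c (?\<gamma> t) (frechet_derivative (snd c \<circ> \<sigma>) (at (x + t *\<^sub>R (y - x))) e) \<le> M * norm e"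
      using M[OF seg[OF t(2)]] unfolding param_bound_def by blast
    then show "speed ?\<gamma> t \<le> M * norm (y - x)" using *(2)[OF _ t(1)] by simp
  qed auto
  then show ?thesis using that[OF pw] by simp
qed

lemma short_curves_near:
  assumes "0 < \<epsilon>"
  shows "\<exists>V. open V \<and> x \<in> V \<and> (\<forall>y\<in>V. \<forall>z\<in>V. \<exists>\<gamma>. pwC1 \<gamma> 0 1 \<and> \<gamma> 0 = y \<and> \<gamma> 1 = z \<and> len \<gamma> 0 1 < \<epsilon>)"
proof -
  obtain c where c: "c \<in> atl" "x \<in> fst c" using chart_exists by blast
  obtain r M where r: "r > 0" "cball (snd c x) r \<subseteq> snd c ` fst c"
    "\<And>z. z \<in> cball (snd c x) r \<Longrightarrow> param_bound (chart_inv c) M z"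
    using param_bound_local[OF Ck1_param_chart_inv[OF c(1)], of "snd c x"] c by blast
  \<comment> \<open>Two points of the ball of radius \<open>s\<close> are at most 2 s apart;
    \<open>M\<close> may be zero or negative, hence the absolute value and the added 1.\<close>
  define s where "s = min r (\<epsilon> / (2 * (\<bar>M\<bar> + 1)))"
  have s: "0 < s" "s \<le> r" "\<bar>M\<bar> * (2 * s) < \<epsilon>"
  proof -
    have "\<bar>M\<bar> * (2 * s) < (\<bar>M\<bar> + 1) * (2 * s)"
      using r assms by (intro mult_strict_right_mono) (auto simp: s_def)
    also have "\<dots> \<le> \<epsilon>"
    proof -
      have "s \<le> \<epsilon> / (2 * (\<bar>M\<bar> + 1))" by (simp add: s_def)
      then have "s * (2 * (\<bar>M\<bar> + 1)) \<le> \<epsilon>" by (subst (asm) pos_le_divide_eq) auto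
      then show ?thesis by (simp add: algebra_simps)
    qed
    finally show "\<bar>M\<bar> * (2 * s) < \<epsilon>" .
  qed (use r assms in \<open>auto simp: s_def\<close>)
  let ?B = "ball (snd c x) s"
  have B: "?B \<subseteq> cball (snd c x) r" using s by auto
  have "\<exists>\<gamma>. pwC1 \<gamma> 0 1 \<and> \<gamma> 0 = y \<and> \<gamma> 1 = z \<and> len \<gamma> 0 1 < \<epsilon>"
    if yz: "y \<in> chart_inv c ` ?B" "z \<in> chart_inv c ` ?B" for y z
  proof -
    obtain y' z' where yz': "y = chart_inv c y'" "z = chart_inv c z'" "y' \<in> ?B" "z' \<in> ?B"
      using yz by blast
    have seg: "closed_segment y' z' \<subseteq> cball (snd c x) r"
      using yz' B closed_segment_subset[of y' ?B z'] by auto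
    obtain \<gamma> where \<gamma>: "pwC1 \<gamma> 0 1" "\<gamma> 0 = y" "\<gamma> 1 = z" "len \<gamma> 0 1 \<le> M * norm (z' - y')"
      using param_segment[OF Ck1_param_chart_inv[OF c(1)], of y' z' M] seg r(2,3) yz' by blast
    have "norm (z' - y') = dist y' z'" by (metis dist_commute dist_norm)
    also have "\<dots> \<le> 2 * s"
      using yz'(3,4) dist_triangle[of y' z' "snd c x"] by (simp add: dist_commute)
    finally have "norm (z' - y') \<le> 2 * s" .
    then have "M * norm (z' - y') \<le> \<bar>M\<bar> * (2 * s)" by (intro mult_mono) auto
    then show ?thesis using \<gamma> s(3) by (intro exI[of _ \<gamma>]) auto
  qed
  moreover have "open (chart_inv c ` ?B)"
    using r B by (intro open_chart_inv_image c) auto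
  moreover have "x \<in> chart_inv c ` ?B"
    using c s by (intro image_eqI[of _ _ "snd c x"]) auto
  ultimately show ?thesis by blast
qed

text \<open>Reachability from \<open>x\<close> is constant on the neighbourhoods of
  \<open>short_curves_near\<close>, so the reachable set and its complement are open, and
  connectedness leaves nothing outside.\<close>

lemma curve_exists: "\<exists>\<gamma>. pwC1 \<gamma> 0 1 \<and> \<gamma> 0 = x \<and> \<gamma> 1 = y"
proof -
  define R where "R = {y. \<exists>\<gamma>. pwC1 \<gamma> 0 1 \<and> \<gamma> 0 = x \<and> \<gamma> 1 = y}"
  have near: "\<exists>V. open V \<and> x \<in> V \<and> (\<forall>y\<in>V. \<forall>z\<in>V. \<exists>\<gamma>. pwC1 \<gamma> 0 1 \<and> \<gamma> 0 = y \<and> \<gamma> 1 = z)" for x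
    using short_curves_near[of 1 x] by (metis zero_less_one)
  have step: "z \<in> R" if y: "y \<in> R" and yz: "\<exists>\<gamma>. pwC1 \<gamma> 0 1 \<and> \<gamma> 0 = y \<and> \<gamma> 1 = z" for y z
  proof -
    obtain \<gamma>\<^sub>1 where 1: "pwC1 \<gamma>\<^sub>1 0 1" "\<gamma>\<^sub>1 0 = x" "\<gamma>\<^sub>1 1 = y" using y by (auto simp: R_def)
    obtain \<gamma>\<^sub>2 where 2: "pwC1 \<gamma>\<^sub>2 0 1" "\<gamma>\<^sub>2 0 = y" "\<gamma>\<^sub>2 1 = z" using yz by auto
    obtain \<gamma> where "pwC1 \<gamma> 0 1" "\<gamma> 0 = \<gamma>\<^sub>1 0" "\<gamma> 1 = \<gamma>\<^sub>2 1"
      using curve_concat[OF 1(1) 2(1)] 1 2 by metis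
    then show ?thesis using 1 2 by (auto simp: R_def)
  qed
  have nbhd: "\<exists>V. open V \<and> y \<in> V \<and> (\<forall>z\<in>V. z \<in> R \<longleftrightarrow> y \<in> R)" for y
  proof -
    obtain V where V: "open V" "y \<in> V"
      "\<And>y z. y \<in> V \<Longrightarrow> z \<in> V \<Longrightarrow> \<exists>\<gamma>. pwC1 \<gamma> 0 1 \<and> \<gamma> 0 = y \<and> \<gamma> 1 = z"
      using near[of y] by metis
    have *: "z \<in> R \<longleftrightarrow> y \<in> R" if "z \<in> V" for z
      using step[OF _ V(3)[OF that V(2)]] step[OF _ V(3)[OF V(2) that]] by (rule iffI)
    show ?thesis by (intro exI[of _ V] conjI ballI V(1,2) *)
  qed
  have "open R"
  proof (subst open_subopen, rule ballI)
    fix y assume y: "y \<in> R"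
    obtain V where V: "open V" "y \<in> V" "\<And>z. z \<in> V \<Longrightarrow> z \<in> R" using nbhd[of y] y by metis
    show "\<exists>T. open T \<and> y \<in> T \<and> T \<subseteq> R" by (intro exI[of _ V] conjI subsetI V)
  qed
  moreover have "open (- R)"
  proof (subst open_subopen, rule ballI)
    fix y assume y: "y \<in> - R"
    obtain V where V: "open V" "y \<in> V" "\<And>z. z \<in> V \<Longrightarrow> z \<in> - R" using nbhd[of y] y by (metis Compl_iff)
    show "\<exists>T. open T \<and> y \<in> T \<and> T \<subseteq> - R" by (intro exI[of _ V] conjI subsetI V)
  qed
  moreover have "x \<in> R" using near[of x] by (auto simp: R_def)
  ultimately have "- R = {}"
    using connectedD[OF connected_UNIV, of R "- R"] by auto
  then show ?thesis by (auto simp: R_def)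
qed

text \<open>Existence of connecting curves gives the real infimum its meaning: over an empty set its
  value would be arbitrary.\<close>

lemma riem_dist_lessE:
  assumes "rdist x y < L"
  obtains \<gamma> where "pwC1 \<gamma> 0 1" "\<gamma> 0 = x" "\<gamma> 1 = y" "len \<gamma> 0 1 < L"
proof -
  have "{\<gamma>. pwC1 \<gamma> 0 1 \<and> \<gamma> 0 = x \<and> \<gamma> 1 = y} \<noteq> {}" using curve_exists[of x y] by blast
  from cINF_less_iff[OF this len_bdd_below] assms show ?thesis
    unfolding riem_dist_eq using that by blast
qed

lemma riem_dist_triangle:
  "rdist x z \<le> rdist x y + rdist y z"
proof (rule field_le_epsilon)
  fix e :: real assume e: "0 < e"
  obtain \<gamma>\<^sub>1 where 1: "pwC1 \<gamma>\<^sub>1 0 1" "\<gamma>\<^sub>1 0 = x" "\<gamma>\<^sub>1 1 = y" "len \<gamma>\<^sub>1 0 1 < rdist x y + e / 2"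
    using riem_dist_lessE[of x y "rdist x y + e / 2"] e by auto
  obtain \<gamma>\<^sub>2 where 2: "pwC1 \<gamma>\<^sub>2 0 1" "\<gamma>\<^sub>2 0 = y" "\<gamma>\<^sub>2 1 = z" "len \<gamma>\<^sub>2 0 1 < rdist y z + e / 2"
    using riem_dist_lessE[of y z "rdist y z + e / 2"] e by auto
  obtain \<gamma> where \<gamma>: "pwC1 \<gamma> 0 1" "\<gamma> 0 = x" "\<gamma> 1 = z" "len \<gamma> 0 1 = len \<gamma>\<^sub>1 0 1 + len \<gamma>\<^sub>2 0 1"
    using curve_concat[OF 1(1) 2(1)] 1 2 by metis
  have "rdist x z \<le> len \<gamma> 0 1"
    using riem_dist_le_len[OF \<gamma>(1)] \<gamma> by simp
  then show "rdist x z \<le> rdist x y + rdist y z + e"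
    using \<gamma>(4) 1(4) 2(4) by simp
qed

lemma riem_dist_near:
  assumes "0 < \<epsilon>"
  shows "\<exists>V. open V \<and> x \<in> V \<and> (\<forall>y\<in>V. \<forall>z\<in>V. rdist y z < \<epsilon>)"
proof -
  obtain V where V: "open V" "x \<in> V"
    "\<And>y z. y \<in> V \<Longrightarrow> z \<in> V \<Longrightarrow> \<exists>\<gamma>. pwC1 \<gamma> 0 1 \<and> \<gamma> 0 = y \<and> \<gamma> 1 = z \<and> len \<gamma> 0 1 < \<epsilon>"
    using short_curves_near[OF assms, of x] by metis
  have "rdist y z < \<epsilon>" if yz: "y \<in> V" "z \<in> V" for y z
  proof -
    obtain \<gamma> where \<gamma>: "pwC1 \<gamma> 0 1" "\<gamma> 0 = y" "\<gamma> 1 = z" "len \<gamma> 0 1 < \<epsilon>" using V(3)[OF yz] by blast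
    then show ?thesis using riem_dist_le_len[OF \<gamma>(1)] by simp
  qed
  then show ?thesis using V by blast
qed

lemma riem_dist_bounded_compact:
  assumes "compact K"
  shows "\<exists>R. \<forall>y\<in>K. rdist b y \<le> R"
proof -
  obtain V where V: "\<And>x. open (V x) \<and> x \<in> V x \<and> (\<forall>y\<in>V x. \<forall>z\<in>V x. rdist y z < 1)"
    using riem_dist_near[OF zero_less_one] by metis
  obtain T where T: "T \<subseteq> K" "finite T" "K \<subseteq> (\<Union>x\<in>T. V x)"
    by (rule compactE_image[OF assms, of K V]) (use V in auto)
  have "rdist b y \<le> (\<Sum>x\<in>T. \<bar>rdist b x\<bar>) + 1" if y: "y \<in> K" for y
  proof -
    obtain x where x: "x \<in> T" "y \<in> V x" using T(3) y by blast
    have "rdist b y \<le> rdist b x + rdist x y" by (rule riem_dist_triangle)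
    also have "rdist x y \<le> 1" using V x by (meson less_imp_le)
    also have "rdist b x \<le> \<bar>rdist b x\<bar>" by simp
    also have "\<bar>rdist b x\<bar> \<le> (\<Sum>x\<in>T. \<bar>rdist b x\<bar>)"
      using T x by (intro member_le_sum) auto
    finally show ?thesis by simp
  qed
  then show ?thesis by blast
qed

text \<open>A curve that leaves a coordinate ball crosses it, and its length is comparable with its
  coordinate length as long as it stays in the ball.\<close>

lemma short_curve_stays:
  assumes U: "open U" "x \<in> U"
  shows "\<exists>V K \<epsilon>. open V \<and> x \<in> V \<and> V \<subseteq> K \<and> K \<subseteq> U \<and> compact K \<and> 0 < \<epsilon> \<and>
    (\<forall>\<gamma>. pwC1 \<gamma> 0 1 \<and> \<gamma> 0 = x \<and> len \<gamma> 0 1 < \<epsilon> \<longrightarrow> \<gamma> ` {0..1} \<subseteq> V)"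
proof -
  obtain c where c: "c \<in> atl" "x \<in> fst c" using chart_exists by blast
  have "open (snd c ` (fst c \<inter> U))" by (rule open_chart_image_Int[OF c(1) U(1)])
  then obtain r where r: "r > 0" "cball (snd c x) r \<subseteq> snd c ` (fst c \<inter> U)"
    using open_contains_cball c U by blast
  define K where "K = chart_inv c ` cball (snd c x) r"
  define V where "V = chart_inv c ` ball (snd c x) r"
  have sub: "cball (snd c x) r \<subseteq> snd c ` fst c" using r by auto
  have V: "open V" "x \<in> V" "V \<subseteq> K"
  proof -
    show "open V" unfolding V_def using sub by (intro open_chart_inv_image c) auto
    show "x \<in> V" unfolding V_def using c r by (intro image_eqI[of _ _ "snd c x"]) auto
    show "V \<subseteq> K" unfolding V_def K_def by auto
  qed
  have K: "compact K" "K \<subseteq> fst c" "K \<subseteq> U"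
  proof -
    show "compact K" unfolding K_def
      by (intro compact_continuous_image continuous_on_subset[OF continuous_on_chart_inv[OF c(1)] sub]) simp
    have "y \<in> fst c \<inter> U" if y: "y \<in> K" for y
    proof -
      obtain z where z: "y = chart_inv c z" "z \<in> cball (snd c x) r" using y unfolding K_def by blast
      then obtain w where "z = snd c w" "w \<in> fst c \<inter> U" using r(2) by blast
      then show ?thesis using z c(1) by simp
    qed
    then show "K \<subseteq> fst c" "K \<subseteq> U" by blast+
  qed
  have mem_V: "y \<in> V \<longleftrightarrow> dist (snd c x) (snd c y) < r" if y: "y \<in> K" for y
  proof -
    obtain z where z: "y = chart_inv c z" "z \<in> cball (snd c x) r" using y by (auto simp: K_def)
    have yz: "snd c y = z" using z sub by (simp add: subset_iff)
    show ?thesis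
    proof
      assume "y \<in> V"
      then obtain w where w: "y = chart_inv c w" "w \<in> ball (snd c x) r" by (auto simp: V_def)
      then have "snd c y = w" using sub by (simp add: subset_iff)
      then show "dist (snd c x) (snd c y) < r" using w by simp
    next
      assume "dist (snd c x) (snd c y) < r"
      then show "y \<in> V" using z(1) yz unfolding V_def by auto
    qed
  qed
  obtain m where m: "0 < m" "\<And>y u. y \<in> K \<Longrightarrow> m * norm u \<le> chart_norm c y u"
    using chart_norm_bounds_compact[OF c(1) K(1,2)] by blast
  \<comment> \<open>The threshold is the coordinate radius \<open>r\<close> times the constant
    \<open>m\<close> that compares the Riemannian norm with the Euclidean one on
    \<open>K\<close>.\<close>
  have "\<gamma> ` {0..1} \<subseteq> V" if \<gamma>: "pwC1 \<gamma> 0 1" "\<gamma> 0 = x" and short: "len \<gamma> 0 1 < m * r" for \<gamma>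
  proof (rule ccontr)
    assume leave: "\<not> \<gamma> ` {0..1} \<subseteq> V"
    have cont: "continuous_on {0..1} \<gamma>" using pwC1_continuous[OF \<gamma>(1)] by simp
    let ?O = "{t \<in> {0..1}. \<gamma> t \<notin> V}"
    have "closed ({0..1} \<inter> \<gamma> -` (- V))"
      using cont V by (intro continuous_closed_preimage) auto
    also have "{0..1} \<inter> \<gamma> -` (- V) = ?O" by auto
    finally have "closed ?O" .
    moreover have "bounded ?O"
      by (rule bounded_subset[OF bounded_closed_interval[of 0 "1::real"]]) auto
    ultimately have cO: "compact ?O" by (simp add: compact_eq_bounded_closed)
    have nO: "?O \<noteq> {}" using leave by auto
    \<comment> \<open>The first time outside \<open>V\<close>; it exists because \<open>V\<close> is
      open, so that the times outside form a compact set.\<close>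
    obtain \<tau> where \<tau>: "\<tau> \<in> ?O" "\<And>t. t \<in> ?O \<Longrightarrow> \<tau> \<le> t"
      using compact_attains_inf[OF cO nO] by blast
    have \<tau>0: "0 < \<tau>" using \<tau>(1) \<gamma>(2) V(2) by (cases "\<tau> = 0") auto
    have inV: "\<gamma> t \<in> V" if "0 \<le> t" "t < \<tau>" for t using \<tau> that by force
    have inK: "\<gamma> t \<in> K" if t: "t \<in> {0..\<tau>}" for t
    proof (cases "t < \<tau>")
      case True then show ?thesis using inV t V(3) by auto
    next
      case False
      \<comment> \<open>At the exit time the curve is a left limit of points of \<open>V\<close>,
        hence in the closed set \<open>K\<close>.\<close>
      have "\<tau> islimpt {0..<\<tau>}" using \<tau>0 by (simp add: islimpt_greaterThanLessThan2)
      have "(\<gamma> \<longlongrightarrow> \<gamma> \<tau>) (at \<tau> within {0..1})"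
        using cont \<tau>(1) by (simp add: continuous_on_def)
      then have "(\<gamma> \<longlongrightarrow> \<gamma> \<tau>) (at \<tau> within {0..<\<tau>})"
        by (rule tendsto_within_subset) (use \<tau>(1) in auto)
      moreover have "\<forall>\<^sub>F t in at \<tau> within {0..<\<tau>}. \<gamma> t \<in> K"
        using inV V(3) by (auto simp: eventually_at_topological)
      moreover have "at \<tau> within {0..<\<tau>} \<noteq> bot"
        using \<open>\<tau> islimpt {0..<\<tau>}\<close> by (simp add: trivial_limit_within)
      ultimately have "\<gamma> \<tau> \<in> K"
        using Lim_in_closed_set[OF compact_imp_closed[OF K(1)]] by blast
      then show ?thesis using False t by auto
    qed
    have far: "r \<le> norm (snd c (\<gamma> \<tau>) - snd c (\<gamma> 0))"
      using mem_V[OF inK[of \<tau>]] \<tau> \<tau>0 \<gamma>(2) by (auto simp: dist_norm norm_minus_commute)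
    have pw: "pwC1 \<gamma> 0 \<tau>" using pwC1_subset[OF \<gamma>(1)] \<tau>(1) by auto
    obtain S where S: "finite S"
      and reg: "\<And>t. t \<in> {0..\<tau>} - S \<Longrightarrow> \<exists>u v. 0 \<le> u \<and> v \<le> \<tau> \<and> t \<in> {u<..<v} \<and> C1_curve_on atl \<gamma> u v"
      by (rule pwC1_partition[OF pw \<tau>0]) (rule that)
    let ?f = "\<lambda>t. velocity atl \<gamma> t c"
    have FTC: "(?f has_integral (snd c \<circ> \<gamma>) \<tau> - (snd c \<circ> \<gamma>) 0) {0..\<tau>}"
    proof (rule fundamental_theorem_of_calculus_interior_strong[OF S])
      fix t assume t: "t \<in> {0<..<\<tau>} - S"
      then obtain u v where "t \<in> {u<..<v}" "C1_curve_on atl \<gamma> u v" using reg[of t] by auto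
      moreover have "\<gamma> t \<in> fst c" using inK[of t] t K(2) by auto
      ultimately show "((snd c \<circ> \<gamma>) has_vector_derivative velocity atl \<gamma> t c) (at t)"
        using C1_curve_interior(2) c(1) by blast
    next
      show "continuous_on {0..\<tau>} (snd c \<circ> \<gamma>)"
        using cont \<tau>(1) inK K(2)
        by (intro continuous_on_compose continuous_on_subset[OF cont] continuous_on_subset[OF continuous_on_chart[OF c(1)]]) auto
    qed (use \<tau>0 in simp)
    \<comment> \<open>At break points the velocity is uncontrolled; there the majorant repeats the
      left side, which alters it on a finite set only.\<close>
    have "norm (integral {0..\<tau>} ?f) \<le> integral {0..\<tau>} (\<lambda>t. if t \<in> S then norm (?f t) else speed \<gamma> t / m)"
    proof (rule integral_norm_bound_integral)
      show "?f integrable_on {0..\<tau>}" using FTC by blast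
      show "(\<lambda>t. if t \<in> S then norm (?f t) else speed \<gamma> t / m) integrable_on {0..\<tau>}"
        by (rule integrable_spike_finite[OF S _ integrable_on_divide[OF speed_integrable[OF pw], of m]]) auto
      fix t assume t: "t \<in> {0..\<tau>}"
      show "norm (?f t) \<le> (if t \<in> S then norm (?f t) else speed \<gamma> t / m)"
      proof (cases "t \<in> S")
        case False
        then obtain u v where uv: "t \<in> {u<..<v}" "C1_curve_on atl \<gamma> u v" using reg[of t] t by auto
        have "\<gamma> t \<in> fst c" using inK[OF t] K(2) by auto
        then have "speed \<gamma> t = chart_norm c (\<gamma> t) (?f t)"
          unfolding speed_def using tnorm_eq_chart_norm[OF c(1) _ C1_curve_interior(3)[OF uv(2,1)]] by simp
        then show ?thesis using m(2)[OF inK[OF t], of "?f t"] m(1) False by (simp add: field_simps)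
      qed simp
    qed
    also have "\<dots> = integral {0..\<tau>} (\<lambda>t. speed \<gamma> t / m)"
      by (rule integral_spike[OF negligible_finite[OF S]]) auto
    also have "\<dots> = len \<gamma> 0 \<tau> / m" unfolding len_def by simp
    also have "\<dots> \<le> len \<gamma> 0 1 / m"
      using len_mono[OF \<gamma>(1), of 0 \<tau>] \<tau>(1) m(1) by (intro divide_right_mono) auto
    also have "\<dots> < r" using short m(1) by (simp add: field_simps)
    finally show False using far integral_unique[OF FTC] by simp
  qed
  then show ?thesis using V K m r
    by (intro exI[of _ V] exI[of _ K] exI[of _ "m * r"]) auto
qed

text \<open>Together with \<open>riem_dist_near\<close> this shows that the distance induces the
  topology of the manifold; it makes Lipschitz maps continuous.\<close>

lemma riem_dist_small_imp_mem:
  assumes "open U" "x \<in> U"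
  shows "\<exists>\<epsilon>>0. \<forall>y. rdist x y < \<epsilon> \<longrightarrow> y \<in> U"
proof -
  obtain V K \<epsilon> where *: "V \<subseteq> K" "K \<subseteq> U" "0 < \<epsilon>"
    "\<And>\<gamma>. pwC1 \<gamma> 0 1 \<and> \<gamma> 0 = x \<and> len \<gamma> 0 1 < \<epsilon> \<Longrightarrow> \<gamma> ` {0..1} \<subseteq> V"
    using short_curve_stays[OF assms] by metis
  have "y \<in> U" if y: "rdist x y < \<epsilon>" for y
  proof -
    obtain \<gamma> where \<gamma>: "pwC1 \<gamma> 0 1" "\<gamma> 0 = x" "\<gamma> 1 = y" "len \<gamma> 0 1 < \<epsilon>"
      using riem_dist_lessE[OF y] by blast
    then have "\<gamma> 1 \<in> V" using *(4)[of \<gamma>] by auto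
    then show ?thesis using * \<gamma> by auto
  qed
  then show ?thesis using * by blast
qed

text \<open>This replaces the Hopf-Rinow theorem, which would need completeness of the metric: only short
  curves have to be kept in a compact set.\<close>

lemma compact_neighbourhood:
  assumes "compact K"
  shows "\<exists>K' \<epsilon>. compact K' \<and> 0 < \<epsilon> \<and>
    (\<forall>\<gamma>. pwC1 \<gamma> 0 1 \<and> \<gamma> 0 \<in> K \<and> len \<gamma> 0 1 < \<epsilon> \<longrightarrow> \<gamma> ` {0..1} \<subseteq> K')"
proof -
  have "\<exists>N K' \<epsilon>. open N \<and> x \<in> N \<and> compact K' \<and> 0 < \<epsilon> \<and>
    (\<forall>\<gamma>. pwC1 \<gamma> 0 1 \<and> \<gamma> 0 \<in> N \<and> len \<gamma> 0 1 < \<epsilon> \<longrightarrow> \<gamma> ` {0..1} \<subseteq> K')" for x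
  proof -
    obtain V K' \<epsilon> where *: "V \<subseteq> K'" "compact K'" "0 < \<epsilon>"
      "\<And>\<gamma>. pwC1 \<gamma> 0 1 \<and> \<gamma> 0 = x \<and> len \<gamma> 0 1 < \<epsilon> \<Longrightarrow> \<gamma> ` {0..1} \<subseteq> V"
      using short_curve_stays[OF open_UNIV UNIV_I, of x] by metis
    \<comment> \<open>One half of the threshold is spent on a prefix from \<open>x\<close> to the
      start of the curve, the other half is left for the curve itself.\<close>
    have "0 < \<epsilon> / 2" using * by simp
    obtain N where N: "open N" "x \<in> N"
      "\<And>y z. y \<in> N \<Longrightarrow> z \<in> N \<Longrightarrow> \<exists>\<gamma>. pwC1 \<gamma> 0 1 \<and> \<gamma> 0 = y \<and> \<gamma> 1 = z \<and> len \<gamma> 0 1 < \<epsilon> / 2"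
      using short_curves_near[OF \<open>0 < \<epsilon> / 2\<close>, of x] by metis
    have "\<gamma> ` {0..1} \<subseteq> K'" if \<gamma>: "pwC1 \<gamma> 0 1" "\<gamma> 0 \<in> N" "len \<gamma> 0 1 < \<epsilon> / 2" for \<gamma>
    proof -
      obtain \<gamma>\<^sub>1 where 1: "pwC1 \<gamma>\<^sub>1 0 1" "\<gamma>\<^sub>1 0 = x" "\<gamma>\<^sub>1 1 = \<gamma> 0" "len \<gamma>\<^sub>1 0 1 < \<epsilon> / 2"
        using N(3)[OF N(2) \<gamma>(2)] by blast
      obtain \<gamma>\<^sub>2 where 2: "pwC1 \<gamma>\<^sub>2 0 1" "\<gamma>\<^sub>2 0 = \<gamma>\<^sub>1 0" "len \<gamma>\<^sub>2 0 1 = len \<gamma>\<^sub>1 0 1 + len \<gamma> 0 1"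
        "\<gamma> ` {0..1} \<subseteq> \<gamma>\<^sub>2 ` {0..1}"
        using curve_concat[OF 1(1) \<gamma>(1) 1(3)] by metis
      have "\<gamma>\<^sub>2 ` {0..1} \<subseteq> V" using *(4)[of \<gamma>\<^sub>2] 1 2 \<gamma> by auto
      then show ?thesis using 2(4) *(1) by blast
    qed
    then show ?thesis using N * by (intro exI[of _ N] exI[of _ K'] exI[of _ "\<epsilon> / 2"]) auto
  qed
  then obtain N K' \<epsilon> where *: "\<And>x. open (N x) \<and> x \<in> N x \<and> compact (K' x) \<and> 0 < \<epsilon> x \<and>
    (\<forall>\<gamma>. pwC1 \<gamma> 0 1 \<and> \<gamma> 0 \<in> N x \<and> len \<gamma> 0 1 < \<epsilon> x \<longrightarrow> \<gamma> ` {0..1} \<subseteq> K' x)"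
    by metis
  obtain T where T: "T \<subseteq> K" "finite T" "K \<subseteq> (\<Union>x\<in>T. N x)"
    by (rule compactE_image[OF assms, of K N]) (use * in auto)
  \<comment> \<open>The element 1 keeps \<open>Min\<close> meaningful when the cover is
    empty.\<close>
  let ?\<epsilon> = "Min (insert 1 (\<epsilon> ` T))"
  show ?thesis
  proof (intro exI[of _ "\<Union>x\<in>T. K' x"] exI[of _ ?\<epsilon>] conjI allI impI)
    show "compact (\<Union>x\<in>T. K' x)" using T * by (intro compact_UN) auto
    show "0 < ?\<epsilon>" using T * by simp
    fix \<gamma> assume \<gamma>: "pwC1 \<gamma> 0 1 \<and> \<gamma> 0 \<in> K \<and> len \<gamma> 0 1 < ?\<epsilon>"
    then obtain x where x: "x \<in> T" "\<gamma> 0 \<in> N x" using T by blast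
    have "?\<epsilon> \<le> \<epsilon> x" using T x by simp
    then have "\<gamma> ` {0..1} \<subseteq> K' x" using * \<gamma> x by (meson order_less_le_trans)
    then show "\<gamma> ` {0..1} \<subseteq> (\<Union>x\<in>T. K' x)" using x by blast
  qed
qed

section \<open>Curves under differentiable maps\<close>

lemma C1_map_on_Ck_1:
  "C1_map_on atl S f \<Longrightarrow> c \<in> atl \<Longrightarrow> c' \<in> atl \<Longrightarrow>
    Ck_on 1 (snd c' \<circ> f \<circ> chart_inv c) (snd c ` (S \<inter> fst c \<inter> f -` fst c'))"
  by (simp add: C1_map_on_def)

lemma C1_map_on_has_derivative:
  assumes f: "C1_map_on atl S f" and x: "x \<in> S"
    and c: "c \<in> atl" "x \<in> fst c" and c': "c' \<in> atl" "f x \<in> fst c'"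
  shows "((snd c' \<circ> f \<circ> chart_inv c) has_derivative
      frechet_derivative (snd c' \<circ> f \<circ> chart_inv c) (at (snd c x))) (at (snd c x))"
  using assms by (intro Ck_on_1_has_derivative[OF C1_map_on_Ck_1[OF f c(1) c'(1)]]) auto

lemma open_C1_map_vimage:
  "C1_map_on atl S f \<Longrightarrow> open S \<Longrightarrow> open V \<Longrightarrow> open (S \<inter> f -` V)"
  using continuous_on_open_vimage[of S f] by (simp add: C1_map_on_def inf_commute)

text \<open>\<open>tangent_map\<close> refers to an arbitrarily chosen chart at the base point; the
  change of coordinates shows that any chart may replace it.\<close>

lemma tangent_map_apply:
  assumes f: "C1_map_on atl S f" and x: "x \<in> S" and v: "v \<in> tangent_space atl x"
    and c: "c \<in> atl" "x \<in> fst c" and c': "c' \<in> atl" "f x \<in> fst c'"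
  shows "tangent_map atl f x v c' = frechet_derivative (snd c' \<circ> f \<circ> chart_inv c) (at (snd c x)) (v c)"
proof -
  let ?b = "some_chart atl x"
  have b: "?b \<in> atl" "x \<in> fst ?b" by (rule some_chart)+
  have cb: "?b \<in> charts_at atl x" "c \<in> charts_at atl x" using b c by (auto simp: charts_at_def)
  have vc: "v c = frechet_derivative (snd c \<circ> chart_inv ?b) (at (snd ?b x)) (v ?b)"
    using v cb unfolding tangent_space_def by blast
  have "((snd c' \<circ> f) \<circ> chart_inv ?b has_derivative
      (\<lambda>u. frechet_derivative (snd c' \<circ> f \<circ> chart_inv c) (at (snd c x))
        (frechet_derivative (snd c \<circ> chart_inv ?b) (at (snd ?b x)) u))) (at (snd ?b x))"
    by (rule chart_change_has_derivative[OF b(1) c(1) b(2) c(2)])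
      (rule C1_map_on_has_derivative[OF f x c c'])
  then have "frechet_derivative (snd c' \<circ> f \<circ> chart_inv c) (at (snd c x))
        (frechet_derivative (snd c \<circ> chart_inv ?b) (at (snd ?b x)) (v ?b))
      = frechet_derivative (snd c' \<circ> f \<circ> chart_inv ?b) (at (snd ?b x)) (v ?b)"
    by (metis frechet_derivative_at)
  then show ?thesis
    using c' by (simp add: tangent_map_def Let_def charts_at_def vc)
qed

lemma tangent_map_in_tangent_space:
  assumes f: "C1_map_on atl S f" and S: "open S" and x: "x \<in> S" and v: "v \<in> tangent_space atl x"
  shows "tangent_map atl f x v \<in> tangent_space atl (f x)"
proof -
  obtain c where c: "c \<in> atl" "x \<in> fst c" using chart_exists by blast
  have "tangent_map atl f x v c2 = frechet_derivative (snd c2 \<circ> chart_inv c1) (at (snd c1 (f x)))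
      (tangent_map atl f x v c1)" if cs: "c1 \<in> charts_at atl (f x)" "c2 \<in> charts_at atl (f x)" for c1 c2
  proof -
    have 1: "c1 \<in> atl" "f x \<in> fst c1" and 2: "c2 \<in> atl" "f x \<in> fst c2"
      using cs by (auto simp: charts_at_def)
    let ?D1 = "frechet_derivative (snd c1 \<circ> f \<circ> chart_inv c) (at (snd c x))"
    let ?T = "frechet_derivative (snd c2 \<circ> chart_inv c1) (at (snd c1 (f x)))"
    have T: "((snd c2 \<circ> chart_inv c1) has_derivative ?T) (at ((snd c1 \<circ> f \<circ> chart_inv c) (snd c x)))"
      using transition_has_derivative[OF 1(1) 2(1) 1(2) 2(2)] c by simp
    let ?W = "snd c ` (fst c \<inter> (S \<inter> f -` (fst c1 \<inter> fst c2)))"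
    have W: "open ?W"
      by (intro open_chart_image_Int[OF c(1)] open_C1_map_vimage[OF f S] open_Int open_chart 1 2)
    have "((snd c2 \<circ> chart_inv c1) \<circ> (snd c1 \<circ> f \<circ> chart_inv c) has_derivative ?T \<circ> ?D1) (at (snd c x))"
      by (rule diff_chain_at[OF C1_map_on_has_derivative[OF f x c 1] T])
    then have "((snd c2 \<circ> f \<circ> chart_inv c) has_derivative ?T \<circ> ?D1) (at (snd c x))"
      by (rule has_derivative_transform_within_open[OF _ W]) (use c x 1 2 in auto)
    then have "?T \<circ> ?D1 = frechet_derivative (snd c2 \<circ> f \<circ> chart_inv c) (at (snd c x))"
      by (rule frechet_derivative_at)
    then show ?thesis
      unfolding tangent_map_apply[OF f x v c 1] tangent_map_apply[OF f x v c 2] by (metis comp_apply)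
  qed
  moreover have "tangent_map atl f x v c = 0" if "c \<notin> charts_at atl (f x)" for c
    using that by (simp add: tangent_map_def Let_def)
  ultimately show ?thesis unfolding tangent_space_def by blast
qed

lemma tnorm_tangent_map:
  assumes f: "C1_map_on atl S f" and S: "open S" and x: "x \<in> S" and v: "v \<in> tangent_space atl x"
    and c: "c \<in> atl" "x \<in> fst c" and c': "c' \<in> atl" "f x \<in> fst c'"
  shows "tnorm g (f x) (tangent_map atl f x v)
    = chart_norm c' (f x) (frechet_derivative (snd c' \<circ> f \<circ> chart_inv c) (at (snd c x)) (v c))"
  using tnorm_eq_chart_norm[OF c' tangent_map_in_tangent_space[OF f S x v]] tangent_map_apply[OF f x v c c']
  by simp

text \<open>\<open>tangent_map_norm\<close> is a real supremum, so the values on the unit ball must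
  first be bounded; comparison with the Euclidean norms at the two points gives this. Homogeneity
  then passes from unit vectors to \<open>v\<close>.\<close>

lemma tangent_map_norm_bound:
  assumes f: "C1_map_on atl S f" and S: "open S" and x: "x \<in> S" and v: "v \<in> tangent_space atl x"
  shows "tnorm g (f x) (tangent_map atl f x v) \<le> tangent_map_norm atl g f x * tnorm g x v"
proof -
  obtain c where c: "c \<in> atl" "x \<in> fst c" using chart_exists by blast
  obtain c' where c': "c' \<in> atl" "f x \<in> fst c'" using chart_exists by blast
  let ?D = "frechet_derivative (snd c' \<circ> f \<circ> chart_inv c) (at (snd c x))"
  have blin: "bounded_linear ?D"
    using C1_map_on_has_derivative[OF f x c c'] has_derivative_bounded_linear by blast
  then have lin: "linear ?D" by (rule bounded_linear.linear)
  obtain m where m: "0 < m" "\<And>u. m * norm u \<le> chart_norm c x u"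
    using chart_norm_bounds_compact[OF c(1), of "{x}"] c(2) by auto
  obtain M where M: "0 < M" "\<And>u. chart_norm c' (f x) u \<le> M * norm u"
    using chart_norm_bounds_compact[OF c'(1), of "{f x}"] c'(2) by auto
  let ?V = "{v \<in> tangent_space atl x. tnorm g x v \<le> 1}"
  let ?h = "\<lambda>v. tnorm g (f x) (tangent_map atl f x v)"
  have h: "?h v = chart_norm c' (f x) (?D (v c))" if "v \<in> tangent_space atl x" for v
    using tnorm_tangent_map[OF f S x that c c'] .
  have bdd: "bdd_above (?h ` ?V)"
  proof (rule bdd_aboveI2)
    fix v assume v: "v \<in> ?V"
    have "m * norm (v c) \<le> 1"
      using v m(2)[of "v c"] tnorm_eq_chart_norm[OF c, of v] by auto
    then have nv: "norm (v c) \<le> 1 / m" using m(1) by (simp add: field_simps)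
    have "?h v \<le> M * norm (?D (v c))" using h v M(2) by auto
    also have "\<dots> \<le> M * (onorm ?D * norm (v c))"
      using M(1) onorm[OF blin] by (intro mult_left_mono) auto
    also have "\<dots> \<le> M * (onorm ?D * (1 / m))"
      using M(1) nv onorm_pos_le[OF blin] by (intro mult_left_mono) auto
    finally show "?h v \<le> M * (onorm ?D * (1 / m))" .
  qed
  show ?thesis
  proof (cases "v c = 0")
    case True
    then show ?thesis
      using h[OF v] tnorm_eq_chart_norm[OF c v] by (simp add: linear_0[OF lin] chart_norm_0[OF c] chart_norm_0[OF c'])
  next
    case False
    let ?n = "tnorm g x v"
    have n: "0 < ?n" using tnorm_eq_chart_norm[OF c v] chart_norm_pos[OF c False] by simp
    let ?w = "coord_vec atl c x ((1 / ?n) *\<^sub>R v c)"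
    have w: "?w \<in> tangent_space atl x" "?w c = (1 / ?n) *\<^sub>R v c"
      using coord_vec_in_tangent_space[OF c] coord_vec_apply_self[OF c] by auto
    have "tnorm g x ?w = 1"
      unfolding tnorm_eq_chart_norm[OF c w(1)] w(2) chart_norm_scaleR[OF c]
      using tnorm_eq_chart_norm[OF c v] n by simp
    then have "?h ?w \<le> tangent_map_norm atl g f x"
      unfolding tangent_map_norm_def using w(1) by (intro cSUP_upper bdd) auto
    moreover have "?h ?w = ?h v / ?n"
      unfolding h[OF w(1)] h[OF v] w(2) linear_scale[OF lin] chart_norm_scaleR[OF c'] using n by simp
    ultimately show ?thesis using n by (simp add: field_simps)
  qed
qed

text \<open>The chart in which the base curve is read changes from point to point while the chart of
  the image is fixed, hence the local criterion \<open>C1_curve_on_localI\<close>.\<close>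

lemma C1_image_curve:
  assumes f: "C1_map_on atl S f" and S: "open S"
    and C: "C1_curve_on atl \<gamma> u v" and uv: "u < v" and sub: "\<gamma> ` {u..v} \<subseteq> S"
  shows "C1_curve_on atl (f \<circ> \<gamma>) u v"
    and "t \<in> {u<..<v} \<Longrightarrow> speed (f \<circ> \<gamma>) t = tnorm g (f (\<gamma> t)) (tangent_map atl f (\<gamma> t) (velocity atl \<gamma> t))"
proof -
  have cont: "continuous_on {u..v} \<gamma>" using C by (simp add: C1_curve_on_def)
  show C': "C1_curve_on atl (f \<circ> \<gamma>) u v"
  proof (rule C1_curve_on_localI[OF uv])
    show "continuous_on {u..v} (f \<circ> \<gamma>)"
      using f sub by (intro continuous_on_compose cont) (auto simp: C1_map_on_def intro: continuous_on_subset)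
    fix c' t\<^sub>0 assume c': "c' \<in> atl" and t0: "t\<^sub>0 \<in> {u..v}" "(f \<circ> \<gamma>) t\<^sub>0 \<in> fst c'"
    obtain c where c: "c \<in> atl" "\<gamma> t\<^sub>0 \<in> fst c" using chart_exists by blast
    let ?W = "fst c \<inter> (S \<inter> f -` fst c')"
    have "open ?W" by (intro open_Int open_chart c open_C1_map_vimage[OF f S] c')
    then have "\<exists>U. open U \<and> U \<inter> {u..v} = \<gamma> -` ?W \<inter> {u..v}"
      using cont by (simp only: continuous_on_open_invariant)
    then obtain U where U: "open U" "U \<inter> {u..v} = \<gamma> -` ?W \<inter> {u..v}" by blast
    have inW: "\<gamma> t \<in> ?W" if "t \<in> {u..v} \<inter> U" for t
      using that U(2) by blast
    obtain D where "chart_velocity c \<gamma> {u..v} D" using C c(1) unfolding C1_curve_on_iff by blast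
    note D = chart_velocityD[OF this]
    let ?\<phi> = "snd c' \<circ> f \<circ> chart_inv c"
    show "\<exists>U D. open U \<and> t\<^sub>0 \<in> U \<and>
        (\<forall>t\<in>{u..v} \<inter> U. ((snd c' \<circ> (f \<circ> \<gamma>)) has_vector_derivative D t) (at t within {u..v})) \<and>
        continuous_on ({u..v} \<inter> U) D"
    proof (intro exI[of _ U] exI[of _ "\<lambda>t. frechet_derivative ?\<phi> (at (snd c (\<gamma> t))) (D t)"] conjI ballI U(1))
      have "\<gamma> t\<^sub>0 \<in> S" using sub t0 by auto
      then show "t\<^sub>0 \<in> U" using U(2) t0 c by auto
      fix t assume t: "t \<in> {u..v} \<inter> U"
      have "((snd c' \<circ> f) \<circ> \<gamma> has_vector_derivative frechet_derivative ?\<phi> (at (snd c (\<gamma> t))) (D t)) (at t within {u..v})"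
      proof (rule curve_chain[OF c(1), where w = "D t" and D = "frechet_derivative ?\<phi> (at (snd c (\<gamma> t)))"])
        show "\<gamma> t \<in> fst c" "t \<in> {u..v}" using inW[OF t] t by auto
        show "continuous (at t within {u..v}) \<gamma>"
          using cont t by (simp add: continuous_on_eq_continuous_within)
        show "((snd c \<circ> \<gamma>) has_vector_derivative D t) (at t within {u..v})"
          using inW[OF t] t by (intro D(1)) auto
        show "(?\<phi> has_derivative frechet_derivative ?\<phi> (at (snd c (\<gamma> t)))) (at (snd c (\<gamma> t)))"
          using inW[OF t] by (intro C1_map_on_has_derivative[OF f _ c(1) _ c']) auto
      qed
      then show "((snd c' \<circ> (f \<circ> \<gamma>)) has_vector_derivative frechet_derivative ?\<phi> (at (snd c (\<gamma> t))) (D t)) (at t within {u..v})"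
        by (simp add: comp_assoc)
    next
      show "continuous_on ({u..v} \<inter> U) (\<lambda>t. frechet_derivative ?\<phi> (at (snd c (\<gamma> t))) (D t))"
      proof (rule Ck_on_1_continuous_on_derivative[OF C1_map_on_Ck_1[OF f c(1) c']])
        have inc: "\<gamma> ` ({u..v} \<inter> U) \<subseteq> fst c" using inW by auto
        show "continuous_on ({u..v} \<inter> U) (\<lambda>t. snd c (\<gamma> t))"
          by (rule continuous_on_compose2[OF continuous_on_chart[OF c(1)] _ inc])
            (rule continuous_on_subset[OF cont], simp)
        show "continuous_on ({u..v} \<inter> U) D"
          by (rule continuous_on_subset[OF D(2)]) (use inc in auto)
        show "(\<lambda>t. snd c (\<gamma> t)) ` ({u..v} \<inter> U) \<subseteq> snd c ` (S \<inter> fst c \<inter> f -` fst c')"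
          using inW by auto
      qed
    qed
  qed
  show "speed (f \<circ> \<gamma>) t = tnorm g (f (\<gamma> t)) (tangent_map atl f (\<gamma> t) (velocity atl \<gamma> t))"
    if t: "t \<in> {u<..<v}"
  proof -
    obtain c where c: "c \<in> atl" "\<gamma> t \<in> fst c" using chart_exists by blast
    obtain c' where c': "c' \<in> atl" "f (\<gamma> t) \<in> fst c'" using chart_exists by blast
    have x: "\<gamma> t \<in> S" using sub t by auto
    note vel = C1_curve_interior[OF C t]
    have "((snd c' \<circ> f) \<circ> \<gamma> has_vector_derivative
        frechet_derivative (snd c' \<circ> f \<circ> chart_inv c) (at (snd c (\<gamma> t))) (velocity atl \<gamma> t c)) (at t)"
      by (rule curve_chain[OF c UNIV_I vel(1) vel(2)[OF c] C1_map_on_has_derivative[OF f x c c']])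
    moreover have "((snd c' \<circ> (f \<circ> \<gamma>)) has_vector_derivative velocity atl (f \<circ> \<gamma>) t c') (at t)"
      using C1_curve_interior(2)[OF C' t c'(1)] c'(2) by simp
    ultimately have "velocity atl (f \<circ> \<gamma>) t c'
        = frechet_derivative (snd c' \<circ> f \<circ> chart_inv c) (at (snd c (\<gamma> t))) (velocity atl \<gamma> t c)"
      using vector_derivative_unique_at by (metis comp_assoc)
    then show ?thesis
      unfolding speed_def tnorm_tangent_map[OF f S x vel(3) c c']
      using tnorm_eq_chart_norm[OF c'(1) _ C1_curve_interior(3)[OF C' t]] c'(2) by simp
  qed
qed

lemma pwC1_image:
  assumes f: "C1_map_on atl S f" and S: "open S" and \<gamma>: "pwC1 \<gamma> a b" and sub: "\<gamma> ` {a..b} \<subseteq> S"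
  shows "pwC1 (f \<circ> \<gamma>) a b"
proof -
  obtain S' where S': "finite S'"
    "\<And>u v. a \<le> u \<Longrightarrow> u < v \<Longrightarrow> v \<le> b \<Longrightarrow> {u<..<v} \<inter> S' = {} \<Longrightarrow> C1_curve_on atl \<gamma> u v"
    using \<gamma> unfolding pwC1_def by blast
  have "C1_curve_on atl (f \<circ> \<gamma>) u v" if "a \<le> u" "u < v" "v \<le> b" "{u<..<v} \<inter> S' = {}" for u v
    by (rule C1_image_curve(1)[OF f S S'(2)[OF that] that(2)]) (use sub that in force)
  then show ?thesis unfolding pwC1_def using S'(1) by blast
qed

end

section \<open>Moments of the lengths of curves\<close>

text \<open>Jensen's inequality for the p-th power with weights w / W, multiplied by a power of the
  total weight W. Terms with zero weight or zero value are discarded first, so that Jensen is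
  applied to positive weights and points; this leaves the left side unchanged and can only lower the
  right side.\<close>

lemma weighted_powr_mean:
  fixes w b :: "'a \<Rightarrow> real"
  assumes I: "finite I" and w: "\<And>i. i \<in> I \<Longrightarrow> 0 \<le> w i" and b: "\<And>i. i \<in> I \<Longrightarrow> 0 \<le> b i" and p: "1 \<le> p"
  shows "(\<Sum>i\<in>I. w i * b i) powr p \<le> (\<Sum>i\<in>I. w i) powr (p - 1) * (\<Sum>i\<in>I. w i * b i powr p)"
proof -
  define J where "J = {i\<in>I. 0 < w i \<and> 0 < b i}"
  have J: "finite J" "J \<subseteq> I" using I by (auto simp: J_def)
  have 1: "(\<Sum>i\<in>I. w i * b i) = (\<Sum>i\<in>J. w i * b i)"
    by (rule sum.mono_neutral_right) (use I J w b in \<open>auto simp: J_def less_le\<close>)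
  have 2: "(\<Sum>i\<in>J. w i * b i powr p) \<le> (\<Sum>i\<in>I. w i * b i powr p)"
    by (rule sum_mono2) (use I J w in auto)
  have 3: "(\<Sum>i\<in>J. w i) \<le> (\<Sum>i\<in>I. w i)" by (rule sum_mono2) (use I J w in auto)
  show ?thesis
  proof (cases "J = {}")
    case True
    then show ?thesis using 1 w b by (auto intro!: mult_nonneg_nonneg sum_nonneg)
  next
    case False
    define W where "W = (\<Sum>i\<in>J. w i)"
    have W: "0 < W" unfolding W_def by (rule sum_pos) (use J False in \<open>auto simp: J_def\<close>)
    have cvx: "(\<Sum>i\<in>J. (w i / W) *\<^sub>R b i) powr p \<le> (\<Sum>i\<in>J. (w i / W) * (b i powr p))"
    proof (rule convex_on_sum[OF J(1) False powr_convex[OF p]])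
      show "(\<Sum>i\<in>J. w i / W) = 1" using W by (simp add: sum_divide_distrib[symmetric] W_def)
    qed (use W in \<open>auto simp: J_def less_imp_le\<close>)
    have "(\<Sum>i\<in>J. w i * b i) = W * (\<Sum>i\<in>J. (w i / W) *\<^sub>R b i)"
      using W by (simp add: sum_distrib_left)
    then have "(\<Sum>i\<in>J. w i * b i) powr p = W powr p * (\<Sum>i\<in>J. (w i / W) *\<^sub>R b i) powr p"
      using W by (simp add: powr_mult sum_nonneg J_def)
    also have "\<dots> \<le> W powr p * (\<Sum>i\<in>J. (w i / W) * (b i powr p))"
      by (intro mult_left_mono cvx) simp
    also have "\<dots> = W powr (p - 1) * (\<Sum>i\<in>J. w i * b i powr p)"
      using W by (simp add: powr_diff sum_divide_distrib[symmetric])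
    also have "\<dots> \<le> (\<Sum>i\<in>I. w i) powr (p - 1) * (\<Sum>i\<in>I. w i * b i powr p)"
      using W p 3 2 w b by (intro mult_mono powr_mono2 sum_nonneg) (auto simp: W_def J_def intro: sum_nonneg)
    finally show ?thesis using 1 by simp
  qed
qed

text \<open>Countably many difference quotients determine a directional derivative; this is how the
  derivative of the flow becomes measurable in \<omega>.\<close>

lemma has_derivative_directional_sequence:
  fixes G :: "'a::real_normed_vector \<Rightarrow> 'b::real_normed_vector"
  assumes "(G has_derivative D) (at z)"
  shows "(\<lambda>n. real (Suc n) *\<^sub>R (G (z + (1 / real (Suc n)) *\<^sub>R u) - G z)) \<longlonglongrightarrow> D u"
proof -
  interpret D: bounded_linear D using assms by (rule has_derivative_bounded_linear)
  have "((\<lambda>s. z + s *\<^sub>R u) has_derivative (\<lambda>s. s *\<^sub>R u)) (at 0)"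
    by (auto intro!: derivative_eq_intros)
  moreover have "(G has_derivative D) (at (z + 0 *\<^sub>R u))" using assms by simp
  ultimately have "((\<lambda>s. G (z + s *\<^sub>R u)) has_derivative (\<lambda>s. D (s *\<^sub>R u))) (at 0)"
    by (rule has_derivative_compose)
  then have "((\<lambda>s. norm (G (z + (0 + s) *\<^sub>R u) - G (z + 0 *\<^sub>R u) - D (s *\<^sub>R u)) / norm s) \<longlongrightarrow> 0) (at 0)"
    unfolding has_derivative_at by blast
  moreover have "\<forall>\<^sub>F s in at (0::real). norm (G (z + (0 + s) *\<^sub>R u) - G (z + 0 *\<^sub>R u) - D (s *\<^sub>R u)) / norm s
      = norm ((1 / s) *\<^sub>R (G (z + s *\<^sub>R u) - G z) - D u)"
    unfolding eventually_at_filter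
  proof (intro always_eventually allI impI)
    fix s :: real assume s: "s \<noteq> 0"
    have "G (z + s *\<^sub>R u) - G z - s *\<^sub>R D u = s *\<^sub>R ((1 / s) *\<^sub>R (G (z + s *\<^sub>R u) - G z) - D u)"
      using s by (simp add: scaleR_diff_right)
    then have "norm (G (z + s *\<^sub>R u) - G z - s *\<^sub>R D u) = \<bar>s\<bar> * norm ((1 / s) *\<^sub>R (G (z + s *\<^sub>R u) - G z) - D u)"
      by simp
    then show "norm (G (z + (0 + s) *\<^sub>R u) - G (z + 0 *\<^sub>R u) - D (s *\<^sub>R u)) / norm s
      = norm ((1 / s) *\<^sub>R (G (z + s *\<^sub>R u) - G z) - D u)"
      using s by (simp add: D.scaleR)
  qed
  ultimately have "((\<lambda>s. norm ((1 / s) *\<^sub>R (G (z + s *\<^sub>R u) - G z) - D u)) \<longlongrightarrow> 0) (at 0)"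
    by (rule Lim_transform_eventually)
  then have lim: "((\<lambda>s. (1 / s) *\<^sub>R (G (z + s *\<^sub>R u) - G z)) \<longlongrightarrow> D u) (at 0)"
    by (rule LIM_zero_cancel[OF tendsto_norm_zero_cancel])
  have "filterlim (\<lambda>n. 1 / real (Suc n)) (at 0) sequentially"
    unfolding filterlim_at using LIMSEQ_inverse_real_of_nat by (simp add: inverse_eq_divide)
  from filterlim_compose[OF lim this] show ?thesis by simp
qed

lemma limseq_liminf_le:
  fixes f g :: "nat \<Rightarrow> ennreal"
  assumes "f \<longlonglongrightarrow> l" "\<forall>\<^sub>F n in sequentially. f n \<le> g n"
  shows "l \<le> liminf g"
  using lim_imp_Liminf[OF _ assms(1)] Liminf_mono[OF assms(2)] by simp

locale stochastic_flow = riem_manifold atl g + prob_space P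
  for atl :: "('m::{t2_space, second_countable_topology}, 'n::finite) chart set"
    and g :: "('m, 'n) metric_tensor" and P :: "'w measure" +
  fixes F :: "real \<Rightarrow> 'm \<Rightarrow> 'w \<Rightarrow> 'm" and \<xi> :: "'m \<Rightarrow> 'w \<Rightarrow> ereal"
  assumes F_measurable: "\<And>x t U. 0 \<le> t \<Longrightarrow> U \<in> sets borel \<Longrightarrow> {\<omega> \<in> space P. ereal t < \<xi> x \<omega> \<and> F t x \<omega> \<in> U} \<in> sets P"
    and F_paths: "\<And>x. AE \<omega> in P. continuous_on {t. 0 \<le> t \<and> ereal t < \<xi> x \<omega>} (\<lambda>t. F t x \<omega>)"
    and F_regular: "AE \<omega> in P. (\<forall>x. 0 < \<xi> x \<omega>) \<and>
      (\<forall>t\<ge>0. open {x. ereal t < \<xi> x \<omega>} \<and> C1_map_on atl {x. ereal t < \<xi> x \<omega>} (\<lambda>x. F t x \<omega>))"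
    and explosion: "\<And>b K. compact K \<Longrightarrow> AE \<omega> in P. explosion_time_on \<xi> K \<omega> < \<infinity> \<longrightarrow>
      filterlim (\<lambda>t. SUP x\<in>K. rdist b (F t x \<omega>)) at_top
        (at_left (real_of_ereal (explosion_time_on \<xi> K \<omega>)))"
begin

text \<open>The value 0 after explosion makes this a function on all of the probability space, as
  measurability requires.\<close>

definition stretch :: "real \<Rightarrow> 'm \<Rightarrow> ('m, 'n) tvec \<Rightarrow> 'w \<Rightarrow> real" where
  "stretch t x v \<omega> = (if ereal t < \<xi> x \<omega>
     then tnorm g (F t x \<omega>) (tangent_map atl (\<lambda>y. F t y \<omega>) x v) else 0)"

text \<open>The supremum runs over uncountably many times, and its measurability is not established.
  \<open>nn_integral\<close> is then the supremum over the simple functions below the integrand; it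
  is used only as an upper bound for integrals of measurable functions.\<close>

definition moment :: "real \<Rightarrow> real \<Rightarrow> 'm \<Rightarrow> ennreal" where
  "moment T p x = (\<integral>\<^sup>+\<omega>. (SUP s\<in>{0..T}. ennreal (tangent_map_norm atl g (\<lambda>y. F s y \<omega>) x powr p)
     * indicator {r. ereal r < \<xi> x \<omega>} s) \<partial>P)"

section \<open>Measurability of the derivative flow\<close>

lemma countable_charts: "\<exists>C :: nat \<Rightarrow> ('m, 'n) chart. (\<forall>j. C j \<in> atl) \<and> (\<forall>x. \<exists>j. x \<in> fst (C j))"
proof -
  obtain \<F> where \<F>: "\<F> \<subseteq> fst ` atl" "countable \<F>" "\<Union>\<F> = \<Union>(fst ` atl)"
    using Lindelof[of "fst ` atl"] open_chart by blast
  have U: "\<Union>\<F> = UNIV" using \<F>(3) chart_exists by auto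
  then have ne: "\<F> \<noteq> {}" by auto
  have "\<exists>c. c \<in> atl \<and> fst c = from_nat_into \<F> j" for j
    using from_nat_into[OF ne, of j] \<F>(1) by (metis image_iff subsetD)
  then obtain C where C: "\<And>j. C j \<in> atl \<and> fst (C j) = from_nat_into \<F> j" by metis
  have "\<exists>j. x \<in> fst (C j)" for x
  proof -
    obtain V where "V \<in> \<F>" "x \<in> V" using U by blast
    then show ?thesis using from_nat_into_surj[OF \<F>(2)] C by metis
  qed
  then show ?thesis using C by blast
qed

lemma chart_of_flow_measurable:
  assumes t: "0 \<le> t" and c: "c \<in> atl"
  shows "(\<lambda>\<omega>. if ereal t < \<xi> y \<omega> \<and> F t y \<omega> \<in> fst c then snd c (F t y \<omega>) else 0) \<in> borel_measurable P"
proof (rule borel_measurableI)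
  fix U :: "(real ^ 'n) set" assume U: "open U"
  let ?W = "fst c \<inter> snd c -` U"
  have "open ?W"
    using continuous_on_open_vimage[OF open_chart[OF c], of "snd c"] continuous_on_chart[OF c] U
    by (simp add: inf_commute)
  then have W: "?W \<in> sets borel" "fst c \<in> sets borel" using open_chart[OF c] by auto
  have "(\<lambda>\<omega>. if ereal t < \<xi> y \<omega> \<and> F t y \<omega> \<in> fst c then snd c (F t y \<omega>) else 0) -` U \<inter> space P
    = {\<omega> \<in> space P. ereal t < \<xi> y \<omega> \<and> F t y \<omega> \<in> ?W} \<union>
      (if 0 \<in> U then space P - {\<omega> \<in> space P. ereal t < \<xi> y \<omega> \<and> F t y \<omega> \<in> fst c} else {})"
    by (auto split: if_splits)
  also have "\<dots> \<in> sets P"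
    using F_measurable[OF t W(1), of y] F_measurable[OF t W(2), of y] by auto
  finally show "(\<lambda>\<omega>. if ereal t < \<xi> y \<omega> \<and> F t y \<omega> \<in> fst c then snd c (F t y \<omega>) else 0) -` U \<inter> space P \<in> sets P" .
qed

text \<open>The coordinates of the image vector are limits of difference quotients of the flow,
  hence of measurable functions, and the metric coefficients are continuous in the position; the
  chart at the random point is taken from a countable family. Equality is almost sure because
  differentiability of the flow is.\<close>

lemma stretch_measurable:
  assumes t: "0 \<le> t" and v: "v \<in> tangent_space atl x"
  shows "\<exists>h. h \<in> borel_measurable P \<and> (AE \<omega> in P. h \<omega> = stretch t x v \<omega>)"
proof -
  obtain C :: "nat \<Rightarrow> ('m, 'n) chart" where C: "\<And>j. C j \<in> atl" "\<And>x. \<exists>j. x \<in> fst (C j)"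
    using countable_charts by auto
  obtain c where c: "c \<in> atl" "x \<in> fst c" using chart_exists by blast
  let ?z = "\<lambda>n. snd c x + (1 / real (Suc n)) *\<^sub>R v c"
  define \<phi> where "\<phi> j y \<omega> = (if ereal t < \<xi> y \<omega> \<and> F t y \<omega> \<in> fst (C j) then snd (C j) (F t y \<omega>) else 0)" for j y \<omega>
  have \<phi> [measurable]: "(\<lambda>\<omega>. \<phi> j y \<omega>) \<in> borel_measurable P" for j y
    unfolding \<phi>_def by (rule chart_of_flow_measurable[OF t C(1)])
  define q where "q j n \<omega> = real (Suc n) *\<^sub>R (\<phi> j (chart_inv c (?z n)) \<omega> - \<phi> j x \<omega>)" for j n \<omega>
  have q [measurable]: "q j n \<in> borel_measurable P" for j n
    unfolding q_def[abs_def] by measurable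
  \<comment> \<open>\<open>lim\<close> is measurable on the whole space, whatever its value where
    the quotients diverge.\<close>
  define w where "w j \<omega> = lim (\<lambda>n. q j n \<omega>)" for j \<omega>
  have w [measurable]: "w j \<in> borel_measurable P" for j
    unfolding w_def[abs_def] by measurable
  have wnth [measurable]: "(\<lambda>\<omega>. w j \<omega> $ a) \<in> borel_measurable P" for j a
    by (rule measurable_compose[OF w]) (intro borel_measurable_continuous_onI continuous_intros)
  \<comment> \<open>Extension by 0 makes the metric coefficient Borel on the whole coordinate
    space.\<close>
  define \<psi> where "\<psi> j a b z = (if z \<in> snd (C j) ` fst (C j)
      then chart_inner (C j) (chart_inv (C j) z) (axis a 1) (axis b 1) else 0)" for j a b z
  have \<psi> [measurable]: "\<psi> j a b \<in> borel_measurable borel" for j a b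
    unfolding \<psi>_def[abs_def]
    by (rule borel_measurable_continuous_on_if)
      (use open_chart_image[OF C(1)] continuous_on_chart_inner_coeff[OF C(1)] in auto)
  define H where "H j \<omega> = sqrt (\<Sum>a\<in>UNIV. \<Sum>b\<in>UNIV. w j \<omega> $ a * w j \<omega> $ b * \<psi> j a b (\<phi> j x \<omega>))" for j \<omega>
  have H: "H j \<in> borel_measurable P" for j
    unfolding H_def[abs_def] by measurable
  define E where "E j = {\<omega> \<in> space P. ereal t < \<xi> x \<omega> \<and> F t x \<omega> \<in> fst (C j)}" for j
  have E [measurable]: "E j \<in> sets P" for j
    unfolding E_def using open_chart[OF C(1)] by (intro F_measurable t) auto
  \<comment> \<open>The least index of a chart containing the random point is a measurable
    choice.\<close>
  define J where "J \<omega> = (LEAST j. \<omega> \<in> E j)" for \<omega>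
  have J: "J \<in> measurable P (count_space UNIV)"
    unfolding J_def[abs_def] by measurable
  define h where "h \<omega> = (if \<omega> \<in> (\<Union>j. E j) then H (J \<omega>) \<omega> else 0)" for \<omega>
  have HJ [measurable]: "(\<lambda>\<omega>. H (J \<omega>) \<omega>) \<in> borel_measurable P"
    by (rule measurable_compose_countable[OF H J])
  have "h \<in> borel_measurable P"
    unfolding h_def[abs_def] by measurable
  moreover have "AE \<omega> in P. h \<omega> = stretch t x v \<omega>"
    using F_regular AE_space
  proof eventually_elim
    case (elim \<omega>)
    let ?S = "{x. ereal t < \<xi> x \<omega>}" and ?f = "\<lambda>x. F t x \<omega>"
    have S: "open ?S" and f: "C1_map_on atl ?S ?f" using elim t by auto
    show ?case
    proof (cases "ereal t < \<xi> x \<omega>")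
      case False
      then show ?thesis by (auto simp: h_def E_def stretch_def)
    next
      case True
      then have xS: "x \<in> ?S" by simp
      have ex: "\<exists>j. \<omega> \<in> E j" using C(2)[of "?f x"] True elim by (auto simp: E_def)
      then have J_E: "\<omega> \<in> E (J \<omega>)" unfolding J_def by (rule LeastI_ex)
      define j where "j = J \<omega>"
      let ?c = "C j"
      have c': "?c \<in> atl" "?f x \<in> fst ?c" using J_E C(1) by (auto simp: E_def j_def)
      let ?G = "snd ?c \<circ> ?f \<circ> chart_inv c"
      let ?D = "frechet_derivative ?G (at (snd c x))"
      have der: "(?G has_derivative ?D) (at (snd c x))"
        by (rule C1_map_on_has_derivative[OF f xS c c'])
      have \<phi>x: "\<phi> j x \<omega> = snd ?c (?f x)" using True c' by (simp add: \<phi>_def)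
      let ?W = "snd c ` (fst c \<inter> (?S \<inter> ?f -` fst ?c))"
      have W: "open ?W"
        by (intro open_chart_image_Int[OF c(1)] open_C1_map_vimage[OF f S] open_chart c')
      have zlim: "?z \<longlonglongrightarrow> snd c x"
      proof -
        have "(\<lambda>n. 1 / real (Suc n)) \<longlonglongrightarrow> 0"
          using LIMSEQ_inverse_real_of_nat by (simp add: inverse_eq_divide)
        from tendsto_add[OF tendsto_const tendsto_scaleR[OF this tendsto_const], of "snd c x" "v c"]
        show ?thesis by simp
      qed
      \<comment> \<open>\<open>q\<close> agrees with the difference quotients of the flow once the
        shifted points lie in the open set where the flow is alive and takes values in the chosen
        chart.\<close>
      have "\<forall>\<^sub>F n in sequentially. ?z n \<in> ?W"
        using topological_tendstoD[OF zlim W] c c' xS by blast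
      then have "\<forall>\<^sub>F n in sequentially. real (Suc n) *\<^sub>R (?G (?z n) - ?G (snd c x)) = q j n \<omega>"
      proof eventually_elim
        case (elim n)
        then obtain y where y: "?z n = snd c y" "y \<in> fst c" "y \<in> ?S" "?f y \<in> fst ?c" by auto
        have "\<phi> j (chart_inv c (?z n)) \<omega> = ?G (?z n)"
          unfolding y(1) using y(2-4) c(1) by (simp add: \<phi>_def)
        then show ?case using \<phi>x c by (simp add: q_def)
      qed
      from Lim_transform_eventually[OF has_derivative_directional_sequence[OF der, of "v c"] this]
      have "(\<lambda>n. q j n \<omega>) \<longlonglongrightarrow> ?D (v c)" .
      then have wD: "w j \<omega> = ?D (v c)" unfolding w_def by (rule limI)
      have \<psi>j: "\<psi> j a b (\<phi> j x \<omega>) = chart_inner ?c (?f x) (axis a 1) (axis b 1)" for a b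
        unfolding \<psi>_def \<phi>x using c' by simp
      have "h \<omega> = H j \<omega>" using ex by (auto simp: h_def j_def)
      also have "\<dots> = chart_norm ?c (?f x) (?D (v c))"
        unfolding H_def \<psi>j wD chart_norm_eq chart_inner_expand[OF c', of "?D (v c)" "?D (v c)"] ..
      also have "\<dots> = stretch t x v \<omega>"
        using True tnorm_tangent_map[OF f S xS v c c'] by (simp add: stretch_def)
      finally show ?thesis .
    qed
  qed
  ultimately show ?thesis by blast
qed

lemma stretch_bounds:
  assumes "open {x. ereal t < \<xi> x \<omega>}" "C1_map_on atl {x. ereal t < \<xi> x \<omega>} (\<lambda>x. F t x \<omega>)"
    and v: "v \<in> tangent_space atl x" and x: "ereal t < \<xi> x \<omega>"
  shows "0 \<le> stretch t x v \<omega>" "stretch t x v \<omega> \<le> tangent_map_norm atl g (\<lambda>y. F t y \<omega>) x * tnorm g x v"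
proof -
  have xS: "x \<in> {x. ereal t < \<xi> x \<omega>}" using x by simp
  have eq: "stretch t x v \<omega> = tnorm g (F t x \<omega>) (tangent_map atl (\<lambda>y. F t y \<omega>) x v)"
    using x by (simp add: stretch_def)
  show "0 \<le> stretch t x v \<omega>"
    unfolding eq by (rule tnorm_nonneg[OF tangent_map_in_tangent_space[OF assms(2,1) xS v]])
  show "stretch t x v \<omega> \<le> tangent_map_norm atl g (\<lambda>y. F t y \<omega>) x * tnorm g x v"
    unfolding eq by (rule tangent_map_norm_bound[OF assms(2,1) xS v])
qed

text \<open>Jensen's inequality for the measure |\<gamma>'| dr, of mass below \<open>L\<close>,
  bounds the p-th power of the image length by L^(p-1) times the integral of |\<gamma>'| |T F|^p;
  the expectation replaces |T F|^p by \<open>C\<close> and contributes a further factor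
  \<open>L\<close>. \<open>Z\<close> does not depend on t, since the supremum over rational times is
  taken at each node. Strictness in \<open>L\<close> leaves room for the Riemann sums of the
  speed.\<close>

lemma length_moment:
  assumes p: "1 \<le> p" and \<gamma>: "pwC1 \<gamma> 0 1" and K: "\<gamma> ` {0..1} \<subseteq> K" and L: "len \<gamma> 0 1 < L"
    and C: "\<And>x. x \<in> K \<Longrightarrow> moment T p x \<le> C"
  shows "\<exists>Z. Z \<in> borel_measurable P \<and> (\<integral>\<^sup>+\<omega>. Z \<omega> \<partial>P) \<le> ennreal (L powr p) * C \<and>
    (AE \<omega> in P. \<forall>t\<in>\<rat> \<inter> {0..T}. (\<forall>x\<in>\<gamma> ` {0..1}. ereal t < \<xi> x \<omega>) \<longrightarrow>
      ennreal (len ((\<lambda>x. F t x \<omega>) \<circ> \<gamma>) 0 1 powr p) \<le> Z \<omega>)"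
proof -
  obtain S B where S: "finite S" "{0, 1} \<subseteq> S" "S \<subseteq> {0..1}"
    and reg: "\<And>r. r \<in> {0..1} - S \<Longrightarrow> \<exists>u v. 0 \<le> u \<and> v \<le> 1 \<and> r \<in> {u<..<v} \<and> C1_curve_on atl \<gamma> u v"
    and B: "\<And>r. r \<in> {0..1} - S \<Longrightarrow> 0 \<le> speed \<gamma> r \<and> speed \<gamma> r \<le> B"
    by (rule pwC1_partition[OF \<gamma> zero_less_one]) (rule that)
  let ?Q = "\<rat> \<inter> {0..T}"
  have Q: "countable ?Q" using countable_rat by (rule countable_subset[rotated]) auto
  have L0: "0 < L" using len_nonneg[OF \<gamma>] L by simp
  let ?v = "velocity atl \<gamma>"
  have v: "?v r \<in> tangent_space atl (\<gamma> r)" if "r \<in> {0..1} - S" for r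
    using reg[OF that] C1_curve_interior(3) by blast
  have w: "tnorm g (\<gamma> r) (?v r) = speed \<gamma> r" for r by (simp add: speed_def)
  have "\<forall>s r. \<exists>h. s \<in> ?Q \<and> r \<in> {0..1} - S \<longrightarrow>
      h \<in> borel_measurable P \<and> (AE \<omega> in P. h \<omega> = stretch s (\<gamma> r) (?v r) \<omega>)"
  proof (intro allI)
    fix s r
    show "\<exists>h. s \<in> ?Q \<and> r \<in> {0..1} - S \<longrightarrow>
      h \<in> borel_measurable P \<and> (AE \<omega> in P. h \<omega> = stretch s (\<gamma> r) (?v r) \<omega>)"
    proof (cases "s \<in> ?Q \<and> r \<in> {0..1} - S")
      case True
      then have "\<exists>h. h \<in> borel_measurable P \<and> (AE \<omega> in P. h \<omega> = stretch s (\<gamma> r) (?v r) \<omega>)"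
        by (intro stretch_measurable v) auto
      then show ?thesis by blast
    qed blast
  qed
  then obtain h where h: "\<And>s r. s \<in> ?Q \<Longrightarrow> r \<in> {0..1} - S \<Longrightarrow> h s r \<in> borel_measurable P"
    and h_eq: "\<And>s r. s \<in> ?Q \<Longrightarrow> r \<in> {0..1} - S \<Longrightarrow> AE \<omega> in P. h s r \<omega> = stretch s (\<gamma> r) (?v r) \<omega>"
    by metis
  \<comment> \<open>The p-th power of the stretch per unit speed. Division by speed zero gives 0,
    which is harmless because such a node carries weight zero in the sums.\<close>
  define A where "A r \<omega> = (SUP s\<in>?Q. ennreal ((h s r \<omega> / speed \<gamma> r) powr p))" for r \<omega>
  have A_meas: "A r \<in> borel_measurable P" if r: "r \<in> {0..1} - S" for r
    unfolding A_def[abs_def]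
  proof (rule borel_measurable_SUP[OF Q])
    fix s assume "s \<in> ?Q"
    from h[OF this r] show "(\<lambda>\<omega>. ennreal ((h s r \<omega> / speed \<gamma> r) powr p)) \<in> borel_measurable P"
      by measurable
  qed
  have A_int: "(\<integral>\<^sup>+\<omega>. A r \<omega> \<partial>P) \<le> C" if r: "r \<in> {0..1} - S" for r
  proof -
    have "AE \<omega> in P. \<forall>s\<in>?Q. h s r \<omega> = stretch s (\<gamma> r) (?v r) \<omega>"
      using h_eq[OF _ r] Q by (intro AE_ball_countable') auto
    then have "AE \<omega> in P. A r \<omega> \<le> (SUP s\<in>{0..T}. ennreal (tangent_map_norm atl g (\<lambda>y. F s y \<omega>) (\<gamma> r) powr p)
            * indicator {u. ereal u < \<xi> (\<gamma> r) \<omega>} s)"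
      using F_regular
    proof eventually_elim
      case (elim \<omega>)
      show ?case
        unfolding A_def
      proof (rule SUP_mono)
        fix s assume s: "s \<in> ?Q"
        have he: "h s r \<omega> = stretch s (\<gamma> r) (?v r) \<omega>" using elim s by blast
        have "ennreal ((h s r \<omega> / speed \<gamma> r) powr p) \<le> ennreal (tangent_map_norm atl g (\<lambda>y. F s y \<omega>) (\<gamma> r) powr p)
            * indicator {u. ereal u < \<xi> (\<gamma> r) \<omega>} s"
        proof (cases "ereal s < \<xi> (\<gamma> r) \<omega> \<and> speed \<gamma> r \<noteq> 0")
          case False
          then show ?thesis by (auto simp: he stretch_def)
        next
          case True
          have sp: "0 < speed \<gamma> r" using True B[OF r] by simp
          have op: "open {x. ereal s < \<xi> x \<omega>}" "C1_map_on atl {x. ereal s < \<xi> x \<omega>} (\<lambda>x. F s x \<omega>)"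
            using elim s by auto
          from stretch_bounds[OF op v[OF r]] True
          have "0 \<le> h s r \<omega> / speed \<gamma> r"
            "h s r \<omega> / speed \<gamma> r \<le> tangent_map_norm atl g (\<lambda>y. F s y \<omega>) (\<gamma> r)"
            using sp by (auto simp: he w divide_le_eq)
          then have "(h s r \<omega> / speed \<gamma> r) powr p \<le> tangent_map_norm atl g (\<lambda>y. F s y \<omega>) (\<gamma> r) powr p"
            using p by (intro powr_mono2) auto
          then show ?thesis using True by (simp add: ennreal_leI)
        qed
        then show "\<exists>s'\<in>{0..T}. ennreal ((h s r \<omega> / speed \<gamma> r) powr p) \<le>
            ennreal (tangent_map_norm atl g (\<lambda>y. F s' y \<omega>) (\<gamma> r) powr p) * indicator {u. ereal u < \<xi> (\<gamma> r) \<omega>} s'"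
          using s by auto
      qed
    qed
    then have "(\<integral>\<^sup>+\<omega>. A r \<omega> \<partial>P) \<le> moment T p (\<gamma> r)"
      unfolding moment_def by (rule nn_integral_mono_AE)
    also have "\<dots> \<le> C" using K r by (intro C) auto
    finally show ?thesis .
  qed
  define I where "I N = {i\<in>{..<N}. real i / real N \<notin> S}" for N
  have I: "finite (I N)" "\<And>i. i \<in> I N \<Longrightarrow> real i / real N \<in> {0..1} - S" for N
    by (auto simp: I_def)
  have sum_I: "(\<Sum>i<N. if real i / real N \<in> S then 0 else f (real i / real N)) = (\<Sum>i\<in>I N. f (real i / real N))"
    for f :: "real \<Rightarrow> real" and N
    unfolding I_def by (subst sum.inter_filter) (auto intro!: sum.cong)
  define W where "W N = (\<Sum>i\<in>I N. speed \<gamma> (real i / real N)) / real N" for N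
  have W0: "0 \<le> W N" for N
    unfolding W_def using B I(2) by (intro divide_nonneg_nonneg sum_nonneg) auto
  have cont_speed: "continuous_on ({0..1} - S) (speed \<gamma>)"
    using reg isCont_speed by (intro continuous_at_imp_continuous_on) blast
  have W_lim: "W \<longlonglongrightarrow> len \<gamma> 0 1"
    using Riemann_sums_tendsto_integral[OF S(1,2) cont_speed, of B] B
    unfolding W_def[abs_def] sum_I len_def by auto
  have W_L: "\<forall>\<^sub>F N in sequentially. 0 < N \<and> W N \<le> L"
    using order_tendstoD(2)[OF W_lim L] eventually_gt_at_top[of 0] by eventually_elim simp
  \<comment> \<open>Riemann sum of the Jensen majorant, with \<open>L\<close> already in place of
    the total weight \<open>W N\<close>, which it eventually dominates.\<close>
  define Zn where "Zn N \<omega> = ennreal (L powr (p - 1)) *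
      ((\<Sum>i\<in>I N. ennreal (speed \<gamma> (real i / real N)) * A (real i / real N) \<omega>) * ennreal (1 / real N))" for N \<omega>
  have Zn_meas: "Zn N \<in> borel_measurable P" for N
    unfolding Zn_def[abs_def]
    by (intro borel_measurable_times_ennreal borel_measurable_sum borel_measurable_const A_meas I(2))
  have Zn_int: "(\<integral>\<^sup>+\<omega>. Zn N \<omega> \<partial>P) \<le> ennreal (L powr (p - 1)) * (ennreal (W N) * C)" for N
  proof -
    have "(\<integral>\<^sup>+\<omega>. Zn N \<omega> \<partial>P) = ennreal (L powr (p - 1)) *
      ((\<Sum>i\<in>I N. ennreal (speed \<gamma> (real i / real N)) * (\<integral>\<^sup>+\<omega>. A (real i / real N) \<omega> \<partial>P)) * ennreal (1 / real N))"
      unfolding Zn_def using A_meas[OF I(2)]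
      by (simp add: nn_integral_cmult nn_integral_multc nn_integral_sum)
    also have "\<dots> \<le> ennreal (L powr (p - 1)) *
      ((\<Sum>i\<in>I N. ennreal (speed \<gamma> (real i / real N)) * C) * ennreal (1 / real N))"
      by (intro mult_left_mono mult_right_mono sum_mono A_int I(2)) auto
    also have "(\<Sum>i\<in>I N. ennreal (speed \<gamma> (real i / real N)) * C) * ennreal (1 / real N)
        = (\<Sum>i\<in>I N. ennreal (speed \<gamma> (real i / real N))) * ennreal (1 / real N) * C"
      unfolding sum_distrib_right[symmetric] by (simp add: mult_ac)
    also have "(\<Sum>i\<in>I N. ennreal (speed \<gamma> (real i / real N))) * ennreal (1 / real N) = ennreal (W N)"
      using B I(2)[of _ N] by (subst sum_ennreal) (auto simp: W_def ennreal_mult'[symmetric] sum_nonneg)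
    finally show ?thesis .
  qed
  define Z where "Z \<omega> = liminf (\<lambda>N. Zn N \<omega>)" for \<omega>
  have "Z \<in> borel_measurable P"
    unfolding Z_def[abs_def] using Zn_meas by measurable
  moreover have "(\<integral>\<^sup>+\<omega>. Z \<omega> \<partial>P) \<le> ennreal (L powr p) * C"
  proof -
    have "(\<integral>\<^sup>+\<omega>. Z \<omega> \<partial>P) \<le> liminf (\<lambda>N. \<integral>\<^sup>+\<omega>. Zn N \<omega> \<partial>P)"
      unfolding Z_def by (rule nn_integral_liminf[OF Zn_meas])
    also have "\<dots> \<le> ennreal (L powr p) * C"
    proof (rule Liminf_le)
      show "\<forall>\<^sub>F N in sequentially. (\<integral>\<^sup>+\<omega>. Zn N \<omega> \<partial>P) \<le> ennreal (L powr p) * C"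
        using W_L
      proof eventually_elim
        case (elim N)
        have "(\<integral>\<^sup>+\<omega>. Zn N \<omega> \<partial>P) \<le> ennreal (L powr (p - 1)) * (ennreal (W N) * C)" by (rule Zn_int)
        also have "\<dots> \<le> ennreal (L powr (p - 1)) * (ennreal L * C)"
          using elim by (intro mult_left_mono mult_right_mono ennreal_leI) auto
        also have "\<dots> = ennreal (L powr p) * C"
          using L0 by (simp add: mult.assoc[symmetric] ennreal_mult'[symmetric] powr_diff)
        finally show ?case .
      qed
    qed simp
    finally show ?thesis .
  qed
  moreover have "AE \<omega> in P. \<forall>t\<in>?Q. (\<forall>x\<in>\<gamma> ` {0..1}. ereal t < \<xi> x \<omega>) \<longrightarrow>
      ennreal (len ((\<lambda>x. F t x \<omega>) \<circ> \<gamma>) 0 1 powr p) \<le> Z \<omega>"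
  proof -
    \<comment> \<open>The nodes of all levels and the rational times form a countable set, so one
      null set serves every t.\<close>
    have "AE \<omega> in P. \<forall>N::nat\<in>UNIV. \<forall>i\<in>I N. \<forall>s\<in>?Q.
        h s (real i / real N) \<omega> = stretch s (\<gamma> (real i / real N)) (?v (real i / real N)) \<omega>"
      using Q I h_eq by (intro AE_ball_countable') (auto simp: countable_finite)
    then show ?thesis
      using F_regular
    proof eventually_elim
      case (elim \<omega>)
      show ?case
      proof (intro ballI impI)
        fix t assume t: "t \<in> ?Q" and alive: "\<forall>x\<in>\<gamma> ` {0..1}. ereal t < \<xi> x \<omega>"
        let ?f = "\<lambda>x. F t x \<omega>" and ?S = "{x. ereal t < \<xi> x \<omega>}"
        have f: "open ?S" "C1_map_on atl ?S ?f" using elim t by auto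
        have sub: "\<gamma> ` {0..1} \<subseteq> ?S" using alive by auto
        let ?\<eta> = "?f \<circ> \<gamma>"
        have \<eta>: "pwC1 ?\<eta> 0 1" by (rule pwC1_image[OF f(2,1) \<gamma> sub])
        have piece: "isCont (speed ?\<eta>) r \<and> speed ?\<eta> r = stretch t (\<gamma> r) (?v r) \<omega> \<and> 0 \<le> speed ?\<eta> r"
          if r: "r \<in> {0..1} - S" for r
        proof -
          obtain u v where uv: "0 \<le> u" "v \<le> 1" "r \<in> {u<..<v}" "C1_curve_on atl \<gamma> u v" using reg[OF r] by blast
          have "{u..v} \<subseteq> {0..1}" using uv by auto
          then have uv': "u < v" "\<gamma> ` {u..v} \<subseteq> ?S"
            using uv(3) subset_trans[OF image_mono sub] by auto
          note * = C1_image_curve[OF f(2,1) uv(4) uv']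
          have "ereal t < \<xi> (\<gamma> r) \<omega>" using alive r by auto
          then show ?thesis
            using isCont_speed[OF *(1) uv(3)] *(2)[OF uv(3)] speed_nonneg[OF *(1) uv(3)] by (simp add: stretch_def)
        qed
        obtain S' B' where S': "finite S'" and B': "\<And>r. r \<in> {0..1} - S' \<Longrightarrow> 0 \<le> speed ?\<eta> r \<and> speed ?\<eta> r \<le> B'"
          by (rule pwC1_partition[OF \<eta> zero_less_one]) (rule that)
        \<comment> \<open>The break points \<open>S'\<close> found for the image curve need not lie
          in \<open>S\<close>; the finitely many values there are absorbed into the bound.\<close>
        have bound: "\<bar>speed ?\<eta> r\<bar> \<le> \<bar>B'\<bar> + (\<Sum>s\<in>S'. \<bar>speed ?\<eta> s\<bar>)" if r: "r \<in> {0..1} - S" for r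
        proof (cases "r \<in> S'")
          case True
          then have "\<bar>speed ?\<eta> r\<bar> \<le> (\<Sum>s\<in>S'. \<bar>speed ?\<eta> s\<bar>)" using S' by (intro member_le_sum) auto
          then show ?thesis by linarith
        next
          case False
          then have "\<bar>speed ?\<eta> r\<bar> \<le> \<bar>B'\<bar>" using B'[of r] r by auto
          moreover have "0 \<le> (\<Sum>s\<in>S'. \<bar>speed ?\<eta> s\<bar>)" by (intro sum_nonneg) auto
          ultimately show ?thesis by linarith
        qed
        define X where "X N = (\<Sum>i\<in>I N. speed ?\<eta> (real i / real N)) / real N" for N
        have "continuous_on ({0..1} - S) (speed ?\<eta>)"
          using piece by (intro continuous_at_imp_continuous_on) blast
        from Riemann_sums_tendsto_integral[OF S(1,2) this bound]
        have X_lim: "X \<longlonglongrightarrow> len ?\<eta> 0 1"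
          unfolding X_def[abs_def] sum_I len_def .
        have X0: "0 \<le> X N" for N
          unfolding X_def
        proof (intro divide_nonneg_nonneg sum_nonneg)
          show "0 \<le> speed ?\<eta> (real i / real N)" if "i \<in> I N" for i
            using piece[OF I(2)[OF that]] by simp
        qed simp
        have "(\<lambda>N. X N powr p) \<longlonglongrightarrow> len ?\<eta> 0 1 powr p"
          using p X0 by (intro tendsto_powr'[OF X_lim tendsto_const]) auto
        then have "(\<lambda>N. ennreal (X N powr p)) \<longlonglongrightarrow> ennreal (len ?\<eta> 0 1 powr p)"
          by (rule tendsto_ennrealI)
        moreover have "\<forall>\<^sub>F N in sequentially. ennreal (X N powr p) \<le> Zn N \<omega>"
          using W_L
        proof eventually_elim
          case (elim N)
          let ?r = "\<lambda>i. real i / real N"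
          let ?w = "\<lambda>i. speed \<gamma> (?r i)"
          define b where "b i = h t (?r i) \<omega> / ?w i" for i
          have w0: "0 \<le> ?w i" if "i \<in> I N" for i using B I(2)[OF that] by auto
          have b: "0 \<le> b i" "speed ?\<eta> (?r i) = ?w i * b i" "ennreal (b i powr p) \<le> A (?r i) \<omega>" if i: "i \<in> I N" for i
          proof -
            note r = I(2)[OF i]
            have he: "h t (?r i) \<omega> = speed ?\<eta> (?r i)"
              using \<open>\<forall>N\<in>UNIV. \<forall>i\<in>I N. \<forall>s\<in>?Q. h s (real i / real N) \<omega> = stretch s (\<gamma> (real i / real N)) (?v (real i / real N)) \<omega>\<close>
                i t piece[OF r] by auto
            show "0 \<le> b i" using he piece[OF r] w0[OF i] by (simp add: b_def)
            have "ereal t < \<xi> (\<gamma> (?r i)) \<omega>" using alive r by auto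
            from stretch_bounds(2)[OF f v[OF r] this]
            \<comment> \<open>If the speed at the node vanishes, this inequality forces the image
              speed to vanish too, so the product with \<open>b i\<close> is right in that case as
              well.\<close>
            have "speed ?\<eta> (?r i) \<le> tangent_map_norm atl g ?f (\<gamma> (?r i)) * ?w i"
              using piece[OF r] by (simp add: w)
            then show "speed ?\<eta> (?r i) = ?w i * b i"
              using he piece[OF r] by (cases "?w i = 0") (auto simp: b_def)
            show "ennreal (b i powr p) \<le> A (?r i) \<omega>"
              unfolding A_def b_def using t by (intro SUP_upper) auto
          qed
          have "X N powr p = ((\<Sum>i\<in>I N. (?w i / real N) * b i)) powr p"
            unfolding X_def using b(2) by (simp add: sum_divide_distrib)
          also have "\<dots> \<le> (\<Sum>i\<in>I N. ?w i / real N) powr (p - 1) * (\<Sum>i\<in>I N. (?w i / real N) * b i powr p)"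
            using p b(1) w0 by (intro weighted_powr_mean I) auto
          also have "\<dots> = W N powr (p - 1) * (\<Sum>i\<in>I N. (?w i / real N) * b i powr p)"
            by (simp add: W_def sum_divide_distrib)
          also have "\<dots> \<le> L powr (p - 1) * (\<Sum>i\<in>I N. (?w i / real N) * b i powr p)"
            using elim p W0 w0 by (intro mult_right_mono powr_mono2 sum_nonneg) auto
          finally have "ennreal (X N powr p) \<le> ennreal (L powr (p - 1) * (\<Sum>i\<in>I N. (?w i / real N) * b i powr p))"
            by (rule ennreal_leI)
          also have "\<dots> = ennreal (L powr (p - 1)) * (\<Sum>i\<in>I N. ennreal (?w i) * ennreal (b i powr p) * ennreal (1 / real N))"
          proof -
            have "ennreal (\<Sum>i\<in>I N. (?w i / real N) * b i powr p) = (\<Sum>i\<in>I N. ennreal ((?w i / real N) * b i powr p))"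
              using w0 by (intro sum_ennreal[symmetric]) simp
            also have "\<dots> = (\<Sum>i\<in>I N. ennreal (?w i) * ennreal (b i powr p) * ennreal (1 / real N))"
              by (intro sum.cong refl) (simp add: ennreal_mult'[symmetric] w0)
            finally show ?thesis by (subst ennreal_mult') auto
          qed
          also have "\<dots> \<le> ennreal (L powr (p - 1)) * (\<Sum>i\<in>I N. ennreal (?w i) * A (?r i) \<omega> * ennreal (1 / real N))"
            using b(3) by (intro mult_left_mono mult_right_mono sum_mono) auto
          also have "\<dots> = Zn N \<omega>" unfolding Zn_def by (simp add: sum_distrib_right)
          finally show ?case .
        qed
        ultimately show "ennreal (len ?\<eta> 0 1 powr p) \<le> Z \<omega>"
          unfolding Z_def by (rule limseq_liminf_le)
      qed
    qed
  qed
  ultimately show ?thesis by blast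
qed

end

section \<open>Completeness at every point\<close>

lemma powr_le_imp_le_root:
  fixes l z p :: real
  assumes "0 \<le> l" "0 < p" "l powr p \<le> z"
  shows "l \<le> z powr (1 / p)"
proof -
  have "l = (l powr p) powr (1 / p)" using assms by (simp add: powr_powr)
  also have "\<dots> \<le> z powr (1 / p)" using assms by (intro powr_mono2) auto
  finally show ?thesis .
qed

text \<open>The dimension is a number here, so that completeness along points and curves does not
  mention the type of the cube; the two are tied by \<open>CARD('d) = d\<close> in the chaining
  argument.\<close>

locale moment_flow = stochastic_flow atl g P F \<xi>
  for atl :: "('m::{t2_space, second_countable_topology}, 'n::finite) chart set"
    and g :: "('m, 'n) metric_tensor" and P :: "'w measure"
    and F :: "real \<Rightarrow> 'm \<Rightarrow> 'w \<Rightarrow> 'm" and \<xi> :: "'m \<Rightarrow> 'w \<Rightarrow> ereal" +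
  fixes d :: nat
  assumes d: "1 \<le> d"
    and complete_at_point: "\<exists>x\<^sub>0. AE \<omega> in P. \<xi> x\<^sub>0 \<omega> = \<infinity>"
    and moments: "\<And>t K. 0 < t \<Longrightarrow> compact K \<Longrightarrow>
      \<exists>\<delta>>0. (SUP x\<in>K. moment t (real d + \<delta>) x) < \<infinity>"
begin

section \<open>Explosion times of compact sets\<close>

lemma moment_bound:
  assumes "0 < T" "compact K"
  obtains \<delta> C where "0 < \<delta>" "C < \<infinity>" "\<And>x. x \<in> K \<Longrightarrow> moment T (real d + \<delta>) x \<le> C"
proof -
  obtain \<delta> where \<delta>: "0 < \<delta>" "(SUP x\<in>K. moment T (real d + \<delta>) x) < \<infinity>"
    using moments[OF assms] by blast
  show ?thesis by (rule that[OF \<delta>]) (rule SUP_upper)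
qed

text \<open>The open sets of points that survive beyond 1 / (n + 1) increase to the whole manifold,
  so one of them contains \<open>K\<close>. Positivity ensures that there are times at which the
  flow on \<open>K\<close> can be examined.\<close>

lemma explosion_time_on_pos:
  assumes K: "compact K" and pos: "\<And>x. 0 < \<xi> x \<omega>" and op: "\<And>t. 0 \<le> t \<Longrightarrow> open {x. ereal t < \<xi> x \<omega>}"
  shows "0 < explosion_time_on \<xi> K \<omega>"
proof -
  let ?V = "\<lambda>n. {x. ereal (1 / real (Suc n)) < \<xi> x \<omega>}"
  have cover: "\<exists>n. x \<in> ?V n" for x
  proof -
    obtain z where z: "0 < ereal z" "ereal z < \<xi> x \<omega>" using ereal_dense2[OF pos[of x]] by auto
    obtain n where "inverse (real (Suc n)) < z" using reals_Archimedean[of z] z by auto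
    then have "ereal (1 / real (Suc n)) < ereal z" by (simp add: inverse_eq_divide)
    then have "x \<in> ?V n" using z(2) by (metis (mono_tags) mem_Collect_eq less_trans)
    then show ?thesis ..
  qed
  obtain N where N: "finite N" "K \<subseteq> (\<Union>n\<in>N. ?V n)"
    by (rule compactE_image[OF K, of UNIV ?V]) (use op cover in auto)
  have "ereal (1 / real (Suc (Max N))) \<le> \<xi> x \<omega>" if x: "x \<in> K" for x
  proof -
    obtain n where n: "n \<in> N" "x \<in> ?V n" using N(2) x by blast
    have "n \<le> Max N" using N(1) n(1) by simp
    then have "ereal (1 / real (Suc (Max N))) \<le> ereal (1 / real (Suc n))"
      by (simp add: frac_le)
    also have "\<dots> \<le> \<xi> x \<omega>" using n by (simp add: less_imp_le)
    finally show ?thesis .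
  qed
  then have "ereal (1 / real (Suc (Max N))) \<le> explosion_time_on \<xi> K \<omega>"
    unfolding explosion_time_on_def by (rule INF_greatest)
  moreover have "0 < ereal (1 / real (Suc (Max N)))" by simp
  ultimately show ?thesis by (rule less_le_trans[rotated])
qed

lemma before_explosion: "ereal t < explosion_time_on \<xi> K \<omega> \<Longrightarrow> x \<in> K \<Longrightarrow> ereal t < \<xi> x \<omega>"
  unfolding explosion_time_on_def by (rule less_INF_D)

text \<open>If the explosion time T were finite, the supremum of distances would exceed
  \<open>R\<close> throughout an interval ending at T, and this interval contains a rational
  time.\<close>

lemma bounded_imp_no_explosion:
  assumes K: "K \<noteq> {}" and \<tau>: "0 < explosion_time_on \<xi> K \<omega>"
    and lim: "explosion_time_on \<xi> K \<omega> < \<infinity> \<longrightarrow>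
      filterlim (\<lambda>t. SUP x\<in>K. rdist b (F t x \<omega>)) at_top
        (at_left (real_of_ereal (explosion_time_on \<xi> K \<omega>)))"
    and R: "\<And>t x. t \<in> \<rat> \<Longrightarrow> 0 \<le> t \<Longrightarrow> ereal t < explosion_time_on \<xi> K \<omega> \<Longrightarrow> x \<in> K \<Longrightarrow>
      rdist b (F t x \<omega>) \<le> R"
  shows "explosion_time_on \<xi> K \<omega> = \<infinity>"
proof (rule ccontr)
  assume "explosion_time_on \<xi> K \<omega> \<noteq> \<infinity>"
  then have fin: "explosion_time_on \<xi> K \<omega> < \<infinity>" by simp
  define T where "T = real_of_ereal (explosion_time_on \<xi> K \<omega>)"
  have T: "explosion_time_on \<xi> K \<omega> = ereal T"
    using fin \<tau> unfolding T_def by (cases "explosion_time_on \<xi> K \<omega>") auto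
  have T0: "0 < T" using \<tau> T by simp
  have "\<forall>\<^sub>F t in at_left T. R < (SUP x\<in>K. rdist b (F t x \<omega>))"
    using lim fin unfolding T_def[symmetric] filterlim_at_top_dense by blast
  then obtain a where a: "a < T" "\<And>t. a < t \<Longrightarrow> t < T \<Longrightarrow> R < (SUP x\<in>K. rdist b (F t x \<omega>))"
    unfolding eventually_at_left[OF T0] by blast
  have "max a 0 < T" using a(1) T0 by simp
  then obtain t where t: "t \<in> \<rat>" "max a 0 < t" "t < T" using Rats_dense_in_real by blast
  have "(SUP x\<in>K. rdist b (F t x \<omega>)) \<le> R"
    using t T by (intro cSUP_least K R) auto
  then show False using a(2)[of t] t by auto
qed

lemma point_bounded:
  assumes "AE \<omega> in P. \<xi> x \<omega> = \<infinity>"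
  shows "AE \<omega> in P. \<exists>R. \<forall>t\<in>{0..T}. rdist b (F t x \<omega>) \<le> R"
  using assms F_paths[of x]
proof eventually_elim
  case (elim \<omega>)
  have "{t. 0 \<le> t \<and> ereal t < \<xi> x \<omega>} = {0..}" using elim(1) by auto
  then have "continuous_on {0..T} (\<lambda>t. F t x \<omega>)"
    using elim(2) by (auto elim: continuous_on_subset)
  then have "compact ((\<lambda>t. F t x \<omega>) ` {0..T})" by (intro compact_continuous_image) auto
  from riem_dist_bounded_compact[OF this, of b] show ?case by auto
qed

text \<open>Moment bounds are available on bounded time intervals only, with an exponent depending
  on the interval, so explosion is excluded before each integer separately.\<close>

lemma AE_complete_from_bounded_times:
  assumes "\<And>n::nat. AE \<omega> in P. explosion_time_on \<xi> K \<omega> < ereal (real (Suc n)) \<longrightarrow> explosion_time_on \<xi> K \<omega> = \<infinity>"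
  shows "AE \<omega> in P. explosion_time_on \<xi> K \<omega> = \<infinity>"
proof -
  have "AE \<omega> in P. \<forall>n::nat. explosion_time_on \<xi> K \<omega> < ereal (real (Suc n)) \<longrightarrow> explosion_time_on \<xi> K \<omega> = \<infinity>"
    by (subst AE_all_countable) (rule allI, rule assms)
  then show ?thesis
  proof eventually_elim
    case (elim \<omega>)
    show ?case
    proof (cases "explosion_time_on \<xi> K \<omega> = \<infinity>")
      case False
      then obtain r :: real where "explosion_time_on \<xi> K \<omega> < ereal r"
        \<comment> \<open>One is added for strictness when the value is finite; 0 serves for minus
          infinity, a possible value of an extended real.\<close>
        by (cases "explosion_time_on \<xi> K \<omega>") (auto intro: that[of "real_of_ereal (explosion_time_on \<xi> K \<omega>) + 1"] that[of 0])
      moreover obtain n where "r \<le> real n" using real_arch_simple[of r] by blast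
      then have "ereal r \<le> ereal (real (Suc n))" by simp
      ultimately have "explosion_time_on \<xi> K \<omega> < ereal (real (Suc n))" by (rule less_le_trans)
      then show ?thesis using elim by blast
    qed simp
  qed
qed

text \<open>The distance of an image point from the image of the start is at most the length of the
  whole image curve, and the start moves along a path that is bounded on bounded time intervals.
  Both bounds are uniform in rational t, which contradicts explosion.\<close>

lemma complete_from_curve_start:
  assumes \<gamma>: "pwC1 \<gamma> 0 1" and start: "AE \<omega> in P. \<xi> (\<gamma> 0) \<omega> = \<infinity>"
  shows "AE \<omega> in P. explosion_time_on \<xi> (\<gamma> ` {0..1}) \<omega> = \<infinity>"
proof (rule AE_complete_from_bounded_times)
  fix n :: nat
  \<comment> \<open>Distances are taken from the arbitrary base point \<open>undefined\<close>.\<close>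
  let ?K = "\<gamma> ` {0..1}" and ?T = "real (Suc n)"
  have K: "compact ?K" "?K \<noteq> {}"
    using pwC1_continuous[OF \<gamma>] by (auto intro: compact_continuous_image)
  obtain \<delta> C where \<delta>: "0 < \<delta>" and C: "C < \<infinity>"
    "\<And>x. x \<in> ?K \<Longrightarrow> moment ?T (real d + \<delta>) x \<le> C"
    by (rule moment_bound[OF _ K(1), of ?T]) (simp, rule that)
  let ?p = "real d + \<delta>"
  have p: "1 \<le> ?p" using d \<delta> by simp
  \<comment> \<open>\<open>length_moment\<close> asks for a number strictly above the length, hence
    the added 1.\<close>
  obtain Z where Z: "Z \<in> borel_measurable P" "(\<integral>\<^sup>+\<omega>. Z \<omega> \<partial>P) \<le> ennreal ((len \<gamma> 0 1 + 1) powr ?p) * C"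
    "AE \<omega> in P. \<forall>t\<in>\<rat> \<inter> {0..?T}. (\<forall>x\<in>?K. ereal t < \<xi> x \<omega>) \<longrightarrow>
      ennreal (len ((\<lambda>x. F t x \<omega>) \<circ> \<gamma>) 0 1 powr ?p) \<le> Z \<omega>"
    using length_moment[OF p \<gamma> order_refl _ C(2), of "len \<gamma> 0 1 + 1"] by auto
  have "(\<integral>\<^sup>+\<omega>. Z \<omega> \<partial>P) \<noteq> \<infinity>"
    using le_less_trans[OF Z(2) ennreal_mult_less_top[THEN iffD2]] C(1) by auto
  then have "AE \<omega> in P. Z \<omega> \<noteq> \<infinity>" by (rule nn_integral_PInf_AE[OF Z(1)])
  then show "AE \<omega> in P. explosion_time_on \<xi> ?K \<omega> < ereal ?T \<longrightarrow> explosion_time_on \<xi> ?K \<omega> = \<infinity>"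
    using Z(3) F_regular point_bounded[OF start, of ?T undefined] explosion[OF K(1), of undefined]
  proof eventually_elim
    case (elim \<omega>)
    note reg = elim(3)
    obtain R where R: "\<And>t. t \<in> {0..?T} \<Longrightarrow> rdist undefined (F t (\<gamma> 0) \<omega>) \<le> R"
      using elim(4) by blast
    have pos: "0 < explosion_time_on \<xi> ?K \<omega>"
      using reg by (intro explosion_time_on_pos K) auto
    show ?case
    proof
      assume less: "explosion_time_on \<xi> ?K \<omega> < ereal ?T"
      show "explosion_time_on \<xi> ?K \<omega> = \<infinity>"
      proof (rule bounded_imp_no_explosion[OF K(2) pos elim(5)])
        fix t x assume t: "t \<in> \<rat>" "0 \<le> t" "ereal t < explosion_time_on \<xi> ?K \<omega>" and x: "x \<in> ?K"
        have "ereal t < ereal ?T" using t(3) less by (rule less_trans)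
        then have tT: "t \<in> \<rat> \<inter> {0..?T}" using t by simp
        have alive: "ereal t < \<xi> x \<omega>" if "x \<in> ?K" for x
          by (rule before_explosion[OF t(3) that])
        let ?\<eta> = "(\<lambda>x. F t x \<omega>) \<circ> \<gamma>"
        have \<eta>: "pwC1 ?\<eta> 0 1"
          by (rule pwC1_image[OF _ _ \<gamma>, of "{x. ereal t < \<xi> x \<omega>}"]) (use reg t alive in auto)
        have "ennreal (len ?\<eta> 0 1 powr ?p) \<le> Z \<omega>" using elim(2) tT alive by blast
        also have "Z \<omega> = ennreal (enn2real (Z \<omega>))" using elim(1) by (simp add: less_top)
        finally have "len ?\<eta> 0 1 powr ?p \<le> enn2real (Z \<omega>)" by (subst (asm) ennreal_le_iff) auto
        then have l: "len ?\<eta> 0 1 \<le> enn2real (Z \<omega>) powr (1 / ?p)"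
          using p by (intro powr_le_imp_le_root len_nonneg \<eta>) auto
        obtain r where r: "x = \<gamma> r" "0 \<le> r" "r \<le> 1" using x by auto
        \<comment> \<open>The start is treated separately because \<open>riem_dist_le_len\<close>
          asks for a nondegenerate interval.\<close>
        have "rdist undefined (F t x \<omega>) \<le> R + len ?\<eta> 0 1"
        proof (cases "r = 0")
          case True
          then show ?thesis using R[of t] tT len_nonneg[OF \<eta>] r by auto
        next
          case False
          have "rdist undefined (F t x \<omega>) \<le>
              rdist undefined (F t (\<gamma> 0) \<omega>) + rdist (?\<eta> 0) (?\<eta> r)"
            using riem_dist_triangle r(1) by simp
          also have "rdist (?\<eta> 0) (?\<eta> r) \<le> len ?\<eta> 0 r"
            by (rule riem_dist_le_len[OF pwC1_subset[OF \<eta>]]) (use False r in auto)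
          also have "len ?\<eta> 0 r \<le> len ?\<eta> 0 1"
            using r by (intro len_mono[OF \<eta>]) auto
          finally show ?thesis using R[of t] tT by auto
        qed
        then show "rdist undefined (F t x \<omega>) \<le> R + enn2real (Z \<omega>) powr (1 / ?p)"
          using l by simp
      qed
    qed
  qed
qed

lemma point_complete: "AE \<omega> in P. \<xi> x \<omega> = \<infinity>"
proof -
  obtain x\<^sub>0 where x0: "AE \<omega> in P. \<xi> x\<^sub>0 \<omega> = \<infinity>" using complete_at_point by blast
  obtain \<gamma> where \<gamma>: "pwC1 \<gamma> 0 1" "\<gamma> 0 = x\<^sub>0" "\<gamma> 1 = x" using curve_exists by blast
  have "AE \<omega> in P. explosion_time_on \<xi> (\<gamma> ` {0..1}) \<omega> = \<infinity>"
    using x0 \<gamma> by (intro complete_from_curve_start) auto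
  then show ?thesis
  proof eventually_elim
    case (elim \<omega>)
    have "explosion_time_on \<xi> (\<gamma> ` {0..1}) \<omega> \<le> \<xi> x \<omega>"
      unfolding explosion_time_on_def using \<gamma>(3) by (intro INF_lower image_eqI[of _ _ 1]) auto
    then show ?case using elim by simp
  qed
qed

lemma curve_complete: "pwC1 \<gamma> 0 1 \<Longrightarrow> AE \<omega> in P. explosion_time_on \<xi> (\<gamma> ` {0..1}) \<omega> = \<infinity>"
  by (intro complete_from_curve_start point_complete)

end

section \<open>Dyadic chaining\<close>

definition grid :: "nat \<Rightarrow> ('d::finite \<Rightarrow> nat) set" where
  "grid m = {k. \<forall>i. k i \<le> 2 ^ m}"

text \<open>The parent of the index \<open>k\<close> of level \<open>m + 1\<close> is \<open>\<lambda>i. k i div 2\<close>; chaining joins every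
  dyadic point to its parent only.\<close>

definition dyadic :: "nat \<Rightarrow> ('d::finite \<Rightarrow> nat) \<Rightarrow> real ^ 'd" where
  "dyadic m k = (\<chi> i. real (k i) / 2 ^ m)"

lemma grid_eq_PiE: "(grid m :: ('d::finite \<Rightarrow> nat) set) = PiE UNIV (\<lambda>_. {..2 ^ m})"
  by (auto simp: grid_def PiE_def)

lemma finite_grid: "finite (grid m :: ('d::finite \<Rightarrow> nat) set)"
  unfolding grid_eq_PiE by (rule finite_PiE) auto

lemma card_grid: "card (grid m :: ('d::finite \<Rightarrow> nat) set) = (2 ^ m + 1) ^ CARD('d)"
  unfolding grid_eq_PiE by (simp add: card_PiE)

lemma grid_parent: "k \<in> grid (Suc m) \<Longrightarrow> (\<lambda>i. k i div 2) \<in> grid m"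
  by (auto simp: grid_def div_le_mono intro: order_trans[OF div_le_mono[of _ "2 * 2 ^ m" 2]])

lemma dyadic_in_cbox: "k \<in> grid m \<Longrightarrow> dyadic m k \<in> cbox 0 1"
  by (auto simp: mem_box_cart dyadic_def grid_def divide_le_eq_1)

text \<open>Passing to the parent drops the last binary digit of every coordinate; bounding the
  Euclidean norm by the sum of the coordinate differences gives the factor
  \<open>CARD('d)\<close>.\<close>

lemma norm_dyadic_parent:
  fixes k :: "'d::finite \<Rightarrow> nat"
  shows "norm (dyadic m (\<lambda>i. k i div 2) - dyadic (Suc m) k) \<le> real CARD('d) / 2 ^ Suc m"
proof -
  have "\<bar>(dyadic m (\<lambda>i. k i div 2) - dyadic (Suc m) k) $ i\<bar> \<le> 1 / 2 ^ Suc m" for i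
  proof -
    have "real (k i) = 2 * real (k i div 2) + real (k i mod 2)"
      by (metis mult_div_mod_eq of_nat_add of_nat_mult of_nat_numeral)
    then have "(dyadic m (\<lambda>i. k i div 2) - dyadic (Suc m) k) $ i = - (real (k i mod 2) / 2 ^ Suc m)"
      by (simp add: dyadic_def field_simps)
    moreover have "real (k i mod 2) \<le> 1" by simp
    ultimately show ?thesis by (simp add: divide_right_mono)
  qed
  then have "(\<Sum>i\<in>UNIV. \<bar>(dyadic m (\<lambda>i. k i div 2) - dyadic (Suc m) k) $ i\<bar>) \<le> (\<Sum>i\<in>(UNIV::'d set). 1 / 2 ^ Suc m)"
    by (intro sum_mono)
  also have "\<dots> = real CARD('d) / 2 ^ Suc m" by simp
  finally show ?thesis by (rule order_trans[OF norm_le_l1_cart])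
qed

text \<open>Every coordinate is rounded down to level m; the coordinate 1 yields the index 2 ^ m,
  which is why the grid includes it.\<close>

lemma dyadic_approximation:
  fixes s :: "real ^ 'd::finite"
  assumes s: "s \<in> cbox 0 1"
  obtains \<kappa> where "\<And>m. \<kappa> m \<in> grid m" "(\<lambda>m. dyadic m (\<kappa> m)) \<longlonglongrightarrow> s"
proof
  define \<kappa> where "\<kappa> m i = nat \<lfloor>2 ^ m * s $ i\<rfloor>" for m i
  have s01: "0 \<le> s $ i" "s $ i \<le> 1" for i using s by (auto simp: mem_box_cart)
  have \<kappa>: "real (\<kappa> m i) = of_int \<lfloor>2 ^ m * s $ i\<rfloor>" for m i
    using s01(1)[of i] by (simp add: \<kappa>_def)
  show "\<kappa> m \<in> grid m" for m
    unfolding grid_def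
  proof (intro CollectI allI)
    fix i
    have "real (\<kappa> m i) \<le> 2 ^ m * s $ i" unfolding \<kappa> by simp
    also have "\<dots> \<le> 2 ^ m * 1" by (intro mult_left_mono s01) simp
    finally have "real (\<kappa> m i) \<le> real (2 ^ m)" by simp
    then show "\<kappa> m i \<le> 2 ^ m" by (simp only: of_nat_le_iff)
  qed
  show "(\<lambda>m. dyadic m (\<kappa> m)) \<longlonglongrightarrow> s"
  proof (rule vec_tendstoI)
    fix i
    have bound: "\<bar>dyadic m (\<kappa> m) $ i - s $ i\<bar> \<le> (1 / 2) ^ m" for m
    proof -
      have "\<bar>real (\<kappa> m i) - 2 ^ m * s $ i\<bar> \<le> 1" unfolding \<kappa> by linarith
      moreover have "dyadic m (\<kappa> m) $ i - s $ i = (real (\<kappa> m i) - 2 ^ m * s $ i) / 2 ^ m"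
        by (simp add: dyadic_def diff_divide_distrib)
      ultimately show ?thesis by (simp add: divide_right_mono power_divide)
    qed
    have "(\<lambda>m. dyadic m (\<kappa> m) $ i - s $ i) \<longlonglongrightarrow> 0"
      by (rule Lim_null_comparison[OF _ LIMSEQ_realpow_zero[of "1/2"]]) (use bound in auto)
    then show "(\<lambda>m. dyadic m (\<kappa> m) $ i) \<longlonglongrightarrow> s $ i" by (rule LIM_zero_cancel)
  qed
qed

text \<open>The factors are the weight of level m, the number of grid points of level m + 1 and the
  moment bound of one link up to a constant. The count cancels the part d of the exponent and leaves
  2^(-m \<delta>); half of this pays for the weight, the other half makes the series
  geometric.\<close>

lemma chaining_weight:
  fixes D \<delta> :: real
  assumes D: "0 < D" and \<delta>: "0 < \<delta>"
  shows "2 powr (real m * \<delta> / 2) * ((2 ^ Suc m + 1) ^ d * (D / 2 ^ Suc m) powr (real d + \<delta>))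
    \<le> 2 ^ d * D powr (real d + \<delta>) * (2 powr (- \<delta> / 2)) ^ m"
proof -
  define x :: real where "x = 2 ^ Suc m"
  have x: "1 \<le> x" unfolding x_def by (rule one_le_power) simp
  then have x0: "0 < x" by simp
  \<comment> \<open>As \<open>x\<close> is at least 1, the number of points per axis is at most
    twice \<open>x\<close>; this is the origin of the factor 2 ^ d.\<close>
  have "(x + 1) ^ d \<le> (2 * x) ^ d" using x by (intro power_mono) auto
  then have 1: "(x + 1) ^ d \<le> 2 ^ d * x powr real d" using x by (simp add: power_mult_distrib powr_realpow)
  have 2: "(D / x) powr (real d + \<delta>) = D powr (real d + \<delta>) * (x powr (- real d) * x powr (- \<delta>))"
  proof -
    have "(D / x) powr (real d + \<delta>) = D powr (real d + \<delta>) * inverse (x powr (real d + \<delta>))"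
      by (subst powr_divide) (use D x0 in \<open>auto simp: divide_inverse\<close>)
    also have "inverse (x powr (real d + \<delta>)) = x powr (- real d) * x powr (- \<delta>)"
      by (simp add: powr_add powr_minus)
    finally show ?thesis .
  qed
  have "x powr (- \<delta>) \<le> (2 ^ m) powr (- \<delta>)"
    using \<delta> by (intro powr_mono2') (auto simp: x_def)
  also have "((2::real) ^ m) powr (- \<delta>) = 2 powr (- (real m * \<delta>))"
    by (simp add: powr_realpow[symmetric] powr_powr)
  finally have 3: "x powr (- \<delta>) \<le> 2 powr (- (real m * \<delta>))" .
  have "2 powr (real m * \<delta> / 2) * ((x + 1) ^ d * (D / x) powr (real d + \<delta>))
    \<le> 2 powr (real m * \<delta> / 2) * ((2 ^ d * x powr real d) * (D powr (real d + \<delta>) * (x powr (- real d) * 2 powr (- (real m * \<delta>)))))"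
    unfolding 2 using 1 3 x by (intro mult_left_mono mult_mono) auto
  also have "\<dots> = 2 ^ d * D powr (real d + \<delta>) * (x powr real d * x powr (- real d)) * (2 powr (real m * \<delta> / 2) * 2 powr (- (real m * \<delta>)))"
    by (simp add: mult_ac)
  also have "x powr real d * x powr (- real d) = 1" using x by (simp add: powr_add[symmetric])
  also have "(2::real) powr (real m * \<delta> / 2) * 2 powr (- (real m * \<delta>)) = (2 powr (- \<delta> / 2)) ^ m"
    by (simp add: powr_add[symmetric] powr_power field_simps)
  finally show ?thesis by (simp add: x_def)
qed

section \<open>Links between dyadic points of a Lipschitz cube\<close>

context riem_manifold begin

lemma Lipschitz_continuous_on:
  fixes \<alpha> :: "'a::real_normed_vector \<Rightarrow> 'm"
  assumes lip: "\<And>s t. s \<in> S \<Longrightarrow> t \<in> S \<Longrightarrow> rdist (\<alpha> s) (\<alpha> t) \<le> C * norm (s - t)"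
  shows "continuous_on S \<alpha>"
  unfolding continuous_on_topological
proof (intro ballI allI impI)
  fix s B assume s: "s \<in> S" and B: "open B" "\<alpha> s \<in> B"
  obtain \<epsilon> where \<epsilon>: "0 < \<epsilon>" "\<And>y. rdist (\<alpha> s) y < \<epsilon> \<Longrightarrow> y \<in> B"
    using riem_dist_small_imp_mem[OF B] by blast
  \<comment> \<open>\<open>C\<close> may be zero or negative; |C| + 1 keeps the radius well defined
    and positive.\<close>
  let ?r = "\<epsilon> / (\<bar>C\<bar> + 1)"
  have "\<alpha> t \<in> B" if t: "t \<in> S" "t \<in> ball s ?r" for t
  proof (rule \<epsilon>(2))
    have n: "norm (s - t) < ?r" using t by (simp add: dist_norm)
    have "rdist (\<alpha> s) (\<alpha> t) \<le> C * norm (s - t)" by (rule lip[OF s t(1)])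
    also have "\<dots> \<le> (\<bar>C\<bar> + 1) * norm (s - t)" by (intro mult_right_mono) auto
    also have "\<dots> < \<epsilon>" using n by (simp add: pos_less_divide_eq mult.commute)
    finally show "rdist (\<alpha> s) (\<alpha> t) < \<epsilon>" .
  qed
  moreover have "s \<in> ball s ?r" using \<epsilon>(1) by simp
  ultimately show "\<exists>A. open A \<and> s \<in> A \<and> (\<forall>y\<in>S. y \<in> A \<longrightarrow> \<alpha> y \<in> B)"
    by (intro exI[of _ "ball s ?r"]) auto
qed

end

context moment_flow begin

text \<open>Almost minimising curves between neighbouring dyadic points may leave the image of the
  cube. From level \<open>m\<^sub>0\<close> on they are shorter than the threshold of
  \<open>compact_neighbourhood\<close> and stay in one compact set, for which a single \<delta> and
  a single moment bound exist.\<close>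

lemma dyadic_curves:
  fixes \<alpha> :: "real ^ 'd::finite \<Rightarrow> 'm"
  assumes dim: "CARD('d) = d"
    and lip: "\<And>s t. s \<in> cbox 0 1 \<Longrightarrow> t \<in> cbox 0 1 \<Longrightarrow> rdist (\<alpha> s) (\<alpha> t) \<le> C * norm (s - t)"
  obtains K m\<^sub>0 D \<gamma> where "compact K" "0 < D"
    "\<And>m k. m\<^sub>0 \<le> m \<Longrightarrow> k \<in> grid (Suc m) \<Longrightarrow> pwC1 (\<gamma> m k) 0 1 \<and> \<gamma> m k 0 = \<alpha> (dyadic m (\<lambda>i. k i div 2)) \<and>
      \<gamma> m k 1 = \<alpha> (dyadic (Suc m) k) \<and> len (\<gamma> m k) 0 1 < D / 2 ^ Suc m \<and> \<gamma> m k ` {0..1} \<subseteq> K"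
proof -
  have "compact (\<alpha> ` cbox 0 1)"
    using Lipschitz_continuous_on[of "cbox 0 1" \<alpha> C] lip by (intro compact_continuous_image) auto
  from compact_neighbourhood[OF this] obtain K \<epsilon> where K: "compact K" "0 < \<epsilon>"
    "\<And>\<gamma>. pwC1 \<gamma> 0 1 \<and> \<gamma> 0 \<in> \<alpha> ` cbox 0 1 \<and> len \<gamma> 0 1 < \<epsilon> \<Longrightarrow> \<gamma> ` {0..1} \<subseteq> K"
    by blast
  \<comment> \<open>The factor \<open>real d\<close> comes from \<open>norm_dyadic_parent\<close>;
    |C| + 1 in place of |C| gives the strict inequality asked for by
    \<open>riem_dist_lessE\<close>.\<close>
  define D where "D = (\<bar>C\<bar> + 1) * real d"
  have D: "0 < D" using d by (simp add: D_def)
  have "(\<lambda>m. D / 2 * (1 / 2) ^ m) \<longlonglongrightarrow> D / 2 * 0"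
    by (intro tendsto_mult tendsto_const LIMSEQ_realpow_zero) auto
  then have "\<forall>\<^sub>F m in sequentially. D / 2 * (1 / 2) ^ m < \<epsilon>"
    using K(2) by (intro order_tendstoD(2)) auto
  then obtain m\<^sub>0 where m0: "\<And>m. m\<^sub>0 \<le> m \<Longrightarrow> D / 2 ^ Suc m < \<epsilon>"
    by (auto simp: eventually_sequentially power_divide)
  let ?good = "\<lambda>m k \<gamma>. pwC1 \<gamma> 0 1 \<and> \<gamma> 0 = \<alpha> (dyadic m (\<lambda>i. k i div 2)) \<and>
      \<gamma> 1 = \<alpha> (dyadic (Suc m) k) \<and> len \<gamma> 0 1 < D / 2 ^ Suc m \<and> \<gamma> ` {0..1} \<subseteq> K"
  have ex: "\<exists>\<gamma>. ?good m k \<gamma>"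
    if m: "m\<^sub>0 \<le> m" and k: "k \<in> grid (Suc m)" for m and k :: "'d \<Rightarrow> nat"
  proof -
    let ?s = "dyadic m (\<lambda>i. k i div 2)" and ?t = "dyadic (Suc m) k"
    have st: "?s \<in> cbox 0 1" "?t \<in> cbox 0 1" using dyadic_in_cbox grid_parent[OF k] k by auto
    have "rdist (\<alpha> ?s) (\<alpha> ?t) \<le> C * norm (?s - ?t)" by (rule lip[OF st])
    also have "\<dots> \<le> \<bar>C\<bar> * (real d / 2 ^ Suc m)"
      using norm_dyadic_parent[of m k] dim by (intro mult_mono) auto
    also have "\<dots> < (\<bar>C\<bar> + 1) * (real d / 2 ^ Suc m)"
      using d by (intro mult_strict_right_mono) auto
    also have "\<dots> = D / 2 ^ Suc m" by (simp add: D_def)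
    finally obtain \<gamma> where \<gamma>: "pwC1 \<gamma> 0 1" "\<gamma> 0 = \<alpha> ?s" "\<gamma> 1 = \<alpha> ?t" "len \<gamma> 0 1 < D / 2 ^ Suc m"
      by (rule riem_dist_lessE)
    have "len \<gamma> 0 1 < \<epsilon>" using \<gamma>(4) m0[OF m] by (rule less_trans)
    then have "\<gamma> ` {0..1} \<subseteq> K" using K(3)[of \<gamma>] \<gamma> st by auto
    then show ?thesis using \<gamma> by blast
  qed
  show ?thesis
  proof (rule that[OF K(1) D])
    show "?good m k (SOME \<gamma>. ?good m k \<gamma>)" if "m\<^sub>0 \<le> m" "k \<in> grid (Suc m)" for m k
      by (rule someI_ex[OF ex[OF that]])
  qed
qed

text \<open>One integrable random variable dominates all links: at level m they have length at most
  y^(1/p) q^m with q < 1, for every rational t in the time interval. Summing along the ancestors of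
  a dyadic point bounds its distance by that of the base level plus a geometric series.\<close>

lemma cube_complete:
  fixes \<alpha> :: "real ^ 'd::finite \<Rightarrow> 'm"
  assumes dim: "CARD('d) = d"
    and lip: "\<And>s t. s \<in> cbox 0 1 \<Longrightarrow> t \<in> cbox 0 1 \<Longrightarrow> rdist (\<alpha> s) (\<alpha> t) \<le> C * norm (s - t)"
  shows "AE \<omega> in P. explosion_time_on \<xi> (\<alpha> ` cbox 0 1) \<omega> = \<infinity>"
proof (rule AE_complete_from_bounded_times)
  fix n :: nat
  let ?T = "real (Suc n)" and ?A = "\<alpha> ` cbox 0 1"
  have cont: "continuous_on (cbox 0 1) \<alpha>" by (rule Lipschitz_continuous_on[OF lip])
  then have A: "compact ?A" by (intro compact_continuous_image) auto
  have "(0::real^'d) \<in> cbox 0 1" by (simp add: mem_box_cart)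
  then have A_ne: "?A \<noteq> {}" by blast
  obtain K m\<^sub>0 D \<gamma> where K: "compact K" and D: "0 < D" and curves:
    "\<And>m k. m\<^sub>0 \<le> m \<Longrightarrow> k \<in> grid (Suc m) \<Longrightarrow> pwC1 (\<gamma> m k) 0 1 \<and> \<gamma> m k 0 = \<alpha> (dyadic m (\<lambda>i. k i div 2)) \<and>
      \<gamma> m k 1 = \<alpha> (dyadic (Suc m) k) \<and> len (\<gamma> m k) 0 1 < D / 2 ^ Suc m \<and> \<gamma> m k ` {0..1} \<subseteq> K"
    by (rule dyadic_curves[OF dim lip], assumption, assumption, rule that)
  have T: "0 < ?T" by simp
  obtain \<delta> B where \<delta>: "0 < \<delta>" and B: "B < \<infinity>"
    "\<And>x. x \<in> K \<Longrightarrow> moment ?T (real d + \<delta>) x \<le> B"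
    by (rule moment_bound[OF T K]) (rule that)
  let ?p = "real d + \<delta>"
  have p: "1 \<le> ?p" using d \<delta> by simp
  let ?ok = "\<lambda>m k Z. Z \<in> borel_measurable P \<and> (\<integral>\<^sup>+\<omega>. Z \<omega> \<partial>P) \<le> ennreal ((D / 2 ^ Suc m) powr ?p) * B \<and>
    (AE \<omega> in P. \<forall>t\<in>\<rat> \<inter> {0..?T}. (\<forall>x\<in>\<gamma> m k ` {0..1}. ereal t < \<xi> x \<omega>) \<longrightarrow>
      ennreal (len ((\<lambda>x. F t x \<omega>) \<circ> \<gamma> m k) 0 1 powr ?p) \<le> Z \<omega>)"
  \<comment> \<open>Chosen for all indices at once; the property is available for grid indices at
    levels from \<open>m\<^sub>0\<close> on.\<close>
  define Z where "Z m k = (SOME Z. ?ok m k Z)" for m k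
  have ok: "?ok m k (Z m k)" if m: "m\<^sub>0 \<le> m" and k: "k \<in> grid (Suc m)" for m k
  proof -
    have c: "pwC1 (\<gamma> m k) 0 1" "len (\<gamma> m k) 0 1 < D / 2 ^ Suc m" "\<gamma> m k ` {0..1} \<subseteq> K"
      using curves[OF m k] by blast+
    show ?thesis
      unfolding Z_def by (rule someI_ex[OF length_moment[OF p c(1,3,2) B(2)]])
  qed
  have Z: "Z m k \<in> borel_measurable P"
      "(\<integral>\<^sup>+\<omega>. Z m k \<omega> \<partial>P) \<le> ennreal ((D / 2 ^ Suc m) powr ?p) * B"
    and Z_AE: "AE \<omega> in P. \<forall>t\<in>\<rat> \<inter> {0..?T}.
      (\<forall>x\<in>\<gamma> m k ` {0..1}. ereal t < \<xi> x \<omega>) \<longrightarrow> ennreal (len ((\<lambda>x. F t x \<omega>) \<circ> \<gamma> m k) 0 1 powr ?p) \<le> Z m k \<omega>"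
    if "m\<^sub>0 \<le> m" "k \<in> grid (Suc m)" for m k
    by (rule ok[OF that, THEN conjunct1], rule ok[OF that, THEN conjunct2, THEN conjunct1],
        rule ok[OF that, THEN conjunct2, THEN conjunct2])
  define a where "a = 2 powr (- \<delta> / 2)"
  have a: "0 < a" "a < 1" using \<delta> by (auto simp: a_def powr_less_one)
  let ?G = "\<lambda>m. grid (Suc m) :: ('d \<Rightarrow> nat) set"
  \<comment> \<open>The weight of level m is the inverse of \<open>a ^ m\<close>, so finiteness of
    \<open>Y\<close> bounds every \<open>Z m k\<close> by \<open>a ^ m\<close> times
    \<open>Y\<close>.\<close>
  define Y where "Y \<omega> = (\<Sum>j. ennreal (2 powr (real (m\<^sub>0 + j) * \<delta> / 2)) * (\<Sum>k\<in>?G (m\<^sub>0 + j). Z (m\<^sub>0 + j) k \<omega>))" for \<omega>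
  have term_meas: "(\<lambda>\<omega>. ennreal (2 powr (real (m\<^sub>0 + j) * \<delta> / 2)) * (\<Sum>k\<in>?G (m\<^sub>0 + j). Z (m\<^sub>0 + j) k \<omega>)) \<in> borel_measurable P" for j
    using Z(1)[of "m\<^sub>0 + j"] by (intro borel_measurable_times_ennreal borel_measurable_sum borel_measurable_const) auto
  have Y_meas: "Y \<in> borel_measurable P"
    unfolding Y_def[abs_def] using term_meas by measurable
  let ?c = "2 ^ d * D powr ?p"
  have "(\<integral>\<^sup>+\<omega>. Y \<omega> \<partial>P) = (\<Sum>j. \<integral>\<^sup>+\<omega>. ennreal (2 powr (real (m\<^sub>0 + j) * \<delta> / 2)) * (\<Sum>k\<in>?G (m\<^sub>0 + j). Z (m\<^sub>0 + j) k \<omega>) \<partial>P)"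
    unfolding Y_def by (rule nn_integral_suminf[OF term_meas])
  also have "\<dots> \<le> (\<Sum>j. ennreal (?c * a ^ (m\<^sub>0 + j)) * B)"
  proof (intro suminf_le summableI)
    fix j
    let ?m = "m\<^sub>0 + j"
    have "(\<integral>\<^sup>+\<omega>. ennreal (2 powr (real ?m * \<delta> / 2)) * (\<Sum>k\<in>?G ?m. Z ?m k \<omega>) \<partial>P)
        = ennreal (2 powr (real ?m * \<delta> / 2)) * (\<Sum>k\<in>?G ?m. \<integral>\<^sup>+\<omega>. Z ?m k \<omega> \<partial>P)"
      using Z(1)[of ?m] by (simp add: nn_integral_cmult nn_integral_sum)
    also have "\<dots> \<le> ennreal (2 powr (real ?m * \<delta> / 2)) * (\<Sum>k\<in>?G ?m. ennreal ((D / 2 ^ Suc ?m) powr ?p) * B)"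
      by (intro mult_left_mono sum_mono Z(2)) auto
    also have "\<dots> = ennreal (2 powr (real ?m * \<delta> / 2)) * (ennreal (real (card (?G ?m))) * (ennreal ((D / 2 ^ Suc ?m) powr ?p) * B))"
      by (simp add: ennreal_of_nat_eq_real_of_nat)
    also have "\<dots> = ennreal (2 powr (real ?m * \<delta> / 2) * (real (card (?G ?m)) * (D / 2 ^ Suc ?m) powr ?p)) * B"
      by (simp add: ennreal_mult' mult.assoc)
    also have "\<dots> \<le> ennreal (?c * a ^ ?m) * B"
    proof (intro mult_right_mono ennreal_leI)
      show "2 powr (real ?m * \<delta> / 2) * (real (card (?G ?m)) * (D / 2 ^ Suc ?m) powr ?p) \<le> ?c * a ^ ?m"
        using chaining_weight[OF D \<delta>, of ?m d] unfolding card_grid dim a_def by (simp add: add.commute)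
    qed simp
    finally show "(\<integral>\<^sup>+\<omega>. ennreal (2 powr (real ?m * \<delta> / 2)) * (\<Sum>k\<in>?G ?m. Z ?m k \<omega>) \<partial>P) \<le> ennreal (?c * a ^ ?m) * B" .
  qed
  also have "\<dots> = (\<Sum>j. ennreal (?c * a ^ (m\<^sub>0 + j))) * B" by (rule ennreal_suminf_multc)
  also have "\<dots> < \<infinity>"
  proof -
    have "summable (\<lambda>j. ?c * a ^ (m\<^sub>0 + j))"
      using a by (simp add: power_add summable_mult summable_geometric)
    then have "(\<Sum>j. ennreal (?c * a ^ (m\<^sub>0 + j))) \<noteq> \<top>"
      using a by (intro ennreal_suminf_neq_top) auto
    then show ?thesis using B(1) by (simp add: ennreal_mult_less_top less_top)
  qed
  finally have "(\<integral>\<^sup>+\<omega>. Y \<omega> \<partial>P) \<noteq> \<infinity>" by simp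
  then have Y_fin: "AE \<omega> in P. Y \<omega> \<noteq> \<infinity>" by (rule nn_integral_PInf_AE[OF Y_meas])
  \<comment> \<open>The links need not lie in the image of the cube, so their survival does not
    follow from that of the cube; it comes from \<open>curve_complete\<close>, for countably many
    curves at once.\<close>
  have curves_AE: "AE \<omega> in P. \<forall>m\<in>{m\<^sub>0..}. \<forall>k\<in>?G m. explosion_time_on \<xi> (\<gamma> m k ` {0..1}) \<omega> = \<infinity> \<and>
      (\<forall>t\<in>\<rat> \<inter> {0..?T}. (\<forall>x\<in>\<gamma> m k ` {0..1}. ereal t < \<xi> x \<omega>) \<longrightarrow>
        ennreal (len ((\<lambda>x. F t x \<omega>) \<circ> \<gamma> m k) 0 1 powr ?p) \<le> Z m k \<omega>)"
  proof (rule AE_ball_countable')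
    fix m assume "m \<in> {m\<^sub>0..}"
    then have m: "m\<^sub>0 \<le> m" by simp
    show "AE \<omega> in P. \<forall>k\<in>?G m. explosion_time_on \<xi> (\<gamma> m k ` {0..1}) \<omega> = \<infinity> \<and>
      (\<forall>t\<in>\<rat> \<inter> {0..?T}. (\<forall>x\<in>\<gamma> m k ` {0..1}. ereal t < \<xi> x \<omega>) \<longrightarrow>
        ennreal (len ((\<lambda>x. F t x \<omega>) \<circ> \<gamma> m k) 0 1 powr ?p) \<le> Z m k \<omega>)"
    proof (rule AE_ball_countable')
      fix k assume k: "k \<in> ?G m"
      have "AE \<omega> in P. explosion_time_on \<xi> (\<gamma> m k ` {0..1}) \<omega> = \<infinity>"
        using curves[OF m k] by (intro curve_complete) blast
      then show "AE \<omega> in P. explosion_time_on \<xi> (\<gamma> m k ` {0..1}) \<omega> = \<infinity> \<and>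
        (\<forall>t\<in>\<rat> \<inter> {0..?T}. (\<forall>x\<in>\<gamma> m k ` {0..1}. ereal t < \<xi> x \<omega>) \<longrightarrow>
          ennreal (len ((\<lambda>x. F t x \<omega>) \<circ> \<gamma> m k) 0 1 powr ?p) \<le> Z m k \<omega>)"
        using Z_AE[OF m k] by (rule AE_conjI)
    qed (intro countable_finite finite_grid)
  qed simp
  \<comment> \<open>Level \<open>m\<^sub>0\<close> has finitely many points, each of them bounded on
    the time interval by its own nonexplosion.\<close>
  have start_AE: "AE \<omega> in P. \<forall>k\<in>(grid m\<^sub>0 :: ('d \<Rightarrow> nat) set).
      \<exists>R. \<forall>t\<in>{0..?T}. rdist undefined (F t (\<alpha> (dyadic m\<^sub>0 k)) \<omega>) \<le> R"
    by (intro AE_ball_countable' point_bounded point_complete countable_finite finite_grid)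
  show "AE \<omega> in P. explosion_time_on \<xi> ?A \<omega> < ereal ?T \<longrightarrow> explosion_time_on \<xi> ?A \<omega> = \<infinity>"
    using Y_fin curves_AE start_AE F_regular explosion[OF A, of undefined]
  proof eventually_elim
    case (elim \<omega>)
    note reg = elim(4)
    have pos: "0 < explosion_time_on \<xi> ?A \<omega>"
      using reg by (intro explosion_time_on_pos A) auto
    obtain R where R: "\<And>k t. k \<in> grid m\<^sub>0 \<Longrightarrow> t \<in> {0..?T} \<Longrightarrow>
        rdist undefined (F t (\<alpha> (dyadic m\<^sub>0 (k :: 'd \<Rightarrow> nat))) \<omega>) \<le> R k"
      using elim(3) by metis
    let ?R = "\<Sum>k\<in>grid m\<^sub>0. \<bar>R k\<bar>"
    define y where "y = enn2real (Y \<omega>)"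
    have y: "Y \<omega> = ennreal y" "0 \<le> y" using elim(1) by (simp_all add: y_def less_top)
    \<comment> \<open>The p-th root appears because lengths, not their p-th powers, are added along
      a chain.\<close>
    define q where "q = a powr (1 / ?p)"
    have q: "0 < q" "q < 1"
      using a p powr_less_mono2[of "1 / ?p" a 1] by (auto simp: q_def)
    show ?case
    proof
      assume less: "explosion_time_on \<xi> ?A \<omega> < ereal ?T"
      show "explosion_time_on \<xi> ?A \<omega> = \<infinity>"
      proof (rule bounded_imp_no_explosion[OF A_ne pos elim(5)])
        fix t x assume t: "t \<in> \<rat>" "0 \<le> t" "ereal t < explosion_time_on \<xi> ?A \<omega>" and x: "x \<in> ?A"
        have "ereal t < ereal ?T" using t(3) less by (rule less_trans)
        then have tT: "t \<in> \<rat> \<inter> {0..?T}" using t by simp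
        let ?f = "\<lambda>x. F t x \<omega>" and ?S = "{x. ereal t < \<xi> x \<omega>}"
        have f: "open ?S" "C1_map_on atl ?S ?f" using reg t(2) by auto
        have link: "rdist (?f (\<alpha> (dyadic m (\<lambda>i. k i div 2)))) (?f (\<alpha> (dyadic (Suc m) k)))
            \<le> y powr (1 / ?p) * q ^ m" if m: "m\<^sub>0 \<le> m" and k: "k \<in> ?G m" for m k
        proof -
          have c: "pwC1 (\<gamma> m k) 0 1" "\<gamma> m k 0 = \<alpha> (dyadic m (\<lambda>i. k i div 2))" "\<gamma> m k 1 = \<alpha> (dyadic (Suc m) k)"
            using curves[OF m k] by auto
          have alive: "ereal t < \<xi> x \<omega>" if "x \<in> \<gamma> m k ` {0..1}" for x
          proof (rule before_explosion[OF _ that])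
            show "ereal t < explosion_time_on \<xi> (\<gamma> m k ` {0..1}) \<omega>" using elim(2) m k by simp
          qed
          let ?\<eta> = "?f \<circ> \<gamma> m k"
          have \<eta>: "pwC1 ?\<eta> 0 1" by (rule pwC1_image[OF f(2,1) c(1)]) (use alive in auto)
          have Zl: "ennreal (len ?\<eta> 0 1 powr ?p) \<le> Z m k \<omega>" using elim(2) m k tT alive by auto
          obtain j where j: "m = m\<^sub>0 + j" using m le_Suc_ex by blast
          have "ennreal (2 powr (real m * \<delta> / 2) * len ?\<eta> 0 1 powr ?p) \<le> ennreal (2 powr (real m * \<delta> / 2)) * Z m k \<omega>"
            using Zl by (simp add: ennreal_mult' mult_left_mono)
          also have "\<dots> \<le> ennreal (2 powr (real m * \<delta> / 2)) * (\<Sum>k\<in>?G m. Z m k \<omega>)"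
            using k by (intro mult_left_mono member_le_sum finite_grid) auto
          also have "\<dots> \<le> Y \<omega>"
            unfolding Y_def j using sum_le_suminf[OF summableI, of "{j}"] by fastforce
          finally have "2 powr (real m * \<delta> / 2) * len ?\<eta> 0 1 powr ?p \<le> y"
            using y by (simp add: ennreal_le_iff)
          then have "a ^ m * (2 powr (real m * \<delta> / 2) * len ?\<eta> 0 1 powr ?p) \<le> a ^ m * y"
            using a by (intro mult_left_mono) auto
          moreover have "a ^ m * (2 powr (real m * \<delta> / 2) * len ?\<eta> 0 1 powr ?p) = len ?\<eta> 0 1 powr ?p"
          proof -
            have "a ^ m * 2 powr (real m * \<delta> / 2) = 1"
              by (simp add: a_def powr_power powr_add[symmetric] field_simps)
            then show ?thesis by (simp only: mult.assoc[symmetric] mult_1)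
          qed
          ultimately have "len ?\<eta> 0 1 powr ?p \<le> y * a ^ m" by (simp only: mult.commute)
          then have "len ?\<eta> 0 1 \<le> (y * a ^ m) powr (1 / ?p)"
            using p by (intro powr_le_imp_le_root len_nonneg \<eta>) auto
          also have "\<dots> = y powr (1 / ?p) * q ^ m"
            using y a by (simp add: powr_mult q_def powr_power powr_realpow[symmetric] powr_powr mult.commute)
          finally show ?thesis using riem_dist_le_len[OF \<eta>] c by simp
        qed
        have chain: "rdist undefined (?f (\<alpha> (dyadic m k))) \<le> ?R + y powr (1 / ?p) * (\<Sum>i<m. q ^ i)"
          if "m\<^sub>0 \<le> m" "k \<in> grid m" for m and k :: "'d \<Rightarrow> nat"
          using that
        proof (induction m arbitrary: k rule: dec_induct)
          case base
          have "rdist undefined (?f (\<alpha> (dyadic m\<^sub>0 k))) \<le> \<bar>R k\<bar>"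
            using R[OF base, of t] tT by auto
          also have "\<dots> \<le> ?R" using base by (intro member_le_sum finite_grid) auto
          also have "\<dots> \<le> ?R + y powr (1 / ?p) * (\<Sum>i<m\<^sub>0. q ^ i)"
            using q by (auto intro!: mult_nonneg_nonneg sum_nonneg)
          finally show ?case .
        next
          case (step m)
          let ?k = "\<lambda>i. k i div 2"
          have "rdist undefined (?f (\<alpha> (dyadic (Suc m) k))) \<le>
              rdist undefined (?f (\<alpha> (dyadic m ?k))) +
              rdist (?f (\<alpha> (dyadic m ?k))) (?f (\<alpha> (dyadic (Suc m) k)))"
            by (rule riem_dist_triangle)
          also have "\<dots> \<le> (?R + y powr (1 / ?p) * (\<Sum>i<m. q ^ i)) + y powr (1 / ?p) * q ^ m"
            by (intro add_mono step.IH[OF grid_parent[OF step.prems]] link[OF \<open>m\<^sub>0 \<le> m\<close> step.prems])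
          also have "\<dots> = ?R + y powr (1 / ?p) * (\<Sum>i<Suc m. q ^ i)" by (simp add: algebra_simps)
          finally show ?case .
        qed
        let ?M = "?R + y powr (1 / ?p) * (1 / (1 - q))"
        have bound: "rdist undefined (?f (\<alpha> (dyadic m k))) \<le> ?M"
          if "m\<^sub>0 \<le> m" "k \<in> grid m" for m and k :: "'d \<Rightarrow> nat"
        proof -
          have "(\<Sum>i<m. q ^ i) \<le> (\<Sum>i. q ^ i)"
            using q by (intro sum_le_suminf summable_geometric) auto
          also have "\<dots> = 1 / (1 - q)" using q by (intro suminf_geometric) auto
          finally have "y powr (1 / ?p) * (\<Sum>i<m. q ^ i) \<le> y powr (1 / ?p) * (1 / (1 - q))"
            by (intro mult_left_mono) auto
          then show ?thesis using chain[OF that] by linarith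
        qed
        obtain s where s: "x = \<alpha> s" "s \<in> cbox 0 1" using x by blast
        obtain \<kappa> where \<kappa>: "\<And>m. \<kappa> m \<in> grid m" "(\<lambda>m. dyadic m (\<kappa> m)) \<longlonglongrightarrow> s"
          using dyadic_approximation[OF s(2)] by blast
        \<comment> \<open>\<open>t\<close> precedes the explosion time of the cube, so the flow at
          time \<open>t\<close> is defined and continuous on its whole image.\<close>
        have "continuous_on (cbox 0 1) (\<lambda>s. ?f (\<alpha> s))"
        proof (rule continuous_on_compose2[OF _ cont])
          show "continuous_on ?S ?f" using f(2) by (simp add: C1_map_on_def)
          show "?A \<subseteq> ?S" using before_explosion[OF t(3)] by blast
        qed
        then have "(\<lambda>m. ?f (\<alpha> (dyadic m (\<kappa> m)))) \<longlonglongrightarrow> ?f x"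
          unfolding s(1)
        proof (rule continuous_on_tendsto_compose[OF _ \<kappa>(2) s(2)])
          show "\<forall>\<^sub>F m in sequentially. dyadic m (\<kappa> m) \<in> cbox 0 1"
            by (intro always_eventually allI dyadic_in_cbox \<kappa>(1))
        qed
        moreover obtain V where V: "open V" "?f x \<in> V" "\<And>y z. y \<in> V \<Longrightarrow> z \<in> V \<Longrightarrow> rdist y z < 1"
          using riem_dist_near[OF zero_less_one, of "?f x"] by blast
        ultimately have "\<forall>\<^sub>F m in sequentially. ?f (\<alpha> (dyadic m (\<kappa> m))) \<in> V"
          by (intro topological_tendstoD)
        then obtain N where N: "\<And>m. N \<le> m \<Longrightarrow> ?f (\<alpha> (dyadic m (\<kappa> m))) \<in> V"
          by (auto simp: eventually_sequentially)
        \<comment> \<open>Level \<open>N\<close> gives closeness to the limit point, level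
          \<open>m\<^sub>0\<close> the bound; the extra 1 below is the bound on distances within
          \<open>V\<close>.\<close>
        let ?m = "max N m\<^sub>0"
        have "rdist undefined (?f x) \<le> rdist undefined (?f (\<alpha> (dyadic ?m (\<kappa> ?m))))
            + rdist (?f (\<alpha> (dyadic ?m (\<kappa> ?m)))) (?f x)"
          by (rule riem_dist_triangle)
        also have "\<dots> \<le> ?M + 1"
          using bound[of ?m "\<kappa> ?m"] \<kappa>(1) V(3)[OF N[of ?m] V(2)] by (intro add_mono) auto
        finally show "rdist undefined (F t x \<omega>) \<le> ?M + 1" .
      qed
    qed
  qed
qed

end

section \<open>Simplices\<close>

context riem_manifold begin

text \<open>Local bounds on the derivative become a common one by compactness, and convexity keeps
  the segment between two points in \<open>S\<close>, so the length of its image gives the Lipschitz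
  estimate.\<close>

lemma smooth_map_Lipschitz_on_convex:
  fixes \<sigma> :: "'a::euclidean_space \<Rightarrow> 'm"
  assumes U: "open U" and \<sigma>: "smooth_map_into atl U \<sigma>" and S: "compact S" "convex S" "S \<subseteq> U"
  shows "\<exists>C\<ge>0. \<forall>x\<in>S. \<forall>y\<in>S. rdist (\<sigma> x) (\<sigma> y) \<le> C * norm (x - y)"
proof -
  have par: "Ck1_param U \<sigma>"
    unfolding Ck1_param_def
  proof (intro conjI ballI U)
    show "continuous_on U \<sigma>" using \<sigma> by (simp add: smooth_map_into_def)
    show "Ck_on 1 (snd c \<circ> \<sigma>) (U \<inter> \<sigma> -` fst c)" if "c \<in> atl" for c
      using \<sigma> that by (intro smooth_on_imp_Ck_on) (simp add: smooth_map_into_def)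
  qed
  have "\<exists>r M. 0 < r \<and> (\<forall>z\<in>cball x r. param_bound \<sigma> M z)" if x: "x \<in> S" for x
    using param_bound_local[OF par, of x] x S(3) by blast
  then obtain r M where rM: "\<And>x. x \<in> S \<Longrightarrow> 0 < r x \<and> (\<forall>z\<in>cball x (r x). param_bound \<sigma> (M x) z)"
    by metis
  obtain T where T: "T \<subseteq> S" "finite T" "S \<subseteq> (\<Union>x\<in>T. ball x (r x))"
    by (rule compactE_image[OF S(1), of S "\<lambda>x. ball x (r x)"]) (use rM in auto)
  let ?C = "\<Sum>x\<in>T. \<bar>M x\<bar>"
  have bound: "param_bound \<sigma> ?C z" if z: "z \<in> S" for z
  proof -
    obtain x where x: "x \<in> T" "z \<in> ball x (r x)" using T(3) z by blast
    have "z \<in> cball x (r x)" using x(2) by simp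
    then have "param_bound \<sigma> (M x) z" using rM T(1) x(1) by blast
    moreover have "M x \<le> ?C"
      using member_le_sum[of x T "\<lambda>x. \<bar>M x\<bar>"] T(2) x(1) by force
    ultimately show ?thesis by (rule param_bound_mono)
  qed
  have "rdist (\<sigma> x) (\<sigma> y) \<le> ?C * norm (x - y)" if xy: "x \<in> S" "y \<in> S" for x y
  proof -
    have seg: "closed_segment x y \<subseteq> S" using S(2) xy by (simp add: closed_segment_subset)
    obtain \<gamma> where \<gamma>: "pwC1 \<gamma> 0 1" "\<gamma> 0 = \<sigma> x" "\<gamma> 1 = \<sigma> y" "len \<gamma> 0 1 \<le> ?C * norm (y - x)"
      by (rule param_segment[OF par, of x y ?C]) (use seg S(3) bound in auto)
    then show ?thesis using riem_dist_le_len[OF \<gamma>(1)] by (simp add: norm_minus_commute)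
  qed
  moreover have "0 \<le> ?C" by (intro sum_nonneg) auto
  ultimately show ?thesis by blast
qed

text \<open>The nearest-point retraction of the cube onto the simplex is 1-Lipschitz.\<close>

lemma smooth_simplices_subset_lipschitz_cubes:
  "smooth_simplices TYPE('d::finite) atl \<subseteq> lipschitz_cubes TYPE('d) atl g"
proof
  fix K assume "K \<in> smooth_simplices TYPE('d) atl"
  let ?S = "convex hull (insert 0 Basis) :: (real ^ 'd) set"
  obtain \<sigma> :: "real ^ 'd \<Rightarrow> 'm" and U where K: "K = \<sigma> ` ?S" and U: "open U" "?S \<subseteq> U" "smooth_map_into atl U \<sigma>"
    using \<open>K \<in> smooth_simplices TYPE('d) atl\<close> unfolding smooth_simplices_def by blast
  have S: "compact ?S" "convex ?S" "?S \<noteq> {}"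
    by (simp_all add: finite_imp_compact_convex_hull)
  obtain C where C: "0 \<le> C" "\<And>x y. x \<in> ?S \<Longrightarrow> y \<in> ?S \<Longrightarrow> rdist (\<sigma> x) (\<sigma> y) \<le> C * norm (x - y)"
    using smooth_map_Lipschitz_on_convex[OF U(1,3) S(1,2) U(2)] by blast
  have "insert 0 Basis \<subseteq> (cbox 0 1 :: (real ^ 'd) set)"
    by (auto simp: mem_box_cart Basis_vec_def axis_def)
  then have cube: "?S \<subseteq> cbox 0 1" by (intro hull_minimal convex_box)
  let ?c = "closest_point ?S"
  have cl: "closed ?S" using S(1) by (rule compact_imp_closed)
  have c: "?c s \<in> ?S" for s by (rule closest_point_in_set[OF cl S(3)])
  \<comment> \<open>The unit cube contains the simplex and the retraction fixes the simplex
    pointwise, so the composition has the same image as \<sigma> on the simplex.\<close>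
  have "K = (\<sigma> \<circ> ?c) ` cbox 0 1"
  proof -
    have "?c ` cbox 0 1 = ?S"
    proof
      show "?S \<subseteq> ?c ` cbox 0 1"
      proof
        fix s assume s: "s \<in> ?S"
        then have "s = ?c s" by (simp add: closest_point_self)
        then show "s \<in> ?c ` cbox 0 1" using s cube by blast
      qed
    qed (use c in blast)
    then show ?thesis unfolding K by (metis image_comp)
  qed
  moreover have "rdist ((\<sigma> \<circ> ?c) s) ((\<sigma> \<circ> ?c) t) \<le> C * norm (s - t)" for s t
  proof -
    have "rdist ((\<sigma> \<circ> ?c) s) ((\<sigma> \<circ> ?c) t) \<le> C * norm (?c s - ?c t)"
      using C(2)[OF c c] by simp
    also have "\<dots> \<le> C * norm (s - t)"
      using closest_point_lipschitz[OF S(2) cl S(3), of s t] C(1) by (intro mult_left_mono) (auto simp: dist_norm)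
    finally show ?thesis .
  qed
  ultimately show "K \<in> lipschitz_cubes TYPE('d) atl g"
    unfolding lipschitz_cubes_def by blast
qed

end

theorem theorem5p2p6:
  fixes atl :: "('m::{t2_space, second_countable_topology}, 'n::finite) chart set"
    and g :: "('m, 'n) metric_tensor"
    and P :: "'w measure" and Fil :: "real \<Rightarrow> 'w measure"
    and B :: "real \<Rightarrow> 'w \<Rightarrow> real ^ 'k::finite"
    and X :: "'m \<Rightarrow> real ^ 'k \<Rightarrow> ('m, 'n) tvec" and A :: "'m \<Rightarrow> ('m, 'n) tvec"
    and F :: "real \<Rightarrow> 'm \<Rightarrow> 'w \<Rightarrow> 'm" and \<xi> :: "'m \<Rightarrow> 'w \<Rightarrow> ereal"
  assumes M: "complete_connected_riemannian_manifold atl g"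
    and filt: "usual_filtration P Fil"
    and BM: "brownian_motion P Fil B"
    and coeff: "C2_coefficients atl X A"
    and flow: "partial_flow P Fil B atl g X A F \<xi>"
    and complete_at_point: "\<exists>x\<^sub>0. AE \<omega> in P. \<xi> x\<^sub>0 \<omega> = \<infinity>"
    and d: "1 \<le> CARD('d::finite)" "CARD('d) \<le> CARD('n)"
    and moments: "\<And>t K. 0 < t \<Longrightarrow> compact K \<Longrightarrow>
      \<exists>\<delta>>0. (SUP x\<in>K. \<integral>\<^sup>+\<omega>. (SUP s\<in>{0..t}.
          ennreal (tangent_map_norm atl g (\<lambda>y. F s y \<omega>) x powr (real CARD('d) + \<delta>))
            * indicator {r. ereal r < \<xi> x \<omega>} s) \<partial>P) < \<infinity>"
  shows "(\<forall>K\<in>lipschitz_cubes TYPE('d) atl g. AE \<omega> in P. explosion_time_on \<xi> K \<omega> = \<infinity>)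
    \<and> strongly_complete TYPE('d) atl P \<xi>"
proof -
  have sol: "sde_solution P Fil B atl X A x (\<lambda>t. F t x) (\<xi> x)" for x
    using flow by (simp add: partial_flow_def maximal_solution_def)
  have "stochastic_flow atl g P F \<xi>"
  proof (intro stochastic_flow.intro riem_manifold.intro stochastic_flow_axioms.intro)
    show "smooth_atlas atl" "riemannian_metric atl g" "connected (UNIV :: 'm set)"
      using M by (auto simp: complete_connected_riemannian_manifold_def)
    show "prob_space P" using filt by (simp add: usual_filtration_def)
    fix x t and U :: "'m set" assume "(0::real) \<le> t" "U \<in> sets borel"
    then have "{\<omega> \<in> space P. ereal t < \<xi> x \<omega> \<and> F t x \<omega> \<in> U} \<in> sets (Fil t)"
      using sol[of x] unfolding sde_solution_def by blast
    moreover have "subalgebra P (Fil t)"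
      using filt \<open>0 \<le> t\<close> unfolding usual_filtration_def by blast
    ultimately show "{\<omega> \<in> space P. ereal t < \<xi> x \<omega> \<and> F t x \<omega> \<in> U} \<in> sets P"
      unfolding subalgebra_def by blast
  next
    fix x
    have "AE \<omega> in P. 0 < \<xi> x \<omega> \<and> F 0 x \<omega> = x \<and> continuous_on {t. 0 \<le> t \<and> ereal t < \<xi> x \<omega>} (\<lambda>t. F t x \<omega>)"
      using sol[of x] unfolding sde_solution_def by blast
    then show "AE \<omega> in P. continuous_on {t. 0 \<le> t \<and> ereal t < \<xi> x \<omega>} (\<lambda>t. F t x \<omega>)"
      by eventually_elim simp
  next
    have "AE \<omega> in P. (\<forall>x. 0 < \<xi> x \<omega>) \<and>
        (\<forall>t\<ge>0. open {x. ereal t < \<xi> x \<omega>} \<and>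
           C1_open_diffeo atl {x. ereal t < \<xi> x \<omega>} (\<lambda>x. F t x \<omega>)) \<and>
        C1_compacta_continuous atl (\<lambda>t x. F t x \<omega>) (\<lambda>x. \<xi> x \<omega>)"
      using flow unfolding partial_flow_def by blast
    then show "AE \<omega> in P. (\<forall>x. 0 < \<xi> x \<omega>) \<and>
        (\<forall>t\<ge>0. open {x. ereal t < \<xi> x \<omega>} \<and> C1_map_on atl {x. ereal t < \<xi> x \<omega>} (\<lambda>x. F t x \<omega>))"
      by eventually_elim (simp add: C1_open_diffeo_def)
  next
    fix b and K :: "'m set" assume "compact K"
    then show "AE \<omega> in P. explosion_time_on \<xi> K \<omega> < \<infinity> \<longrightarrow>
      filterlim (\<lambda>t. SUP x\<in>K. riem_dist atl g b (F t x \<omega>)) at_top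
        (at_left (real_of_ereal (explosion_time_on \<xi> K \<omega>)))"
      using flow unfolding partial_flow_def by blast
  qed
  then interpret stochastic_flow atl g P F \<xi> .
  \<comment> \<open>Unfolding \<open>moment\<close> turns the hypothesis of the locale into that of
    the theorem.\<close>
  interpret moment_flow atl g P F \<xi> "CARD('d)"
    by unfold_locales (rule d(1), rule complete_at_point, unfold moment_def, rule moments)
  have cubes: "AE \<omega> in P. explosion_time_on \<xi> K \<omega> = \<infinity>" if K: "K \<in> lipschitz_cubes TYPE('d) atl g" for K
  proof -
    obtain \<alpha> :: "real ^ 'd \<Rightarrow> 'm" and C where \<alpha>: "K = \<alpha> ` cbox 0 1"
      "\<And>s t. s \<in> cbox 0 1 \<Longrightarrow> t \<in> cbox 0 1 \<Longrightarrow> riem_dist atl g (\<alpha> s) (\<alpha> t) \<le> C * norm (s - t)"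
      using K unfolding lipschitz_cubes_def by blast
    show ?thesis unfolding \<alpha>(1) by (rule cube_complete[OF refl \<alpha>(2)])
  qed
  then show ?thesis
    unfolding strongly_complete_def using smooth_simplices_subset_lipschitz_cubes by blast
qed

end
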